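(* Let $U$ be an open disk in a translation surface containing the basepoint. Then the set $$\{S\in\mathcal{M}: U\hookrightarrow S\}$$ of pointed translation surfaces into which $U$ embeds is compact in the immersive topology on $\mathcal{M}$.
   Context: Surfaces and translation structures. A surface is a connected oriented 2-manifold without boundary (possibly non-compact). A translation atlas on a surface $X$ is a collection of pairs $(U_j,\phi_j)$ with the $U_j$ open and covering $X$, and $\phi_j:U_j\to\mathbb{R}^2$ orientation preserving local homeomorphisms, such that on overlaps $U_i\cap U_j$ the transition functions $\phi_i\circ\phi_j^{-1}$ are locally restrictions of translations (i.e. $\phi_i-\phi_j$ is locally constant on $U_i\cap U_j$). A translation structure is a pair $(X,\mathcal{A})$ with $\mathcal{A}$ a maximal translation atlas on $X$. A pointed translation structure is $(X,x_0,\mathcal{A})$ with basepoint $x_0\in X$. An isomorphism $(X,x_0,\mathcal{A})\to(Y,y_0,\mathcal{B})$ is a homeomorphism $h:X\to Y$ with $h(x_0)=y_0$ and $\mathcal{B}=\{(h(U),\phi\circ h^{-1}):(U,\phi)\in\mathcal{A}\}$. $\mathcal{M}$ is the set of all isomorphism classes of pointed translation structures. One identifies a point of $\mathcal{M}$ with a translation surface $S$ representing it, with basepoint denoted $o_S$. Immersions and embeddings. $PC(S)$ is the collection of path-connected subsets of $S$ containing $o_S$. For $A\in PC(S)$ and $B\subset T$ (with $S,T$ translation surfaces), an immersion of $A$ into $B$ is a continuous map $\iota:A\to B$ with $\iota(o_S)=o_T$ such that each $s\in A$ has a chart $(U,\phi)$ of $S$ with $s\in U$, a chart $(V,\psi)$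 of $T$, and a vector $v\in\mathbb{R}^2$ with $\iota(U\cap A)\subset V$ and $\psi\circ\iota(s')=v+\phi(s')$ for all $s'\in U\cap A$ (charts from the maximal atlases). Immersions are unique when they exist. Write $A\rightsquigarrow B$ if an immersion exists and $A\not\rightsquigarrow B$ otherwise. An embedding is an injective immersion; write $A\hookrightarrow B$ if an embedding exists. Disks. An open disk is a path-connected subset of a translation surface, containing the basepoint, homeomorphic to an open disk. A closed disk is a subset of a translation surface homeomorphic to a closed disk and containing the basepoint in its interior; $D^\circ$ denotes the interior of $D$. Immersive topology on $\mathcal{M}$: the coarsest topology in which all the following sets are open: $\{S: D\rightsquigarrow S\}$ for $D$ a closed disk; $\{S: U\not\rightsquigarrow S\}$ for $U$ an open disk; $\mathcal{M}_+(D,U)=\{S:\exists\,\iota:D\rightsquigarrow S\text{ and }o_S\in\iota(U)\}$ for $D$ a closed disk and $U\subset D^\circ$ open; $\mathcal{M}_-(D,K)=\{S:\exists\,\iota:D\rightsquigarrow S\text{ and }o_S\notin\iota(K)\}$ for $D$ a closed disk and $K\subset D$ closed. *)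

theory Defs
  imports "HOL-Analysis.Analysis"
begin

type_synonym plane = "real^2"

definition surface :: "'a topology \<Rightarrow> bool" where
  "surface X \<longleftrightarrow>
     connected_space X \<and> Hausdorff_space X \<and> second_countable X \<and>
     (\<forall>x\<in>topspace X. \<exists>W. openin X W \<and> x \<in> W \<and>
        (\<exists>V::plane set. open V \<and> subtopology X W homeomorphic_space top_of_set V))"

definition local_homeomorphism_on :: "'a topology \<Rightarrow> 'a set \<Rightarrow> ('a \<Rightarrow> plane) \<Rightarrow> bool" where
  "local_homeomorphism_on X U \<phi> \<longleftrightarrow>
     (\<forall>x\<in>U. \<exists>W. openin X W \<and> x \<in> W \<and> W \<subseteq> U \<and> open (\<phi> ` W) \<and>
        homeomorphic_map (subtopology X W) (top_of_set (\<phi> ` W)) \<phi>)"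

definition translation_compatible ::
    "'a topology \<Rightarrow> 'a set \<times> ('a \<Rightarrow> plane) \<Rightarrow> 'a set \<times> ('a \<Rightarrow> plane) \<Rightarrow> bool" where
  "translation_compatible X = (\<lambda>(U,\<phi>) (V,\<psi>).
     \<forall>x\<in>U \<inter> V. \<exists>W v. openin X W \<and> x \<in> W \<and> W \<subseteq> U \<inter> V \<and> (\<forall>y\<in>W. \<phi> y - \<psi> y = v))"

text \<open>
  A chart is only defined on its domain \<open>U\<close>; requiring it to be \<open>extensional\<close> makes equality of
  charts agree with equality of partial maps.

  The orientation of the surface is not recorded separately. Translations preserve the orientation
  of the plane, so an atlas as below pulls back one orientation of the surface, which is the only one
  for which all charts preserve orientation. Isomorphisms carry atlas to atlas and so respect it.
\<close>

definition translation_atlas :: "'a topology \<Rightarrow> ('a set \<times> ('a \<Rightarrow> plane)) set \<Rightarrow> bool" where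
  "translation_atlas X A \<longleftrightarrow>
     (\<forall>(U,\<phi>)\<in>A. openin X U \<and> \<phi> \<in> extensional U \<and> local_homeomorphism_on X U \<phi>) \<and>
     (\<Union>(U,\<phi>)\<in>A. U) = topspace X \<and>
     (\<forall>c\<in>A. \<forall>d\<in>A. translation_compatible X c d)"

definition maximal_translation_atlas :: "'a topology \<Rightarrow> ('a set \<times> ('a \<Rightarrow> plane)) set \<Rightarrow> bool" where
  "maximal_translation_atlas X A \<longleftrightarrow>
     translation_atlas X A \<and> (\<forall>B. translation_atlas X B \<and> A \<subseteq> B \<longrightarrow> B = A)"

record 'a pointed =
  space_of :: "'a topology"
  basept :: 'a
  charts :: "('a set \<times> ('a \<Rightarrow> plane)) set"

definition pointed_translation_structure :: "'a pointed \<Rightarrow> bool" where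
  "pointed_translation_structure S \<longleftrightarrow>
     surface (space_of S) \<and> basept S \<in> topspace (space_of S) \<and>
     maximal_translation_atlas (space_of S) (charts S)"

definition isomorphism :: "('a \<Rightarrow> 'b) \<Rightarrow> 'a pointed \<Rightarrow> 'b pointed \<Rightarrow> bool" where
  "isomorphism h S T \<longleftrightarrow>
     homeomorphic_map (space_of S) (space_of T) h \<and> h (basept S) = basept T \<and>
     charts T = (\<lambda>(U,\<phi>). (h ` U, restrict (\<phi> \<circ> inv_into (topspace (space_of S)) h) (h ` U))) ` charts S"

text \<open>
  A connected second countable Hausdorff surface has the cardinality of the continuum, so every
  pointed translation structure is isomorphic to one whose points are real numbers. Using the type
  \<^typ>\<open>real\<close> for the points therefore yields all isomorphism classes, each exactly once.
\<close>

definition iso_rel :: "(real pointed \<times> real pointed) set" where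
  "iso_rel = {(S,T). pointed_translation_structure S \<and> pointed_translation_structure T \<and>
     (\<exists>h. isomorphism h S T)}"

definition moduli :: "real pointed set set" where
  "moduli = {S. pointed_translation_structure S} // iso_rel"

text \<open>
  The classes of the surfaces with property \<open>P\<close>. It is only used for properties \<open>P\<close> invariant
  under isomorphism, so the choice of representative does not matter.
\<close>

definition classes_of :: "(real pointed \<Rightarrow> bool) \<Rightarrow> real pointed set set" where
  "classes_of P = {c \<in> moduli. \<exists>S\<in>c. P S}"

definition PC :: "'a pointed \<Rightarrow> 'a set set" where
  "PC S = {A. path_connectedin (space_of S) A \<and> basept S \<in> A}"

definition immersion :: "'a pointed \<Rightarrow> 'a set \<Rightarrow> 'b pointed \<Rightarrow> 'b set \<Rightarrow> ('a \<Rightarrow> 'b) \<Rightarrow> bool" where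
  "immersion S A T B \<iota> \<longleftrightarrow>
     A \<in> PC S \<and> B \<subseteq> topspace (space_of T) \<and>
     continuous_map (subtopology (space_of S) A) (subtopology (space_of T) B) \<iota> \<and>
     \<iota> (basept S) = basept T \<and>
     (\<forall>s\<in>A. \<exists>(U,\<phi>)\<in>charts S. \<exists>(V,\<psi>)\<in>charts T. \<exists>v.
        s \<in> U \<and> \<iota> ` (U \<inter> A) \<subseteq> V \<and> (\<forall>s'\<in>U \<inter> A. \<psi> (\<iota> s') = v + \<phi> s'))"

definition immerses :: "'a pointed \<Rightarrow> 'a set \<Rightarrow> 'b pointed \<Rightarrow> 'b set \<Rightarrow> bool" where
  "immerses S A T B \<longleftrightarrow> (\<exists>\<iota>. immersion S A T B \<iota>)"

definition embeds :: "'a pointed \<Rightarrow> 'a set \<Rightarrow> 'b pointed \<Rightarrow> 'b set \<Rightarrow> bool" where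
  "embeds S A T B \<longleftrightarrow> (\<exists>\<iota>. immersion S A T B \<iota> \<and> inj_on \<iota> A)"

abbreviation whole :: "'a pointed \<Rightarrow> 'a set" where
  "whole S \<equiv> topspace (space_of S)"

definition open_disk :: "'a pointed \<Rightarrow> 'a set \<Rightarrow> bool" where
  "open_disk S U \<longleftrightarrow> U \<in> PC S \<and>
     subtopology (space_of S) U homeomorphic_space top_of_set (ball (0::plane) 1)"

definition closed_disk :: "'a pointed \<Rightarrow> 'a set \<Rightarrow> bool" where
  "closed_disk S D \<longleftrightarrow> D \<subseteq> whole S \<and>
     subtopology (space_of S) D homeomorphic_space top_of_set (cball (0::plane) 1) \<and>
     basept S \<in> space_of S interior_of D"

definition moduli_plus :: "real pointed \<Rightarrow> real set \<Rightarrow> real set \<Rightarrow> real pointed set set" where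
  "moduli_plus R D U =
     classes_of (\<lambda>S. \<exists>\<iota>. immersion R D S (whole S) \<iota> \<and> basept S \<in> \<iota> ` U)"

definition moduli_minus :: "real pointed \<Rightarrow> real set \<Rightarrow> real set \<Rightarrow> real pointed set set" where
  "moduli_minus R D K =
     classes_of (\<lambda>S. \<exists>\<iota>. immersion R D S (whole S) \<iota> \<and> basept S \<notin> \<iota> ` K)"

definition immersive_subbasis :: "real pointed set set set" where
  "immersive_subbasis =
     {classes_of (\<lambda>S. immerses R D S (whole S)) | (R::real pointed) D.
        pointed_translation_structure R \<and> closed_disk R D} \<union>
     {classes_of (\<lambda>S. \<not> immerses R U S (whole S)) | (R::real pointed) U.
        pointed_translation_structure R \<and> open_disk R U} \<union>
     {moduli_plus R D U | R D U.
        pointed_translation_structure R \<and> closed_disk R D \<and>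
        openin (space_of R) U \<and> U \<subseteq> space_of R interior_of D} \<union>
     {moduli_minus R D K | R D K.
        pointed_translation_structure R \<and> closed_disk R D \<and>
        closedin (space_of R) K \<and> K \<subseteq> D}"

text \<open>
  \<^const>\<open>moduli\<close> is inserted because \<^const>\<open>topology_generated_by\<close> takes the union of the
  generating sets as the whole space.
\<close>

definition immersive_topology :: "real pointed set topology" where
  "immersive_topology = topology_generated_by (insert moduli immersive_subbasis)"

end

theory Submission
  imports Defs
begin

text \<open>
  Compactness is tested on ultrafilters: every ultrafilter \<open>F\<close> on the set of classes into which \<open>U\<close>
  embeds has to converge to a member of that set. Choose a representative \<open>T i\<close> of every class \<open>i\<close>.
  The limit is the nonstandard hull of the family \<open>T\<close>. Its points are sections \<open>a\<close>, that is,
  choices of a point \<open>a i\<close> of each \<open>T i\<close>, which are reached from the basepoints by finitely many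
  straight moves inside immersed disks, with bounds on the moves that do not depend on
  \<open>i\<close>. Sections \<open>a\<close> and \<open>b\<close> are identified when for every \<open>\<delta> > 0\<close> a move shorter than \<open>\<delta>\<close> leads from
  \<open>a i\<close> to \<open>b i\<close> for \<open>F\<close>-almost all \<open>i\<close>.
  Moving a section by a fixed vector gives the charts of the limit.

  That these are charts is where the embeddings of \<open>U\<close> enter. They provide embedded disks of one
  common radius at all basepoints. Injectivity of moves travels along immersed disks, by unique
  continuation of local translations, so every reachable section has embedded disks whose radius does not
  depend on \<open>i\<close> (\<open>reachable_embedded\<close>). The limit is Hausdorff because of the identification, it is
  connected because every step of a section is a move inside one disk of the limit, and it is second
  countable because the sections obtained by rational moves are dense (\<open>chain_dense\<close>).

  Convergence has to be checked on the four kinds of subbasic sets. Immersions of an open disk into \<open>F\<close>-almost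
  all \<open>T i\<close> have a pointwise limit, which is injective when they are (\<open>limit_translation_on\<close>, \<open>limit_inj\<close>);
  so \<open>U\<close> embeds in the limit, and an open disk that does not immerse in the limit fails to immerse
  in \<open>T i\<close> for almost all \<open>i\<close>.
  Conversely, an immersion \<open>f\<close> of a closed disk \<open>D\<close> into the limit lifts to almost all \<open>T i\<close>
  (\<open>immersion_lift\<close>). On a small piece of \<open>D\<close> around a point \<open>x\<close> with coordinate \<open>\<phi>\<close>, the lift
  sends \<open>y\<close> to the point obtained from \<open>a i\<close> by the move \<open>\<phi> y - \<phi> x\<close>, where \<open>a\<close> represents \<open>f x\<close>.
  As \<open>D\<close> is a topological square it is cut into small rectangles, and lifts over adjacent rectangles
  are glued along the common edge, which is connected. The lifts converge
  to \<open>f\<close> even along moving arguments, and this decides whether the basepoint lies in the image of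
  an open or a closed part of \<open>D\<close>.
\<close>

section \<open>Ultrafilters\<close>

definition ultrafilter :: "'i filter \<Rightarrow> bool" where
  "ultrafilter F \<longleftrightarrow> F \<noteq> bot \<and> (\<forall>P. eventually P F \<or> eventually (\<lambda>x. \<not> P x) F)"

lemma ultrafilter_not_eventually:
  assumes "ultrafilter F" "\<not> eventually P F"
  shows "eventually (\<lambda>x. \<not> P x) F"
  using assms unfolding ultrafilter_def by blast

lemma ultrafilter_not_False: "ultrafilter F \<Longrightarrow> \<not> eventually (\<lambda>x. False) F"
  by (simp add: ultrafilter_def)

lemma ultrafilter_eventually_ex: "ultrafilter F \<Longrightarrow> eventually P F \<Longrightarrow> \<exists>x. P x"
  using eventually_happens'[of F P] by (auto simp: ultrafilter_def)

lemma ultrafilter_exists_below: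
  fixes F0 :: "'i filter"
  assumes "F0 \<noteq> bot"
  obtains F where "F \<le> F0" "ultrafilter F"
proof -
  let ?A = "{G. G \<le> F0 \<and> G \<noteq> bot}"
  let ?P = "\<lambda>G H :: 'i filter. H \<le> G"
  have po: "partial_order_on ?A (relation_of ?P ?A)"
    by (rule partial_order_on_relation_ofI) auto
  have "\<exists>m\<in>?A. \<forall>a\<in>?A. ?P m a \<longrightarrow> a = m"
  proof (rule predicate_Zorn[OF po])
    fix C assume C: "C \<in> Chains (relation_of ?P ?A)"
    then have CA: "C \<subseteq> ?A"
      by (auto simp: Chains_def relation_of_def)
    have tot: "G \<le> H \<or> H \<le> G" if "G \<in> C" "H \<in> C" for G H
      using C that by (auto simp: Chains_def relation_of_def)
    show "\<exists>u\<in>?A. \<forall>a\<in>C. ?P a u"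
    proof (cases "C = {}")
      case True
      then show ?thesis using assms by auto
    next
      case False
      have "eventually P (Inf C) \<longleftrightarrow> (\<exists>G\<in>C. eventually P G)" for P
        by (rule eventually_Inf_base[OF False]) (use tot in \<open>metis inf.absorb1 inf.absorb2 order_refl\<close>)
      then have "Inf C \<noteq> bot"
        using CA unfolding trivial_limit_def by blast
      moreover have "Inf C \<le> F0"
        using False CA by (metis (mono_tags, lifting) Inf_lower2 all_not_in_conv mem_Collect_eq subsetD)
      ultimately show ?thesis
        by (auto intro!: bexI[of _ "Inf C"] Inf_lower)
    qed
  qed
  then obtain F where F: "F \<le> F0" "F \<noteq> bot" and max: "\<And>G. G \<le> F0 \<Longrightarrow> G \<noteq> bot \<Longrightarrow> G \<le> F \<Longrightarrow> G = F"
    by blast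
  have "eventually P F \<or> eventually (\<lambda>x. \<not> P x) F" for P
  proof (cases "inf F (principal {x. P x}) = bot")
    case True
    then have "eventually (\<lambda>_. False) (inf F (principal {x. P x}))" by simp
    then have "eventually (\<lambda>x. \<not> P x) F"
      by (simp add: eventually_inf_principal)
    then show ?thesis ..
  next
    case False
    then have "inf F (principal {x. P x}) = F"
      by (intro max) (use F in \<open>auto intro: le_infI1\<close>)
    moreover have "eventually P (inf F (principal {x. P x}))"
      by (simp add: eventually_inf_principal)
    ultimately have "eventually P F" by simp
    then show ?thesis ..
  qed
  then show ?thesis using that F unfolding ultrafilter_def by blast
qed

lemma ultrafilter_limit_compactin:
  assumes F: "ultrafilter F" and K: "compactin X K" and u: "eventually (\<lambda>i. u i \<in> K) F"
  obtains x where "x \<in> K" "limitin X u x F"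
proof (rule ccontr)
  assume neg: "\<not> thesis"
  define \<U> where "\<U> = {O'. openin X O' \<and> eventually (\<lambda>i. u i \<notin> O') F}"
  have "K \<subseteq> \<Union>\<U>"
  proof
    fix x assume x: "x \<in> K"
    then have "\<not> limitin X u x F" using neg that by blast
    moreover have "x \<in> topspace X" using x K compactin_subset_topspace by blast
    ultimately obtain O' where "openin X O'" "x \<in> O'" "\<not> eventually (\<lambda>i. u i \<in> O') F"
      unfolding limitin_def by blast
    then show "x \<in> \<Union>\<U>"
      unfolding \<U>_def using ultrafilter_not_eventually[OF F] by blast
  qed
  then obtain \<F> where fin: "finite \<F>" and \<F>: "\<F> \<subseteq> \<U>" "K \<subseteq> \<Union>\<F>"
    using K unfolding compactin_def \<U>_def by (metis (no_types, lifting) mem_Collect_eq)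
  have "eventually (\<lambda>i. \<forall>O'\<in>\<F>. u i \<notin> O') F"
    using fin \<F>(1) by (auto simp: eventually_ball_finite_distrib \<U>_def)
  with u have "eventually (\<lambda>i. False) F"
    by eventually_elim (use \<F> in blast)
  then show False using ultrafilter_not_False[OF F] by blast
qed

section \<open>Local translations between translation surfaces\<close>

text \<open>
  The atlas may be any translation atlas, so that the plane with the identity as its only chart is an
  instance.
\<close>

definition tsurf :: "'a pointed \<Rightarrow> bool" where
  "tsurf S \<longleftrightarrow> Hausdorff_space (space_of S) \<and> translation_atlas (space_of S) (charts S)"

lemma pts_tsurf: "pointed_translation_structure S \<Longrightarrow> tsurf S"
  by (simp add: tsurf_def pointed_translation_structure_def surface_def maximal_translation_atlas_def)

lemma chart_open: "tsurf S \<Longrightarrow> (U,\<phi>) \<in> charts S \<Longrightarrow> openin (space_of S) U"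
  unfolding tsurf_def translation_atlas_def by blast

lemma chart_cover:
  assumes "tsurf S" "x \<in> whole S"
  obtains U \<phi> where "(U,\<phi>) \<in> charts S" "x \<in> U"
proof -
  have "(\<Union>(U,\<phi>)\<in>charts S. U) = whole S"
    using assms(1) unfolding tsurf_def translation_atlas_def by blast
  with assms(2) show ?thesis using that by (auto simp: set_eq_iff)
qed

lemma chart_compat:
  assumes S: "tsurf S" and 1: "(U,\<phi>) \<in> charts S" "(V,\<psi>) \<in> charts S" and x: "x \<in> U" "x \<in> V"
  obtains W where "openin (space_of S) W" "x \<in> W" "W \<subseteq> U \<inter> V"
    "\<And>y. y \<in> W \<Longrightarrow> \<phi> y - \<psi> y = \<phi> x - \<psi> x"
proof -
  have "translation_compatible (space_of S) (U,\<phi>) (V,\<psi>)"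
    using S 1 unfolding tsurf_def translation_atlas_def by blast
  then obtain W v where "openin (space_of S) W" "x \<in> W" "W \<subseteq> U \<inter> V" "\<forall>y\<in>W. \<phi> y - \<psi> y = v"
    using x unfolding translation_compatible_def by (simp add: Ball_def) metis
  then show ?thesis using that by (metis)
qed

lemma chart_homeo:
  assumes S: "tsurf S" and 1: "(U,\<phi>) \<in> charts S" and x: "x \<in> U"
  obtains W where "openin (space_of S) W" "x \<in> W" "W \<subseteq> U" "open (\<phi> ` W)"
    "homeomorphic_map (subtopology (space_of S) W) (top_of_set (\<phi> ` W)) \<phi>"
    "inj_on \<phi> W" "continuous_map (subtopology (space_of S) W) euclidean \<phi>"
proof -
  have "local_homeomorphism_on (space_of S) U \<phi>"
    using S 1 unfolding tsurf_def translation_atlas_def by blast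
  then obtain W where W: "openin (space_of S) W" "x \<in> W" "W \<subseteq> U" "open (\<phi> ` W)"
    and h: "homeomorphic_map (subtopology (space_of S) W) (top_of_set (\<phi> ` W)) \<phi>"
    using x unfolding local_homeomorphism_on_def by blast
  have "inj_on \<phi> W"
    using homeomorphic_imp_injective_map[OF h] W(1) openin_subset
    by (metis inf.absorb2 topspace_subtopology)
  moreover have "continuous_map (subtopology (space_of S) W) euclidean \<phi>"
    using h continuous_map_in_subtopology homeomorphic_imp_continuous_map by blast
  ultimately show ?thesis by (rule that[OF W h])
qed

lemma chart_cont:
  assumes S: "tsurf S" and 1: "(U,\<phi>) \<in> charts S" and x: "x \<in> U" and e: "e > 0"
  obtains W where "openin (space_of S) W" "x \<in> W" "W \<subseteq> U" "\<And>y. y \<in> W \<Longrightarrow> norm (\<phi> y - \<phi> x) < e"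
proof -
  obtain W where W: "openin (space_of S) W" "x \<in> W" "W \<subseteq> U"
    and c: "continuous_map (subtopology (space_of S) W) euclidean \<phi>"
    by (rule chart_homeo[OF S 1 x]) (rule that)
  have "openin (subtopology (space_of S) W) {y \<in> topspace (subtopology (space_of S) W). \<phi> y \<in> ball (\<phi> x) e}"
    using c unfolding continuous_map_def by auto
  then have o: "openin (space_of S) {y \<in> W. \<phi> y \<in> ball (\<phi> x) e}"
    using W(1) openin_subset[OF W(1)] by (simp add: openin_open_subtopology inf.absorb2)
  show ?thesis
    by (rule that[OF o]) (use W x e in \<open>auto simp: dist_norm norm_minus_commute\<close>)
qed

text \<open>
  The pointwise form of being continuous and, in charts, a translation. It makes sense for arbitrary
  \<open>A\<close>, such as disks with a wild boundary, and it is local in \<open>A\<close>. Continuity is a separate condition because a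
  chart need not be injective: a map could jump between points with the same coordinates.
\<close>

definition translation_at :: "'a pointed \<Rightarrow> 'a set \<Rightarrow> 'b pointed \<Rightarrow> ('a \<Rightarrow> 'b) \<Rightarrow> 'a \<Rightarrow> bool" where
  "translation_at S A T f s \<longleftrightarrow>
     (\<forall>O'. openin (space_of T) O' \<and> f s \<in> O' \<longrightarrow>
        (\<exists>W. openin (space_of S) W \<and> s \<in> W \<and> f ` (W \<inter> A) \<subseteq> O')) \<and>
     (\<exists>U \<phi> V \<psi> W. (U,\<phi>) \<in> charts S \<and> (V,\<psi>) \<in> charts T \<and> s \<in> U \<and> f s \<in> V \<and>
        openin (space_of S) W \<and> s \<in> W \<and> (\<forall>s'\<in>W \<inter> A. \<psi> (f s') - \<phi> s' = \<psi> (f s) - \<phi> s))"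

definition translation_on :: "'a pointed \<Rightarrow> 'a set \<Rightarrow> 'b pointed \<Rightarrow> ('a \<Rightarrow> 'b) \<Rightarrow> bool" where
  "translation_on S A T f \<longleftrightarrow> (\<forall>s\<in>A. translation_at S A T f s)"

lemma translation_atE:
  assumes "translation_at S A T f s"
  obtains U \<phi> V \<psi> W where "(U,\<phi>) \<in> charts S" "(V,\<psi>) \<in> charts T" "s \<in> U" "f s \<in> V"
        "openin (space_of S) W" "s \<in> W" "\<And>s'. s' \<in> W \<inter> A \<Longrightarrow> \<psi> (f s') - \<phi> s' = \<psi> (f s) - \<phi> s"
  using assms[unfolded translation_at_def, THEN conjunct2]
  by (elim exE conjE) (use that in simp)

lemma translation_atI:
  assumes "(U,\<phi>) \<in> charts S" "(V,\<psi>) \<in> charts T" "s \<in> U" "f s \<in> V" "openin (space_of T) V"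
    and "\<And>O'. openin (space_of T) O' \<Longrightarrow> f s \<in> O' \<Longrightarrow>
      \<exists>W. openin (space_of S) W \<and> s \<in> W \<and> f ` (W \<inter> A) \<subseteq> O' \<and> (\<forall>s'\<in>W \<inter> A. \<psi> (f s') - \<phi> s' = \<psi> (f s) - \<phi> s)"
  shows "translation_at S A T f s"
  unfolding translation_at_def
proof (rule conjI)
  show "\<forall>O'. openin (space_of T) O' \<and> f s \<in> O' \<longrightarrow> (\<exists>W. openin (space_of S) W \<and> s \<in> W \<and> f ` (W \<inter> A) \<subseteq> O')"
  proof (intro allI impI)
    fix O' assume "openin (space_of T) O' \<and> f s \<in> O'"
    then show "\<exists>W. openin (space_of S) W \<and> s \<in> W \<and> f ` (W \<inter> A) \<subseteq> O'"
      using assms(6)[of O'] by meson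
  qed
  obtain W where W: "openin (space_of S) W" "s \<in> W" "\<forall>s'\<in>W \<inter> A. \<psi> (f s') - \<phi> s' = \<psi> (f s) - \<phi> s"
    using assms(6)[OF assms(5,4)] by blast
  show "\<exists>U \<phi> V \<psi> W. (U,\<phi>) \<in> charts S \<and> (V,\<psi>) \<in> charts T \<and> s \<in> U \<and> f s \<in> V \<and>
        openin (space_of S) W \<and> s \<in> W \<and> (\<forall>s'\<in>W \<inter> A. \<psi> (f s') - \<phi> s' = \<psi> (f s) - \<phi> s)"
    using assms(1-4) W by (intro exI conjI)
qed

text \<open>
  Transition functions are locally translations, so composing with them keeps the difference of the
  coordinates locally constant.
\<close>

lemma translation_at_any_chart:
  assumes S: "tsurf S" and T: "tsurf T" and f: "translation_at S A T f s"
    and U: "(U,\<phi>) \<in> charts S" "s \<in> U" and V: "(V,\<psi>) \<in> charts T" "f s \<in> V"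
    and O': "openin (space_of T) O'" "f s \<in> O'"
  obtains W where "openin (space_of S) W" "s \<in> W" "W \<subseteq> U" "f ` (W \<inter> A) \<subseteq> V \<inter> O'"
    "\<And>s'. s' \<in> W \<inter> A \<Longrightarrow> \<psi> (f s') - \<phi> s' = \<psi> (f s) - \<phi> s"
proof -
  obtain U0 \<phi>0 V0 \<psi>0 W0 where 0: "(U0,\<phi>0) \<in> charts S" "(V0,\<psi>0) \<in> charts T" "s \<in> U0" "f s \<in> V0"
        "openin (space_of S) W0" "s \<in> W0"
        and W0: "\<And>s'. s' \<in> W0 \<inter> A \<Longrightarrow> \<psi>0 (f s') - \<phi>0 s' = \<psi>0 (f s) - \<phi>0 s"
    by (rule translation_atE[OF f]) (rule that)
  obtain W1 where W1: "openin (space_of S) W1" "s \<in> W1" "W1 \<subseteq> U \<inter> U0"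
    "\<And>y. y \<in> W1 \<Longrightarrow> \<phi> y - \<phi>0 y = \<phi> s - \<phi>0 s"
    using chart_compat[OF S U(1) 0(1) U(2) 0(3)] by blast
  obtain V1 where V1: "openin (space_of T) V1" "f s \<in> V1" "V1 \<subseteq> V \<inter> V0"
    "\<And>y. y \<in> V1 \<Longrightarrow> \<psi> y - \<psi>0 y = \<psi> (f s) - \<psi>0 (f s)"
    using chart_compat[OF T V(1) 0(2) V(2) 0(4)] by blast
  have "openin (space_of T) (V1 \<inter> O') \<and> f s \<in> V1 \<inter> O'" using V1 O' by auto
  then obtain W2 where W2: "openin (space_of S) W2" "s \<in> W2" "f ` (W2 \<inter> A) \<subseteq> V1 \<inter> O'"
    using f unfolding translation_at_def by blast
  show ?thesis
  proof (rule that[of "W0 \<inter> W1 \<inter> W2"])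
    show "\<psi> (f s') - \<phi> s' = \<psi> (f s) - \<phi> s" if s': "s' \<in> W0 \<inter> W1 \<inter> W2 \<inter> A" for s'
    proof -
      have "f s' \<in> V1" using W2 s' by auto
      have "\<psi> (f s') - \<phi> s' = (\<psi> (f s') - \<psi>0 (f s')) + (\<psi>0 (f s') - \<phi>0 s') - (\<phi> s' - \<phi>0 s')" by simp
      also have "\<dots> = (\<psi> (f s) - \<psi>0 (f s)) + (\<psi>0 (f s) - \<phi>0 s) - (\<phi> s - \<phi>0 s)"
        using W0[of s'] W1(4)[of s'] V1(4)[of "f s'"] s' \<open>f s' \<in> V1\<close> by (simp only: Int_iff)
      finally show ?thesis by simp
    qed
  qed (use 0 W1 W2 V1 in auto)
qed

lemma translation_at_mono: "translation_at S A T f s \<Longrightarrow> B \<subseteq> A \<Longrightarrow> translation_at S B T f s"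
  unfolding translation_at_def by (meson Int_mono image_mono order_refl order_trans subsetD)

lemma translation_on_mono: "translation_on S A T f \<Longrightarrow> B \<subseteq> A \<Longrightarrow> translation_on S B T f"
  unfolding translation_on_def by (meson subsetD translation_at_mono)

lemma translation_at_local:
  assumes N: "openin (space_of S) N" "s \<in> N" and f: "translation_at S (N \<inter> A) T f s"
  shows "translation_at S A T f s"
  unfolding translation_at_def
proof (intro conjI allI impI)
  fix O' assume "openin (space_of T) O' \<and> f s \<in> O'"
  then obtain W where "openin (space_of S) W" "s \<in> W" "f ` (W \<inter> (N \<inter> A)) \<subseteq> O'"
    using f unfolding translation_at_def by blast
  then show "\<exists>W. openin (space_of S) W \<and> s \<in> W \<and> f ` (W \<inter> A) \<subseteq> O'"
    by (intro exI[of _ "W \<inter> N"]) (use N in auto)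
next
  obtain U \<phi> V \<psi> W where *: "(U,\<phi>) \<in> charts S" "(V,\<psi>) \<in> charts T" "s \<in> U" "f s \<in> V"
        "openin (space_of S) W" "s \<in> W" "\<And>s'. s' \<in> W \<inter> (N \<inter> A) \<Longrightarrow> \<psi> (f s') - \<phi> s' = \<psi> (f s) - \<phi> s"
    by (rule translation_atE[OF f]) (rule that)
  show "\<exists>U \<phi> V \<psi> W. (U,\<phi>) \<in> charts S \<and> (V,\<psi>) \<in> charts T \<and> s \<in> U \<and> f s \<in> V \<and>
        openin (space_of S) W \<and> s \<in> W \<and> (\<forall>s'\<in>W \<inter> A. \<psi> (f s') - \<phi> s' = \<psi> (f s) - \<phi> s)"
    by (rule exI[of _ U], rule exI[of _ \<phi>], rule exI[of _ V], rule exI[of _ \<psi>], rule exI[of _ "W \<inter> N"])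
      (use * N in auto)
qed

lemma translation_at_cong:
  assumes f: "translation_at S A T f s" and eq: "\<And>x. x \<in> A \<Longrightarrow> f x = g x" and s: "s \<in> A"
  shows "translation_at S A T g s"
proof -
  have im: "g ` (W \<inter> A) = f ` (W \<inter> A)" for W using eq by auto
  have "(\<forall>s'\<in>W \<inter> A. \<psi> (g s') - \<phi> s' = \<psi> (g s) - \<phi> s) = (\<forall>s'\<in>W \<inter> A. \<psi> (f s') - \<phi> s' = \<psi> (f s) - \<phi> s)"
    for W and \<psi> :: "_ \<Rightarrow> plane" and \<phi>
    using eq s by auto
  then show ?thesis
    using f unfolding translation_at_def im eq[OF s, symmetric] by presburger
qed

lemma translation_on_cong:
  "translation_on S A T f \<Longrightarrow> (\<And>x. x \<in> A \<Longrightarrow> f x = g x) \<Longrightarrow> translation_on S A T g"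
  unfolding translation_on_def by (meson translation_at_cong)

lemma translation_at_topspace:
  assumes "tsurf S" "tsurf T" "translation_at S A T f s"
  shows "s \<in> whole S" "f s \<in> whole T"
  using assms(3) chart_open[OF assms(1)] chart_open[OF assms(2)] openin_subset
  unfolding translation_at_def by (metis subsetD)+

lemma translation_on_continuous:
  assumes S: "tsurf S" and T: "tsurf T" and f: "translation_on S A T f"
  shows "continuous_map (subtopology (space_of S) A) (space_of T) f"
  unfolding continuous_map_def
proof (intro conjI allI impI)
  show "f \<in> topspace (subtopology (space_of S) A) \<rightarrow> whole T"
    using f translation_at_topspace[OF S T] unfolding translation_on_def by auto
  fix O' assume O': "openin (space_of T) O'"
  let ?P = "{x \<in> topspace (subtopology (space_of S) A). f x \<in> O'}"
  show "openin (subtopology (space_of S) A) ?P"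
  proof (subst openin_subopen, safe)
    fix x assume x: "x \<in> topspace (subtopology (space_of S) A)" "f x \<in> O'"
    then obtain W where W: "openin (space_of S) W" "x \<in> W" "f ` (W \<inter> A) \<subseteq> O'"
      using f O' unfolding translation_on_def translation_at_def by (metis IntD2 topspace_subtopology)
    show "\<exists>Ta. openin (subtopology (space_of S) A) Ta \<and> x \<in> Ta \<and> Ta \<subseteq> ?P"
      by (rule exI[of _ "W \<inter> A"]) (use W x openin_subset[OF W(1)] in \<open>auto simp: openin_subtopology\<close>)
  qed
qed

lemma translation_on_comp:
  assumes S: "tsurf S" and T: "tsurf T" and Z: "tsurf Z"
    and f: "translation_on S A T f" and g: "translation_on T B Z g" and im: "f ` A \<subseteq> B"
  shows "translation_on S A Z (\<lambda>x. g (f x))"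
  unfolding translation_on_def
proof
  fix s assume s: "s \<in> A"
  have fs: "translation_at S A T f s" using f s translation_on_def by metis
  have gs: "translation_at T B Z g (f s)" using g s im unfolding translation_on_def by blast
  obtain U \<phi> where U: "(U,\<phi>) \<in> charts S" "s \<in> U"
    using chart_cover[OF S] translation_at_topspace[OF S T fs] by metis
  obtain V \<psi> where V: "(V,\<psi>) \<in> charts T" "f s \<in> V"
    using chart_cover[OF T] translation_at_topspace[OF S T fs] by metis
  obtain Q \<theta> where Q: "(Q,\<theta>) \<in> charts Z" "g (f s) \<in> Q"
    using chart_cover[OF Z] translation_at_topspace[OF T Z gs] by metis
  have key: "\<exists>W. openin (space_of S) W \<and> s \<in> W \<and> (\<lambda>x. g (f x)) ` (W \<inter> A) \<subseteq> O' \<and>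
     (\<forall>s'\<in>W\<inter>A. \<theta> (g (f s')) - \<phi> s' = \<theta> (g (f s)) - \<phi> s)"
    if O': "openin (space_of Z) O'" "g (f s) \<in> O'" for O'
  proof -
    obtain W1 where W1: "openin (space_of T) W1" "f s \<in> W1" "W1 \<subseteq> V" "g ` (W1 \<inter> B) \<subseteq> Q \<inter> O'"
      "\<And>s'. s' \<in> W1 \<inter> B \<Longrightarrow> \<theta> (g s') - \<psi> s' = \<theta> (g (f s)) - \<psi> (f s)"
      using translation_at_any_chart[OF T Z gs V Q O'] by blast
    obtain W where W: "openin (space_of S) W" "s \<in> W" "W \<subseteq> U" "f ` (W \<inter> A) \<subseteq> V \<inter> W1"
      "\<And>s'. s' \<in> W \<inter> A \<Longrightarrow> \<psi> (f s') - \<phi> s' = \<psi> (f s) - \<phi> s"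
      using translation_at_any_chart[OF S T fs U V W1(1,2)] by blast
    have fW: "f s' \<in> W1 \<inter> B" if "s' \<in> W \<inter> A" for s' using that W(4) im by auto
    have "\<theta> (g (f s')) - \<phi> s' = \<theta> (g (f s)) - \<phi> s" if "s' \<in> W \<inter> A" for s'
      using W1(5)[OF fW[OF that]] W(5)[OF that] by (metis (no_types) diff_add_cancel add_diff_eq)
    moreover have "(\<lambda>x. g (f x)) ` (W \<inter> A) \<subseteq> O'" using fW W1(4) by auto
    ultimately show ?thesis using W by blast
  qed
  show "translation_at S A Z (\<lambda>x. g (f x)) s"
    by (rule translation_atI[OF U(1) Q(1) U(2) Q(2) chart_open[OF Z Q(1)] key])
qed

text \<open>
  Unique continuation. The set where the maps agree is closed because the target is Hausdorff.
  It is open because both maps are the same translation in charts near a point of agreement, and charts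
  are locally injective.
\<close>

lemma translation_on_unique:
  assumes S: "tsurf S" and T: "tsurf T"
    and f: "translation_on S A T f" and g: "translation_on S A T g"
    and A: "connectedin (space_of S) A" and x: "x \<in> A" "f x = g x" and y: "y \<in> A"
  shows "f y = g y"
proof -
  let ?X = "subtopology (space_of S) A"
  have AS: "A \<subseteq> whole S" using A by (simp add: connectedin_def)
  have top: "topspace ?X = A" using AS by auto
  have conn: "connected_space ?X" using A by (simp add: connectedin_def)
  let ?E = "{x \<in> topspace ?X. f x = g x}"
  have cl: "closedin ?X ?E"
    by (rule closedin_continuous_maps_eq)
      (use T translation_on_continuous[OF S T f] translation_on_continuous[OF S T g] in \<open>auto simp: tsurf_def\<close>)
  have op: "openin ?X ?E"
  proof (subst openin_subopen, safe)
    fix s assume s: "s \<in> topspace ?X" "f s = g s"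
    then have sA: "s \<in> A" by auto
    have fs: "translation_at S A T f s" "translation_at S A T g s" using f g sA translation_on_def by metis+
    obtain U \<phi> where U: "(U,\<phi>) \<in> charts S" "s \<in> U"
      using chart_cover[OF S] translation_at_topspace[OF S T fs(1)] by metis
    obtain V \<psi> where V: "(V,\<psi>) \<in> charts T" "f s \<in> V"
      using chart_cover[OF T] translation_at_topspace[OF S T fs(1)] by metis
    obtain O' where O': "openin (space_of T) O'" "f s \<in> O'" "O' \<subseteq> V" "inj_on \<psi> O'"
      by (rule chart_homeo[OF T V]) (rule that)
    obtain W1 where W1: "openin (space_of S) W1" "s \<in> W1" "f ` (W1 \<inter> A) \<subseteq> V \<inter> O'"
      "\<And>s'. s' \<in> W1 \<inter> A \<Longrightarrow> \<psi> (f s') - \<phi> s' = \<psi> (f s) - \<phi> s"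
      using translation_at_any_chart[OF S T fs(1) U V O'(1,2)] by metis
    obtain W2 where W2: "openin (space_of S) W2" "s \<in> W2" "g ` (W2 \<inter> A) \<subseteq> V \<inter> O'"
      "\<And>s'. s' \<in> W2 \<inter> A \<Longrightarrow> \<psi> (g s') - \<phi> s' = \<psi> (g s) - \<phi> s"
      using translation_at_any_chart[OF S T fs(2) U V(1) _ O'(1)] V(2) O'(2) s(2) by metis
    have eq: "f s' = g s'" if "s' \<in> W1 \<inter> W2 \<inter> A" for s'
    proof (rule inj_onD[OF O'(4)])
      have "\<psi> (f s') - \<phi> s' = \<psi> (g s') - \<phi> s'" using W1(4)[of s'] W2(4)[of s'] that s(2) by auto
      then show "\<psi> (f s') = \<psi> (g s')" by simp
    qed (use that W1 W2 in auto)
    have "openin ?X (W1 \<inter> W2 \<inter> A)"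
      using W1(1) W2(1) by (intro openin_subtopology_Int openin_Int)
    moreover have "W1 \<inter> W2 \<inter> A \<subseteq> ?E" using eq top by auto
    ultimately show "\<exists>Ta. openin ?X Ta \<and> s \<in> Ta \<and> Ta \<subseteq> ?E"
      using W1(2) W2(2) sA by (intro exI[of _ "W1 \<inter> W2 \<inter> A"]) auto
  qed
  have "?E = topspace ?X"
    using conn cl op x top unfolding connected_space_clopen_in by blast
  then show ?thesis using y top by blast
qed

text \<open>
  At a common point of \<open>A\<close> and \<open>B\<close> both maps have the same value, hence the same translation
  vector in charts, so the vectors on the two sides match.
\<close>

lemma translation_on_glue:
  assumes S: "tsurf S" and T: "tsurf T"
    and f: "translation_on S A T f" and g: "translation_on S B T g"
    and A: "closedin (space_of S) A" and B: "closedin (space_of S) B"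
    and eq: "\<And>x. x \<in> A \<Longrightarrow> x \<in> B \<Longrightarrow> f x = g x"
  shows "translation_on S (A \<union> B) T (\<lambda>x. if x \<in> A then f x else g x)"
  unfolding translation_on_def
proof
  fix s assume s: "s \<in> A \<union> B"
  define h where "h = (\<lambda>x. if x \<in> A then f x else g x)"
  have oA: "openin (space_of S) (whole S - A)" and oB: "openin (space_of S) (whole S - B)"
    using A B by auto
  have AS: "A \<subseteq> whole S" "B \<subseteq> whole S" using A B closedin_subset by auto
  have hA: "translation_on S A T h" by (rule translation_on_cong[OF f]) (auto simp: h_def)
  have hB: "translation_on S B T h" by (rule translation_on_cong[OF g]) (use eq in \<open>auto simp: h_def\<close>)
  consider "s \<notin> B" | "s \<notin> A" | "s \<in> A" "s \<in> B" by blast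
  then have "translation_at S (A \<union> B) T h s"
  proof cases
    case 1
    show ?thesis
      by (rule translation_at_local[OF oB], use 1 s AS in blast, rule translation_at_mono[of _ A])
        (use 1 s AS hA in \<open>auto simp: translation_on_def\<close>)
  next
    case 2
    show ?thesis
      by (rule translation_at_local[OF oA], use 2 s AS in blast, rule translation_at_mono[of _ B])
        (use 2 s AS hB in \<open>auto simp: translation_on_def\<close>)
  next
    case 3
    have fs: "translation_at S A T h s" "translation_at S B T h s" using hA hB 3 translation_on_def by metis+
    obtain U \<phi> where U: "(U,\<phi>) \<in> charts S" "s \<in> U"
      using chart_cover[OF S] translation_at_topspace[OF S T fs(1)] by metis
    obtain V \<psi> where V: "(V,\<psi>) \<in> charts T" "h s \<in> V"
      using chart_cover[OF T] translation_at_topspace[OF S T fs(1)] by metis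
    have key: "\<exists>W. openin (space_of S) W \<and> s \<in> W \<and> h ` (W \<inter> (A \<union> B)) \<subseteq> O' \<and>
        (\<forall>s'\<in>W\<inter>(A\<union>B). \<psi> (h s') - \<phi> s' = \<psi> (h s) - \<phi> s)"
      if O': "openin (space_of T) O'" "h s \<in> O'" for O'
    proof -
      obtain W1 where W1: "openin (space_of S) W1" "s \<in> W1" "W1 \<subseteq> U" "h ` (W1 \<inter> A) \<subseteq> V \<inter> O'"
        "\<And>s'. s' \<in> W1 \<inter> A \<Longrightarrow> \<psi> (h s') - \<phi> s' = \<psi> (h s) - \<phi> s"
        by (rule translation_at_any_chart[OF S T fs(1) U V O']) (rule that)
      obtain W2 where W2: "openin (space_of S) W2" "s \<in> W2" "W2 \<subseteq> U" "h ` (W2 \<inter> B) \<subseteq> V \<inter> O'"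
        "\<And>s'. s' \<in> W2 \<inter> B \<Longrightarrow> \<psi> (h s') - \<phi> s' = \<psi> (h s) - \<phi> s"
        by (rule translation_at_any_chart[OF S T fs(2) U V O']) (rule that)
      show ?thesis
      proof (intro exI[of _ "W1 \<inter> W2"] conjI ballI)
        show "h ` (W1 \<inter> W2 \<inter> (A \<union> B)) \<subseteq> O'" using W1(4) W2(4) by blast
        fix s' assume "s' \<in> W1 \<inter> W2 \<inter> (A \<union> B)"
        then show "\<psi> (h s') - \<phi> s' = \<psi> (h s) - \<phi> s"
          using W1(5)[of s'] W2(5)[of s'] by blast
      qed (use W1 W2 in auto)
    qed
    show ?thesis
      by (rule translation_atI[OF U(1) V(1) U(2) V(2) chart_open[OF T V(1)] key])
  qed
  then show "translation_at S (A \<union> B) T (\<lambda>x. if x \<in> A then f x else g x) s"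
    unfolding h_def .
qed

section \<open>Straight moves\<close>

text \<open>
  With the plane as a translation surface, immersed disks are local translations of plane disks, and
  unique continuation applies to them.
\<close>

definition plane_surface :: "plane pointed" where
  "plane_surface = \<lparr>space_of = euclidean, basept = 0, charts = {(UNIV, \<lambda>x. x)}\<rparr>"

lemma plane_surface_simps [simp]:
  "space_of plane_surface = euclidean" "charts plane_surface = {(UNIV, \<lambda>x. x)}"
  by (simp_all add: plane_surface_def)

lemma tsurf_plane: "tsurf plane_surface"
proof -
  have "local_homeomorphism_on euclidean UNIV (\<lambda>x::plane. x)"
    unfolding local_homeomorphism_on_def
  proof
    fix x :: plane
    show "\<exists>W. openin euclidean W \<and> x \<in> W \<and> W \<subseteq> UNIV \<and> open ((\<lambda>x. x) ` W) \<and>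
      homeomorphic_map (subtopology euclidean W) (top_of_set ((\<lambda>x. x) ` W)) (\<lambda>x. x)"
      by (rule exI[of _ UNIV]) (auto simp: homeomorphic_map_id[unfolded id_def])
  qed
  then show ?thesis
    by (auto simp: tsurf_def translation_atlas_def translation_compatible_def)
qed

lemma translation_on_plane_affine: "translation_on plane_surface A plane_surface (\<lambda>w. v + w)"
  unfolding translation_on_def
proof
  fix s :: plane assume "s \<in> A"
  show "translation_at plane_surface A plane_surface (\<lambda>w. v + w) s"
  proof (rule translation_atI[where U = UNIV and V = UNIV and \<phi> = "\<lambda>x. x" and \<psi> = "\<lambda>x. x"])
    fix O' :: "plane set" assume O': "openin (space_of plane_surface) O'" "v + s \<in> O'"
    have "open ((\<lambda>w. - v + w) ` O')" using O' by (intro open_translation) auto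
    moreover have "s \<in> (\<lambda>w. - v + w) ` O'" using O'(2) by (auto intro: image_eqI[of _ _ "v + s"])
    ultimately show "\<exists>W. openin (space_of plane_surface) W \<and> s \<in> W \<and> (+) v ` (W \<inter> A) \<subseteq> O' \<and>
       (\<forall>s'\<in>W \<inter> A. v + s' - s' = v + s - s)"
      by (intro exI[of _ "(\<lambda>w. - v + w) ` O'"]) auto
  qed auto
qed

lemma translation_on_chart:
  assumes S: "tsurf S" and U: "(U,\<phi>) \<in> charts S"
  shows "translation_on S U plane_surface (\<lambda>y. \<phi> y - c)"
  unfolding translation_on_def
proof
  fix s assume s: "s \<in> U"
  show "translation_at S U plane_surface (\<lambda>y. \<phi> y - c) s"
  proof (rule translation_atI[OF U, where V = UNIV and \<psi> = "\<lambda>x. x"])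
    fix O' :: "plane set" assume O': "openin (space_of plane_surface) O'" "\<phi> s - c \<in> O'"
    then obtain e where e: "e > 0" "ball (\<phi> s - c) e \<subseteq> O'"
      by (auto simp: open_contains_ball)
    obtain W where W: "openin (space_of S) W" "s \<in> W" "W \<subseteq> U" "\<And>y. y \<in> W \<Longrightarrow> norm (\<phi> y - \<phi> s) < e"
      using chart_cont[OF S U s e(1)] by blast
    have "\<phi> y - c \<in> O'" if "y \<in> W" for y
    proof -
      have "\<phi> y - c \<in> ball (\<phi> s - c) e" using W(4)[OF that] by (simp add: dist_norm norm_minus_commute)
      then show ?thesis using e by blast
    qed
    then show "\<exists>W. openin (space_of S) W \<and> s \<in> W \<and> (\<lambda>y. \<phi> y - c) ` (W \<inter> U) \<subseteq> O' \<and>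
       (\<forall>s'\<in>W \<inter> U. \<phi> s' - c - \<phi> s' = \<phi> s - c - \<phi> s)"
      using W by (intro exI[of _ W]) auto
  qed (use s in auto)
qed

definition tball :: "'a pointed \<Rightarrow> 'a \<Rightarrow> real \<Rightarrow> (plane \<Rightarrow> 'a) \<Rightarrow> bool" where
  "tball T x r g \<longleftrightarrow> r > 0 \<and> translation_on plane_surface (ball 0 r) T g \<and> g 0 = x"

definition has_ball :: "'a pointed \<Rightarrow> 'a \<Rightarrow> real \<Rightarrow> bool" where
  "has_ball T x r \<longleftrightarrow> (\<exists>g. tball T x r g)"

text \<open>
  \<open>mv T x v\<close> is the end of the straight segment that starts at \<open>x\<close> and has the
  vector \<open>v\<close>. It is meaningful only when \<open>x\<close> is the centre of an immersed disk of radius greater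
  than \<open>norm v\<close>, and then it does not depend on the disk.
\<close>

definition mv :: "'a pointed \<Rightarrow> 'a \<Rightarrow> plane \<Rightarrow> 'a" where
  "mv T x v = (SOME y. \<exists>r g. norm v < r \<and> tball T x r g \<and> y = g v)"

lemma tball_unique:
  assumes T: "tsurf T" and g: "tball T x r g" "tball T x r' h" and v: "norm v < r" "norm v < r'"
  shows "g v = h v"
proof (rule translation_on_unique[OF tsurf_plane T, where A = "ball 0 (min r r')" and x = 0])
  show "translation_on plane_surface (ball 0 (min r r')) T g"
       "translation_on plane_surface (ball 0 (min r r')) T h"
    using g unfolding tball_def by (auto elim!: translation_on_mono)
  show "connectedin (space_of plane_surface) (ball 0 (min r r'))" by simp
qed (use g v in \<open>auto simp: tball_def\<close>)

lemma mv_eq: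
  assumes T: "tsurf T" and g: "tball T x r g" and v: "norm v < r"
  shows "mv T x v = g v"
  unfolding mv_def
proof (rule some_equality)
  show "\<exists>r g'. norm v < r \<and> tball T x r g' \<and> g v = g' v" using g v by blast
  fix y assume "\<exists>r g. norm v < r \<and> tball T x r g \<and> y = g v"
  then show "y = g v" using tball_unique[OF T _ g _ v] by blast
qed

lemma has_ball_tball:
  assumes T: "tsurf T" and x: "has_ball T x r"
  shows "tball T x r (mv T x)"
proof -
  obtain g where g: "tball T x r g" using x has_ball_def by metis
  then have "translation_on plane_surface (ball 0 r) T (mv T x)"
    using translation_on_cong[of plane_surface "ball 0 r" T g "mv T x"] mv_eq[OF T g]
    by (auto simp: tball_def)
  then show ?thesis using g mv_eq[OF T g, of 0] by (auto simp: tball_def)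
qed

lemma has_ball_pos: "has_ball T x r \<Longrightarrow> r > 0"
  by (auto simp: has_ball_def tball_def)

lemma has_ball_mono: "has_ball T x r \<Longrightarrow> 0 < r' \<Longrightarrow> r' \<le> r \<Longrightarrow> has_ball T x r'"
  unfolding has_ball_def tball_def by (metis subset_ball translation_on_mono)

lemma mv_translation:
  assumes "tsurf T" "has_ball T x r"
  shows "translation_on plane_surface (ball 0 r) T (mv T x)"
  using has_ball_tball[OF assms] tball_def by metis

lemma mv_0: "tsurf T \<Longrightarrow> has_ball T x r \<Longrightarrow> mv T x 0 = x"
  using has_ball_tball tball_def by metis

text \<open>
  An immersed disk contains an immersed disk about each of its points; this gives the addition law for moves.
\<close>

lemma tball_shift:
  assumes T: "tsurf T" and x: "has_ball T x r" and v: "norm v < r"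
  shows "tball T (mv T x v) (r - norm v) (\<lambda>w. mv T x (v + w))"
proof -
  have "norm (v + w) < r" if "norm w < r - norm v" for w :: plane
    using that norm_triangle_ineq[of v w] by simp
  then have "(\<lambda>w. v + w) ` ball 0 (r - norm v) \<subseteq> ball 0 r"
    by (intro image_subsetI) simp
  then show ?thesis
    using translation_on_comp[OF tsurf_plane tsurf_plane T translation_on_plane_affine mv_translation[OF T x]] v
    unfolding tball_def by auto
qed

lemma has_ball_shift:
  "tsurf T \<Longrightarrow> has_ball T x r \<Longrightarrow> norm v < r \<Longrightarrow> has_ball T (mv T x v) (r - norm v)"
  using tball_shift[of T x r v] has_ball_def[of T "mv T x v" "r - norm v"] by metis

lemma mv_add:
  assumes T: "tsurf T" and x: "has_ball T x r" and v: "norm v + norm w < r"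
  shows "mv T (mv T x v) w = mv T x (v + w)"
proof (rule mv_eq[OF T tball_shift[OF T x]])
  show "norm v < r" using v norm_ge_zero[of w] by linarith
  show "norm w < r - norm v" using v by simp
qed

lemma mv_back:
  assumes T: "tsurf T" and x: "has_ball T x r" and v: "2 * norm v < r"
  shows "mv T (mv T x v) (- v) = x"
  using mv_add[OF T x, of v "- v"] v mv_0[OF T x] by simp

text \<open>
  A local translation maps an immersed disk to an immersed disk, so it commutes with moves.
\<close>

lemma translation_on_mv:
  assumes S: "tsurf S" and T: "tsurf T" and f: "translation_on S A T f"
    and x: "has_ball S x r" and im: "mv S x ` ball 0 r \<subseteq> A"
  shows "has_ball T (f x) r" "norm v < r \<Longrightarrow> f (mv S x v) = mv T (f x) v"
proof -
  have "translation_on plane_surface (ball 0 r) T (\<lambda>v. f (mv S x v))"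
    by (rule translation_on_comp[OF tsurf_plane S T mv_translation[OF S x] f im])
  then have *: "tball T (f x) r (\<lambda>v. f (mv S x v))"
    using has_ball_pos[OF x] mv_0[OF S x] by (auto simp: tball_def)
  then show "has_ball T (f x) r" using has_ball_def by metis
  show "norm v < r \<Longrightarrow> f (mv S x v) = mv T (f x) v"
    using mv_eq[OF T *] by simp
qed

text \<open>
  The inverse of a chart on a small disk is an immersed disk, so near \<open>x\<close> every point is a move of \<open>x\<close>.
\<close>

lemma small_ball_exists:
  assumes T: "tsurf T" and V: "(V,\<psi>) \<in> charts T" "x \<in> V" and O': "openin (space_of T) O'" "x \<in> O'"
  obtains r N where "has_ball T x r" "inj_on (mv T x) (ball 0 r)" "N = mv T x ` ball 0 r"
    "openin (space_of T) N" "x \<in> N" "N \<subseteq> V \<inter> O'"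
    "\<And>v. norm v < r \<Longrightarrow> \<psi> (mv T x v) = \<psi> x + v"
    "\<And>y. y \<in> N \<Longrightarrow> norm (\<psi> y - \<psi> x) < r \<and> y = mv T x (\<psi> y - \<psi> x)"
proof -
  obtain W0 where W0: "openin (space_of T) W0" "x \<in> W0" "W0 \<subseteq> V" "open (\<psi> ` W0)"
    and hom: "homeomorphic_map (subtopology (space_of T) W0) (top_of_set (\<psi> ` W0)) \<psi>"
    and inj0: "inj_on \<psi> W0" and cont: "continuous_map (subtopology (space_of T) W0) euclidean \<psi>"
    by (rule chart_homeo[OF T V]) (rule that)
  have W0T: "W0 \<subseteq> whole T" using W0(1) openin_subset by blast
  obtain r where r: "r > 0" and rb: "ball (\<psi> x) r \<subseteq> \<psi> ` (W0 \<inter> O')"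
  proof -
    have "openin (subtopology (space_of T) W0) (W0 \<inter> O')"
      using O'(1) by (metis inf_commute openin_subtopology_Int)
    then have "openin (top_of_set (\<psi> ` W0)) (\<psi> ` (W0 \<inter> O'))"
      using hom homeomorphic_imp_open_map open_map_def by blast
    then have "open (\<psi> ` (W0 \<inter> O'))" using W0(4) openin_open_trans by blast
    then show ?thesis using that W0(2) O'(2) by (metis IntI imageI openE)
  qed
  define W where "W = {y \<in> W0 \<inter> O'. \<psi> y \<in> ball (\<psi> x) r}"
  have imW: "\<psi> ` W = ball (\<psi> x) r" using rb by (auto simp: W_def)
  have injW: "inj_on \<psi> W" using inj0 by (rule inj_on_subset) (auto simp: W_def)
  have opW: "openin (space_of T) W"
  proof -
    have "openin (subtopology (space_of T) W0) {y \<in> topspace (subtopology (space_of T) W0). \<psi> y \<in> ball (\<psi> x) r}"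
      using cont unfolding continuous_map_def by auto
    then have "openin (space_of T) {y \<in> W0. \<psi> y \<in> ball (\<psi> x) r}"
      using W0(1) W0T by (simp add: openin_open_subtopology inf.absorb2)
    moreover have "W = {y \<in> W0. \<psi> y \<in> ball (\<psi> x) r} \<inter> O'" by (auto simp: W_def)
    ultimately show ?thesis using O'(1) by auto
  qed
  have xW: "x \<in> W" using W0(2) O'(2) r by (auto simp: W_def)
  define g where "g = (\<lambda>v. inv_into W \<psi> (\<psi> x + v))"
  have gW: "g v \<in> W" "\<psi> (g v) = \<psi> x + v" if "norm v < r" for v
  proof -
    have "\<psi> x + v \<in> \<psi> ` W" unfolding imW using that by (simp add: dist_norm)
    then show "g v \<in> W" "\<psi> (g v) = \<psi> x + v" unfolding g_def by (auto intro: inv_into_into f_inv_into_f)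
  qed
  have gW': "g v = y" if "y \<in> W" "\<psi> y = \<psi> x + v" for y v
    unfolding g_def that(2)[symmetric] using inv_into_f_f[OF injW that(1)] .
  have yW: "norm (\<psi> y - \<psi> x) < r" "g (\<psi> y - \<psi> x) = y" if "y \<in> W" for y
  proof -
    have "\<psi> y \<in> ball (\<psi> x) r" using imW that by blast
    then show "norm (\<psi> y - \<psi> x) < r" by (simp add: dist_norm norm_minus_commute)
    show "g (\<psi> y - \<psi> x) = y" by (rule gW'[OF that]) simp
  qed
  have g: "tball T x r g"
    unfolding tball_def translation_on_def
  proof (intro conjI ballI)
    show "g 0 = x" using gW'[OF xW, of 0] by simp
    fix v :: plane assume v: "v \<in> ball 0 r"
    show "translation_at plane_surface (ball 0 r) T g v"
    proof (rule translation_atI[where U = UNIV and \<phi> = "\<lambda>x. x", OF _ V(1) _ _ chart_open[OF T V(1)]])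
      show "g v \<in> V" using gW(1)[of v] v W0(3) by (auto simp: W_def)
      fix O2 assume O2: "openin (space_of T) O2" "g v \<in> O2"
      have "openin (subtopology (space_of T) W0) (W \<inter> O2)"
        using O2(1) opW W0(1) by (simp add: openin_open_subtopology) (auto simp: W_def)
      then have "openin (top_of_set (\<psi> ` W0)) (\<psi> ` (W \<inter> O2))"
        using hom homeomorphic_imp_open_map open_map_def by blast
      then have o: "open (\<psi> ` (W \<inter> O2))" using W0(4) openin_open_trans by blast
      have "open ((\<lambda>w. - \<psi> x + w) ` \<psi> ` (W \<inter> O2))" by (rule open_translation[OF o])
      moreover have "v \<in> (\<lambda>w. - \<psi> x + w) ` \<psi> ` (W \<inter> O2)"
        using gW[of v] v O2(2) by (auto intro!: image_eqI[of _ _ "g v"] image_eqI[of _ _ "\<psi> (g v)"])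
      moreover have "g ` ((\<lambda>w. - \<psi> x + w) ` \<psi> ` (W \<inter> O2) \<inter> ball 0 r) \<subseteq> O2"
      proof clarify
        fix y assume y: "y \<in> W" "y \<in> O2"
        have "g (- \<psi> x + \<psi> y) = y" by (rule gW'[OF y(1)]) simp
        then show "g (- \<psi> x + \<psi> y) \<in> O2" using y by simp
      qed
      moreover have "\<psi> (g s') - s' = \<psi> (g v) - v" if "s' \<in> ball 0 r" for s'
        using gW(2)[of s'] gW(2)[of v] v that by simp
      ultimately show "\<exists>W. openin (space_of plane_surface) W \<and> v \<in> W \<and> g ` (W \<inter> ball 0 r) \<subseteq> O2 \<and>
         (\<forall>s'\<in>W \<inter> ball 0 r. \<psi> (g s') - s' = \<psi> (g v) - v)"
        by (intro exI[of _ "(\<lambda>w. - \<psi> x + w) ` \<psi> ` (W \<inter> O2)"]) auto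
    qed auto
  qed (rule r)
  have eq: "mv T x v = g v" if "norm v < r" for v using mv_eq[OF T g that] .
  have imN: "mv T x ` ball 0 r = W"
  proof
    show "mv T x ` ball 0 r \<subseteq> W" using gW(1) eq by auto
    show "W \<subseteq> mv T x ` ball 0 r"
    proof
      fix y assume "y \<in> W"
      then show "y \<in> mv T x ` ball 0 r"
        using yW[of y] eq[of "\<psi> y - \<psi> x"] by (intro image_eqI[of _ _ "\<psi> y - \<psi> x"]) auto
    qed
  qed
  show ?thesis
  proof (rule that[of r W])
    show "has_ball T x r" using g has_ball_def by metis
    show "inj_on (mv T x) (ball 0 r)"
    proof (rule inj_onI)
      fix v w :: plane assume *: "v \<in> ball 0 r" "w \<in> ball 0 r" "mv T x v = mv T x w"
      then have n: "norm v < r" "norm w < r" by auto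
      have "g v = g w" using *(3) eq[OF n(1)] eq[OF n(2)] by metis
      then have "\<psi> x + v = \<psi> x + w" using gW(2)[OF n(1)] gW(2)[OF n(2)] by metis
      then show "v = w" by simp
    qed
    show "W \<subseteq> V \<inter> O'" using W0(3) by (auto simp: W_def)
    show "\<psi> (mv T x v) = \<psi> x + v" if "norm v < r" for v using eq[OF that] gW(2)[OF that] by simp
    show "norm (\<psi> y - \<psi> x) < r \<and> y = mv T x (\<psi> y - \<psi> x)" if "y \<in> W" for y
      using yW[OF that] eq[OF yW(1)[OF that]] by metis
  qed (use imN opW xW in auto)
qed

text \<open>
  Near each point a local translation is given by moves, and on open sets commuting with
  moves is also sufficient (\<open>translation_on_openI\<close>). This replaces charts of the target in what follows.
\<close>

lemma translation_atD_mv: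
  assumes S: "tsurf S" and T: "tsurf T" and f: "translation_at S A T f s"
    and U: "(U,\<phi>) \<in> charts S" "s \<in> U" and r: "has_ball T (f s) r"
  obtains W where "openin (space_of S) W" "s \<in> W" "W \<subseteq> U"
    "\<And>s'. s' \<in> W \<inter> A \<Longrightarrow> norm (\<phi> s' - \<phi> s) < r \<and> f s' = mv T (f s) (\<phi> s' - \<phi> s)"
proof -
  obtain V \<psi> where V: "(V,\<psi>) \<in> charts T" "f s \<in> V"
    using chart_cover[OF T] translation_at_topspace[OF S T f] by metis
  obtain q N where q: "has_ball T (f s) q" "openin (space_of T) N" "f s \<in> N"
     "\<And>y. y \<in> N \<Longrightarrow> norm (\<psi> y - \<psi> (f s)) < q \<and> y = mv T (f s) (\<psi> y - \<psi> (f s))"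
    by (rule small_ball_exists[OF T V chart_open[OF T V(1)] V(2)]) (rule that)
  obtain W1 where W1: "openin (space_of S) W1" "s \<in> W1" "W1 \<subseteq> U" "f ` (W1 \<inter> A) \<subseteq> V \<inter> N"
    "\<And>s'. s' \<in> W1 \<inter> A \<Longrightarrow> \<psi> (f s') - \<phi> s' = \<psi> (f s) - \<phi> s"
    by (rule translation_at_any_chart[OF S T f U V q(2,3)]) (rule that)
  obtain W2 where W2: "openin (space_of S) W2" "s \<in> W2" "W2 \<subseteq> U"
    "\<And>y. y \<in> W2 \<Longrightarrow> norm (\<phi> y - \<phi> s) < r"
    by (rule chart_cont[OF S U has_ball_pos[OF r]]) (rule that)
  show ?thesis
  proof (rule that[of "W1 \<inter> W2"])
    show "norm (\<phi> s' - \<phi> s) < r \<and> f s' = mv T (f s) (\<phi> s' - \<phi> s)" if s': "s' \<in> W1 \<inter> W2 \<inter> A" for s'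
    proof
      have "\<psi> (f s') - \<phi> s' = \<psi> (f s) - \<phi> s" using W1(5) s' by blast
      then have e: "\<psi> (f s') - \<psi> (f s) = \<phi> s' - \<phi> s" by (metis add.commute diff_add_eq diff_eq_eq)
      have "f s' \<in> N" using W1(4) s' by auto
      then have "f s' = mv T (f s) (\<psi> (f s') - \<psi> (f s))" using q(4) by blast
      then show "f s' = mv T (f s) (\<phi> s' - \<phi> s)" unfolding e .
    qed (use W2 s' in auto)
  qed (use W1 W2 in auto)
qed

lemma translation_on_openI:
  assumes S: "tsurf S" and T: "tsurf T" and A: "openin (space_of S) A"
    and f: "\<And>x. x \<in> A \<Longrightarrow> \<exists>r. has_ball S x r \<and> has_ball T (f x) r \<and>
       (\<forall>v. norm v < r \<longrightarrow> mv S x v \<in> A \<longrightarrow> f (mv S x v) = mv T (f x) v)"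
  shows "translation_on S A T f"
  unfolding translation_on_def
proof
  fix x assume x: "x \<in> A"
  have "x \<in> whole S" using A x openin_subset by blast
  then obtain U \<phi> where U: "(U,\<phi>) \<in> charts S" "x \<in> U" using chart_cover[OF S] by metis
  obtain r where r: "has_ball S x r" "has_ball T (f x) r"
    "\<And>v. norm v < r \<Longrightarrow> mv S x v \<in> A \<Longrightarrow> f (mv S x v) = mv T (f x) v" using f[OF x] by blast
  obtain W where W: "openin (space_of S) W" "x \<in> W" "W \<subseteq> U" "\<And>y. y \<in> W \<Longrightarrow> norm (\<phi> y - \<phi> x) < r"
    using chart_cont[OF S U has_ball_pos[OF r(1)]] by metis
  obtain q N where q: "has_ball S x q" "openin (space_of S) N" "x \<in> N" "N \<subseteq> U \<inter> (W \<inter> A)"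
     "\<And>y. y \<in> N \<Longrightarrow> norm (\<phi> y - \<phi> x) < q \<and> y = mv S x (\<phi> y - \<phi> x)"
    by (rule small_ball_exists[OF S U, of "W \<inter> A"]) (use W A x that in auto)
  have "(\<lambda>y. \<phi> y - \<phi> x) ` N \<subseteq> ball 0 r" using W(4) q(4) by auto
  from translation_on_comp[OF S tsurf_plane T translation_on_mono[OF translation_on_chart[OF S U(1)]] mv_translation[OF T r(2)] this]
  have 1: "translation_on S N T (\<lambda>y. mv T (f x) (\<phi> y - \<phi> x))" using q(4) by blast
  have "translation_on S N T f"
  proof (rule translation_on_cong[OF 1])
    fix y assume y: "y \<in> N"
    have yy: "y = mv S x (\<phi> y - \<phi> x)" using q(5)[OF y] by blast
    have "norm (\<phi> y - \<phi> x) < r" using W(4) q(4) y by blast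
    moreover have "mv S x (\<phi> y - \<phi> x) \<in> A" using yy y q(4) by auto
    ultimately have "f (mv S x (\<phi> y - \<phi> x)) = mv T (f x) (\<phi> y - \<phi> x)" by (rule r(3))
    then show "mv T (f x) (\<phi> y - \<phi> x) = f y" using yy by simp
  qed
  then have "translation_at S (N \<inter> A) T f x"
    using q(3,4) x unfolding translation_on_def by (metis inf.absorb1 le_inf_iff)
  then show "translation_at S A T f x"
    by (rule translation_at_local[OF q(2,3)])
qed

section \<open>Sections of a family of surfaces\<close>

text \<open>
  The common radius \<open>\<rho>\<close> keeps the basepoints from becoming a singularity of the limit.
\<close>

locale surface_family =
  fixes T :: "'i \<Rightarrow> 'b pointed" and F :: "'i filter" and \<rho> :: real
  assumes ultra: "ultrafilter F"
    and ts: "\<And>i. tsurf (T i)"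
    and base_ball: "\<And>i. has_ball (T i) (basept (T i)) \<rho>"
    and base_inj: "\<And>i. inj_on (mv (T i) (basept (T i))) (ball 0 \<rho>)"
begin

abbreviation mvs :: "('i \<Rightarrow> 'b) \<Rightarrow> plane \<Rightarrow> 'i \<Rightarrow> 'b" where
  "mvs a v \<equiv> \<lambda>i. mv (T i) (a i) v"

definition base :: "'i \<Rightarrow> 'b" where
  "base = (\<lambda>i. basept (T i))"

definition immersed :: "('i \<Rightarrow> 'b) \<Rightarrow> real \<Rightarrow> bool" where
  "immersed a r \<longleftrightarrow> eventually (\<lambda>i. has_ball (T i) (a i) r) F"

definition embedded :: "('i \<Rightarrow> 'b) \<Rightarrow> real \<Rightarrow> bool" where
  "embedded a r \<longleftrightarrow> immersed a r \<and> eventually (\<lambda>i. inj_on (mv (T i) (a i)) (ball 0 r)) F"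

abbreviation close :: "real \<Rightarrow> ('i \<Rightarrow> 'b) \<Rightarrow> ('i \<Rightarrow> 'b) \<Rightarrow> bool" where
  "close \<delta> a b \<equiv> eventually (\<lambda>i. \<exists>v. norm v < \<delta> \<and> b i = mv (T i) (a i) v) F"

definition near :: "('i \<Rightarrow> 'b) \<Rightarrow> ('i \<Rightarrow> 'b) \<Rightarrow> bool" where
  "near a b \<longleftrightarrow> (\<forall>\<delta>>0. close \<delta> a b)"

text \<open>
  The sections that survive in the limit. The bounds \<open>r\<close> and \<open>s\<close> of a step are the same for almost all
  indices, and so is the number of steps: without this a section could run off to infinity or into
  points where the immersed disks shrink.
\<close>

inductive reachable :: "('i \<Rightarrow> 'b) \<Rightarrow> bool" where
  base: "reachable base"
| step: "reachable a \<Longrightarrow> immersed a r \<Longrightarrow> s < r \<Longrightarrow>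
    eventually (\<lambda>i. \<exists>v. norm v \<le> s \<and> b i = mv (T i) (a i) v) F \<Longrightarrow> reachable b"

lemma immersed_pos: "immersed a r \<Longrightarrow> r > 0"
  unfolding immersed_def by (drule ultrafilter_eventually_ex[OF ultra]) (auto dest: has_ball_pos)

lemma immersed_mono: "immersed a r \<Longrightarrow> 0 < r' \<Longrightarrow> r' \<le> r \<Longrightarrow> immersed a r'"
  unfolding immersed_def by (erule eventually_mono) (rule has_ball_mono)

lemma immersed_step:
  assumes "immersed a r" "s < r" "eventually (\<lambda>i. \<exists>v. norm v \<le> s \<and> b i = mv (T i) (a i) v) F"
  shows "immersed b (r - s)"
  using assms(1,3) unfolding immersed_def
proof eventually_elim
  case (elim i)
  then obtain v where v: "norm v \<le> s" "b i = mv (T i) (a i) v" by blast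
  have "has_ball (T i) (b i) (r - norm v)"
    using has_ball_shift[OF ts elim(1), of v] v assms(2) by auto
  then show ?case by (rule has_ball_mono) (use v assms(2) in auto)
qed

lemma immersed_mvs: "immersed a r \<Longrightarrow> norm v < r \<Longrightarrow> immersed (mvs a v) (r - norm v)"
  by (rule immersed_step) (auto intro!: always_eventually)

lemma reachable_immersed:
  assumes "reachable a" obtains r where "r > 0" "immersed a r"
proof -
  have "\<exists>r>0. immersed a r"
    using assms
  proof induction
    case base
    then show ?case
      unfolding immersed_def base_def using base_ball has_ball_pos[OF base_ball] by (auto intro!: exI[of _ \<rho>])
  next
    case (step a r s b)
    then show ?case using immersed_step[of a r s b] immersed_pos by blast
  qed
  then show ?thesis using that by blast
qed

lemma reachable_mvs: "reachable a \<Longrightarrow> immersed a r \<Longrightarrow> norm v < r \<Longrightarrow> reachable (mvs a v)"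
  by (rule step[of a r "norm v"]) (auto intro!: always_eventually)

lemma near_immersed:
  assumes "immersed a r" "near a b" "0 < s" "s < r"
  shows "immersed b s"
proof -
  have "close (r - s) a b"
    using assms unfolding near_def by auto
  then have "eventually (\<lambda>i. \<exists>v. norm v \<le> r - s \<and> b i = mv (T i) (a i) v) F"
    by (rule eventually_mono) (use less_imp_le in blast)
  from immersed_step[OF assms(1) _ this] assms show ?thesis by simp
qed

lemma reachable_near:
  assumes "reachable a" "near a b"
  shows "reachable b"
proof -
  obtain r where r: "r > 0" "immersed a r" using reachable_immersed[OF assms(1)] .
  have "close (r / 2) a b"
    using assms(2) r(1) unfolding near_def by (meson half_gt_zero)
  then have "eventually (\<lambda>i. \<exists>v. norm v \<le> r/2 \<and> b i = mv (T i) (a i) v) F"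
    by (rule eventually_mono) (use less_imp_le in blast)
  from step[OF assms(1) r(2) _ this] r show ?thesis by simp
qed

lemma near_cong:
  assumes "reachable a" "eventually (\<lambda>i. a i = b i) F"
  shows "near a b"
  unfolding near_def
proof (intro allI impI)
  fix \<delta> :: real assume "\<delta> > 0"
  obtain r where "immersed a r" using reachable_immersed[OF assms(1)] .
  then show "close \<delta> a b"
    using assms(2) unfolding immersed_def
    by eventually_elim (use mv_0[OF ts] \<open>\<delta> > 0\<close> in \<open>auto intro!: exI[of _ 0]\<close>)
qed

lemma near_refl: "reachable a \<Longrightarrow> near a a"
  by (rule near_cong) auto

lemma near_sym:
  assumes "reachable a" "near a b"
  shows "near b a"
  unfolding near_def
proof (intro allI impI)
  fix \<delta> :: real assume \<delta>: "\<delta> > 0"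
  obtain r where r: "r > 0" "immersed a r" using reachable_immersed[OF assms(1)] .
  have "min \<delta> (r/2) > 0" using \<delta> r by simp
  then have "close (min \<delta> (r / 2)) a b"
    using assms(2) unfolding near_def by blast
  then show "close \<delta> b a"
    using r(2) unfolding immersed_def
  proof eventually_elim
    case (elim i)
    then obtain v where v: "norm v < min \<delta> (r/2)" "b i = mv (T i) (a i) v" by blast
    then have "mv (T i) (b i) (- v) = a i" using mv_back[OF ts elim(2), of v] by simp
    then show ?case using v by (intro exI[of _ "- v"]) auto
  qed
qed

lemma near_trans:
  assumes "reachable a" "near a b" "near b c"
  shows "near a c"
  unfolding near_def
proof (intro allI impI)
  fix \<delta> :: real assume \<delta>: "\<delta> > 0"
  obtain r where r: "r > 0" "immersed a r" using reachable_immersed[OF assms(1)] .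
  define e where "e = min \<delta> r / 2"
  have e: "e > 0" using \<delta> r by (simp add: e_def)
  have "close e a b"
    "close e b c"
    using assms(2,3) e unfolding near_def by blast+
  then show "close \<delta> a c"
    using r(2) unfolding immersed_def
  proof eventually_elim
    case (elim i)
    then obtain v w where v: "norm v < e" "b i = mv (T i) (a i) v" "norm w < e" "c i = mv (T i) (b i) w" by blast
    then have "norm v + norm w < r" "norm v + norm w < \<delta>" by (auto simp: e_def)
    then show ?case using v mv_add[OF ts elim(3), of v w] norm_triangle_ineq[of v w]
      by (intro exI[of _ "v + w"]) auto
  qed
qed

lemma near_mvs:
  assumes "immersed a r" "near a b" "norm v < r"
  shows "near (mvs a v) (mvs b v)"
  unfolding near_def
proof (intro allI impI)
  fix \<delta> :: real assume \<delta>: "\<delta> > 0"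
  have "min \<delta> (r - norm v) > 0" using \<delta> assms by simp
  then have "close (min \<delta> (r - norm v)) a b"
    using assms(2) unfolding near_def by blast
  then show "close \<delta> (mvs a v) (mvs b v)"
    using assms(1) unfolding immersed_def
  proof eventually_elim
    case (elim i)
    then obtain u where u: "norm u < \<delta>" "norm u < r - norm v" "b i = mv (T i) (a i) u" by auto
    have "mv (T i) (b i) v = mv (T i) (a i) (u + v)" "mv (T i) (mv (T i) (a i) v) u = mv (T i) (a i) (v + u)"
      unfolding u(3) using u by (auto intro!: mv_add[OF ts elim(2)])
    then show ?case using u by (intro exI[of _ u]) (simp add: add.commute)
  qed
qed

lemma mvs_add:
  assumes "immersed a r" "norm v + norm w < r"
  shows "eventually (\<lambda>i. mvs (mvs a v) w i = mvs a (v + w) i) F"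
  using assms(1) unfolding immersed_def by eventually_elim (use assms(2) mv_add[OF ts] in blast)

text \<open>
  Up to identification, a move by vectors that converge along \<open>F\<close> is a move by the limit vector.
\<close>

lemma near_tendsto:
  assumes "immersed a r" "norm v < r" "(u \<longlongrightarrow> v) F" "eventually (\<lambda>i. b i = mv (T i) (a i) (u i)) F"
  shows "near (mvs a v) b"
  unfolding near_def
proof (intro allI impI)
  fix \<delta> :: real assume \<delta>: "\<delta> > 0"
  have "min \<delta> (r - norm v) > 0" using \<delta> assms by simp
  then have "eventually (\<lambda>i. dist (u i) v < min \<delta> (r - norm v)) F"
    using assms(3) tendstoD by blast
  then show "close \<delta> (mvs a v) b"
    using assms(1,4) unfolding immersed_def
  proof eventually_elim
    case (elim i)
    have "mv (T i) (mv (T i) (a i) v) (u i - v) = mv (T i) (a i) (v + (u i - v))"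
      by (rule mv_add[OF ts elim(2)]) (use elim(1) in \<open>auto simp: dist_norm\<close>)
    then show ?case using elim by (intro exI[of _ "u i - v"]) (auto simp: dist_norm)
  qed
qed

lemma ultra_limit_plane:
  fixes u :: "'i \<Rightarrow> plane"
  assumes "eventually (\<lambda>i. norm (u i) \<le> s) F"
  obtains v where "norm v \<le> s" "(u \<longlongrightarrow> v) F"
proof -
  have "compactin euclidean (cball (0::plane) s)" by (simp add: compactin_euclidean_iff)
  moreover have "eventually (\<lambda>i. u i \<in> cball 0 s) F" using assms by simp
  ultimately obtain v where "v \<in> cball 0 s" "limitin euclidean u v F"
    by (rule ultrafilter_limit_compactin[OF ultra])
  then show ?thesis using that[of v] by simp
qed

text \<open>
  By compactness of disks in the plane, every step is up to identification a move by a fixed vector.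
\<close>

lemma step_limit:
  assumes a: "immersed a r" "s < r" and b: "eventually (\<lambda>i. \<exists>v. norm v \<le> s \<and> b i = mv (T i) (a i) v) F"
  obtains v where "norm v \<le> s" "near (mvs a v) b"
proof -
  define u where "u = (\<lambda>i. SOME v. norm v \<le> s \<and> b i = mv (T i) (a i) v)"
  have "eventually (\<lambda>i. norm (u i) \<le> s \<and> b i = mv (T i) (a i) (u i)) F"
    using b unfolding u_def by eventually_elim (rule someI_ex)
  then have u: "eventually (\<lambda>i. norm (u i) \<le> s) F" "eventually (\<lambda>i. b i = mv (T i) (a i) (u i)) F"
    by (auto elim: eventually_mono)
  obtain v where v: "norm v \<le> s" "(u \<longlongrightarrow> v) F" using ultra_limit_plane[OF u(1)] .
  have "norm v < r" using v a(2) by simp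
  from near_tendsto[OF a(1) this v(2) u(2)] show ?thesis by (rule that[OF v(1)])
qed

text \<open>
  Injectivity of moves travels along a step from \<open>a\<close> to \<open>b\<close>: if two short moves \<open>w1\<close>, \<open>w2\<close> of \<open>b i\<close>
  agree, then \<open>u \<mapsto> mv (T i) (a i) (w1 + u)\<close> and \<open>u \<mapsto> mv (T i) (a i) (w2 + u)\<close> agree at the vector from \<open>a i\<close>
  to \<open>b i\<close>, hence by unique continuation also at \<open>0\<close>.
\<close>

lemma reachable_embedded:
  assumes "reachable a" obtains r where "r > 0" "embedded a r"
proof -
  have "\<exists>r>0. embedded a r"
    using assms
  proof induction
    case base
    then show ?case
      unfolding embedded_def immersed_def base_def using base_ball base_inj has_ball_pos[OF base_ball]
      by (auto intro!: exI[of _ \<rho>])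
  next
    case (step a r s b)
    then obtain q where q: "q > 0" "embedded a q" by blast
    \<comment> \<open>then \<open>norm (w + u) < r\<close> whenever \<open>norm w < e\<close> and \<open>norm u < r - e\<close>, and the vector of the step is such a \<open>u\<close>\<close>
    define e where "e = min q ((r - s) / 2)"
    have e: "e > 0" "e \<le> q" "2 * e \<le> r - s" using q step(3) by (auto simp: e_def min_def)
    have "immersed b e" by (rule immersed_mono[OF immersed_step[OF step(2-4)]]) (use e in auto)
    moreover have "eventually (\<lambda>i. inj_on (mv (T i) (b i)) (ball 0 e)) F"
      using step(2)[unfolded immersed_def] step(4) q(2)[unfolded embedded_def, THEN conjunct2]
    proof eventually_elim
      case (elim i)
      have inj: "inj_on (mv (T i) (a i)) (ball 0 q)" using elim by blast
      obtain v where v: "norm v \<le> s" "b i = mv (T i) (a i) v" using elim by blast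
      have tr: "translation_on plane_surface (ball 0 (r - e)) (T i) (\<lambda>u. mv (T i) (a i) (w + u))"
        if w: "norm w < e" for w
      proof -
        have "norm (w + u) < r" if "norm u < r - e" for u :: plane
          using that w norm_triangle_ineq[of w u] by simp
        then have "(\<lambda>u. w + u) ` ball 0 (r - e) \<subseteq> ball 0 r" by (intro image_subsetI) simp
        then show ?thesis
          by (rule translation_on_comp[OF tsurf_plane tsurf_plane ts translation_on_plane_affine mv_translation[OF ts elim(1)]])
      qed
      show ?case
      proof (rule inj_onI)
        fix w1 w2 :: plane assume w: "w1 \<in> ball 0 e" "w2 \<in> ball 0 e" and eq: "mv (T i) (b i) w1 = mv (T i) (b i) w2"
        have "mv (T i) (b i) w = mv (T i) (a i) (w + v)" if "norm w < e" for w
          unfolding v(2) using mv_add[OF ts elim(1), of v w] that v(1) e by (simp add: add.commute)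
        then have "mv (T i) (a i) (w1 + v) = mv (T i) (a i) (w2 + v)" using eq w by auto
        then have "mv (T i) (a i) (w1 + 0) = mv (T i) (a i) (w2 + 0)"
          by (intro translation_on_unique[OF tsurf_plane ts tr tr, where x = v and y = 0])
            (use w v(1) e norm_ge_zero[of v] in \<open>auto simp del: norm_ge_zero\<close>)
        then show "w1 = w2" using inj w e by (auto dest!: inj_onD)
      qed
    qed
    ultimately show ?case using e by (auto simp: embedded_def)
  qed
  then show ?thesis using that by blast
qed

lemma embedded_immersed: "embedded a r \<Longrightarrow> immersed a r" by (simp add: embedded_def)

text \<open>
  Charts of the limit are well defined: in an embedded disk, moves by different vectors remain a definite distance apart.
\<close>

lemma near_mvs_inj:
  assumes a: "embedded a r" and v: "norm v < r" "norm w < r" and n: "near (mvs a v) (mvs a w)"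
  shows "v = w"
proof (rule ccontr)
  assume "v \<noteq> w"
  define \<delta> where "\<delta> = min (norm (w - v)) (r - norm v)"
  have "\<delta> > 0" using \<open>v \<noteq> w\<close> v by (simp add: \<delta>_def)
  then have "close \<delta> (mvs a v) (mvs a w)"
    using n unfolding near_def by blast
  moreover have "eventually (\<lambda>i. has_ball (T i) (a i) r) F" "eventually (\<lambda>i. inj_on (mv (T i) (a i)) (ball 0 r)) F"
    using a unfolding embedded_def immersed_def by blast+
  ultimately have "eventually (\<lambda>i. False) F"
  proof eventually_elim
    case (elim i)
    obtain u where u: "norm u < \<delta>" "mv (T i) (a i) w = mv (T i) (mv (T i) (a i) v) u" using elim by blast
    have "norm v + norm u < r" using u by (auto simp: \<delta>_def)
    then have "mv (T i) (a i) w = mv (T i) (a i) (v + u)" "norm (v + u) < r"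
      using mv_add[OF ts elim(2), of v u] u norm_triangle_ineq[of v u] by auto
    then have "w = v + u" using elim(3) v by (auto dest!: inj_onD)
    then show False using u by (simp add: \<delta>_def)
  qed
  then show False using ultrafilter_not_False[OF ultra] by blast
qed

text \<open>
  The section obtained from the basepoints by the moves in \<open>p\<close>, the last entry first.
\<close>

definition chain :: "plane list \<Rightarrow> 'i \<Rightarrow> 'b" where
  "chain p = foldr (\<lambda>q a. mvs a q) p base"

text \<open>
  Approximate the vector \<open>v\<close> of each step by a vector of \<open>D\<close>, which at the same time corrects the error \<open>w\<close> of the
  previous steps. Thus the error does not accumulate, and it can be made as small as the disks
  around \<open>a\<close> require.
\<close>

lemma chain_dense:
  assumes D: "\<And>X::plane set. open X \<Longrightarrow> X \<noteq> {} \<Longrightarrow> \<exists>d\<in>D. d \<in> X"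
    and "reachable a" "\<delta> > 0"
  shows "\<exists>p\<in>lists D. \<exists>w. norm w < \<delta> \<and> near (mvs a w) (chain p)"
  using assms(2,3)
proof (induction arbitrary: \<delta>)
  case base
  obtain r where "immersed base r" using reachable_immersed[OF reachable.base] .
  then have "eventually (\<lambda>i. base i = mvs base 0 i) F"
    unfolding immersed_def by eventually_elim (use mv_0[OF ts] in auto)
  then have "near base (mvs base 0)" by (rule near_cong[OF reachable.base])
  then have "near (mvs base 0) base" by (rule near_sym[OF reachable.base])
  then show ?case using base by (intro bexI[of _ "[]"] exI[of _ 0]) (auto simp: chain_def)
next
  case (step a r s b)
  obtain v where v: "norm v \<le> s" and ab: "near (mvs a v) b" by (rule step_limit[OF step(2-4)])
  have vr: "norm v < r" using v step by simp
  define e where "e = min \<delta> (r - s) / 4"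
  have e: "e > 0" "4 * e \<le> \<delta>" "4 * e \<le> r - s" using step by (auto simp: e_def)
  obtain p w where p: "p \<in> lists D" "norm w < e" "near (mvs a w) (chain p)" using step.IH[OF e(1)] by blast
  obtain q where q: "q \<in> D" "dist (v - w) q < e"
    using D[of "ball (v - w) e"] e by auto
  have nq: "norm q < s + 2 * e"
  proof -
    have "norm q \<le> norm (q - (v - w)) + norm (v - w)" using norm_triangle_ineq[of "q - (v - w)" "v - w"] by simp
    also have "\<dots> \<le> norm (q - (v - w)) + (norm v + norm w)" using norm_triangle_ineq4[of v w] by simp
    finally show ?thesis using q p v by (simp add: dist_norm norm_minus_commute)
  qed
  define w' where "w' = w + q - v"
  have nw': "norm w' < e" using q by (simp add: w'_def dist_norm norm_minus_commute algebra_simps)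
  have ta: "reachable (mvs a w)" by (rule reachable_mvs[OF step(1,2)]) (use p e v vr norm_ge_zero[of v] in linarith)
  have tb: "reachable (mvs (mvs a w) q)"
    by (rule reachable_mvs[OF ta immersed_mvs[OF step(2)]]) (use p e v nq norm_ge_zero[of v] in linarith)+
  have tb2: "reachable (mvs a (w + q))"
    by (rule reachable_mvs[OF step(1,2)]) (use norm_triangle_ineq[of w q] p e nq in linarith)
  have tav: "reachable (mvs a v)" by (rule reachable_mvs[OF step(1,2) vr])
  have tv: "reachable (mvs (mvs a v) w')"
    by (rule reachable_mvs[OF tav immersed_mvs[OF step(2) vr]]) (use v e nw' in linarith)
  have 1: "near (mvs (mvs a w) q) (mvs (chain p) q)"
    by (rule near_mvs[OF immersed_mvs[OF step(2)] p(3)]) (use p e v nq norm_ge_zero[of v] in linarith)+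
  have 2: "near (mvs (mvs a w) q) (mvs a (w + q))"
    by (rule near_cong[OF tb mvs_add[OF step(2)]]) (use p e v nq in linarith)
  have eq: "v + w' = w + q" by (simp add: w'_def)
  have 3: "near (mvs (mvs a v) w') (mvs a (w + q))"
    using near_cong[OF tv mvs_add[OF step(2), of v w']] v e nw' unfolding eq by auto
  have 4: "near (mvs (mvs a v) w') (mvs b w')"
    by (rule near_mvs[OF immersed_mvs[OF step(2) vr] ab]) (use v e nw' in linarith)
  have "near (mvs b w') (mvs (mvs a v) w')" by (rule near_sym[OF tv 4])
  moreover have tbw: "reachable (mvs b w')" by (rule reachable_near[OF tv 4])
  ultimately have "near (mvs b w') (mvs a (w + q))" using near_trans 3 by blast
  moreover have "near (mvs a (w + q)) (mvs (mvs a w) q)" by (rule near_sym[OF tb 2])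
  ultimately have "near (mvs b w') (mvs (mvs a w) q)" using near_trans tbw by blast
  then have "near (mvs b w') (mvs (chain p) q)" using 1 near_trans tbw by blast
  moreover have "mvs (chain p) q = chain (q # p)" by (simp add: chain_def)
  ultimately show ?case using p q nw' e by (intro bexI[of _ "q # p"] exI[of _ w']) auto
qed

text \<open>
  Up to identification, reachable sections are determined by finite lists of vectors, so there are at most continuum many of them.
\<close>

lemma chain_near:
  assumes a: "reachable a"
  shows "\<exists>p w. near a (mvs (chain p) w)"
proof -
  obtain r where r: "r > 0" "immersed a r" using reachable_immersed[OF a] .
  have "\<exists>p\<in>lists UNIV. \<exists>w. norm w < r/2 \<and> near (mvs a w) (chain p)"
    by (rule chain_dense[OF _ a]) (use r in auto)
  then obtain p w where p: "norm w < r / 2" "near (mvs a w) (chain p)" by blast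
  have 1: "near (mvs (mvs a w) (- w)) (mvs (chain p) (- w))"
    by (rule near_mvs[OF immersed_mvs[OF r(2)] p(2)]) (use p norm_ge_zero[of w] in \<open>auto simp del: norm_ge_zero\<close>)
  have "eventually (\<lambda>i. a i = mvs (mvs a w) (- w) i) F"
    using r(2) unfolding immersed_def
  proof eventually_elim
    case (elim i)
    then show ?case using mv_back[OF ts elim, of w] p(1) by simp
  qed
  then have "near a (mvs (mvs a w) (- w))" by (rule near_cong[OF a])
  then show ?thesis using near_trans[OF a _ 1] by blast
qed

end

lemma inj_plane_list_real: "\<exists>e :: plane list \<Rightarrow> real. inj e"
proof -
  obtain h where h: "bij_betw h (UNIV \<times> UNIV :: (real \<times> real) set) (UNIV :: real set)"
    using iffD2[OF card_of_ordIso card_of_Times_same_infinite[OF infinite_UNIV_char_0]] by (elim exE)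
  have hi: "h x = h y \<longleftrightarrow> x = y" for x y
    using inj_on_eq_iff[OF bij_betw_imp_inj_on[OF h], of x y] by simp
  define g where "g = (\<lambda>(v::plane, x). h (h (v $ 1, v $ 2), x))"
  have gi: "g (v, x) = g (w, y) \<longleftrightarrow> v = w \<and> x = y" for v w x y
    by (auto simp: g_def hi vec_eq_iff forall_2)
  define e where "e = (\<lambda>p. h (real (length p), foldr (\<lambda>v x. g (v, x)) p 0))"
  have "p = q" if "length p = length q" "foldr (\<lambda>v x. g (v, x)) p 0 = foldr (\<lambda>v x. g (v, x)) q 0" for p q
    using that by (induction p q rule: list_induct2) (auto simp: gi)
  then have "inj e" by (auto simp: inj_def e_def hi)
  then show ?thesis by blast
qed

text \<open>
  Real numbers can serve as names for the classes of identified sections, and hence as the points of the limit.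
\<close>

lemma (in surface_family) label_exists:
  "\<exists>\<kappa> :: ('i \<Rightarrow> 'b) \<Rightarrow> real. \<forall>a b. reachable a \<longrightarrow> reachable b \<longrightarrow> (\<kappa> a = \<kappa> b \<longleftrightarrow> near a b)"
proof -
  obtain e :: "plane list \<Rightarrow> real" where e: "inj e" using inj_plane_list_real by blast
  define rep where "rep = (\<lambda>a. SOME x. near a x)"
  have rep: "near a (rep a)" if "reachable a" for a
    unfolding rep_def by (rule someI[of "near a"]) (rule near_refl[OF that])
  have "\<forall>a. \<exists>l. reachable a \<longrightarrow> near a (mvs (chain (tl l)) (hd l))"
    using chain_near by (metis list.sel(1) list.sel(3))
  then obtain l where l: "\<And>a. reachable a \<Longrightarrow> near a (mvs (chain (tl (l a))) (hd (l a)))" by metis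
  have "e (l (rep a)) = e (l (rep b)) \<longleftrightarrow> near a b" if ab: "reachable a" "reachable b" for a b
  proof
    have ta: "reachable (rep a)" "reachable (rep b)" using reachable_near rep ab by blast+
    assume "e (l (rep a)) = e (l (rep b))"
    then have *: "l (rep a) = l (rep b)" using e by (auto dest: injD)
    define c where "c = mvs (chain (tl (l (rep a)))) (hd (l (rep a)))"
    have "near (rep a) c" "near (rep b) c" using l[OF ta(1)] l[OF ta(2)] by (auto simp: c_def *)
    then show "near a b"
      using ab ta rep near_trans near_sym reachable_near by metis
  next
    assume "near a b"
    then have "near a x \<longleftrightarrow> near b x" for x
      using near_trans[OF ab(1), of b x] near_trans[OF ab(2) near_sym[OF ab(1)], of x] \<open>near a b\<close> by metis
    then have "near a = near b" by blast
    then show "e (l (rep a)) = e (l (rep b))" by (simp add: rep_def)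
  qed
  then show ?thesis by (intro exI[of _ "\<lambda>a. e (l (rep a))"]) blast
qed

section \<open>The ultralimit of a family of surfaces\<close>

definition compatible_charts :: "'a topology \<Rightarrow> ('a set \<times> ('a \<Rightarrow> plane)) set \<Rightarrow> ('a set \<times> ('a \<Rightarrow> plane)) set" where
  "compatible_charts X A = {c. openin X (fst c) \<and> snd c \<in> extensional (fst c) \<and>
     local_homeomorphism_on X (fst c) (snd c) \<and> (\<forall>d\<in>A. translation_compatible X c d)}"

text \<open>
  All charts compatible with \<open>A\<close> are compatible with each other, since near each point they can be
  compared through a chart in \<open>A\<close>.
\<close>

lemma compatible_charts_maximal:
  assumes A: "translation_atlas X A"
  shows "A \<subseteq> compatible_charts X A" "maximal_translation_atlas X (compatible_charts X A)"
proof -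
  define ok where "ok = (\<lambda>c. c \<in> compatible_charts X A)"
  note ok_def = ok_def compatible_charts_def mem_Collect_eq
  define B where "B = compatible_charts X A"
  have B: "c \<in> B \<longleftrightarrow> ok c" for c by (simp add: B_def ok_def)
  have atl: "translation_atlas X C \<longleftrightarrow>
     (\<forall>c\<in>C. openin X (fst c) \<and> snd c \<in> extensional (fst c) \<and> local_homeomorphism_on X (fst c) (snd c)) \<and>
     (\<Union>c\<in>C. fst c) = topspace X \<and> (\<forall>c\<in>C. \<forall>d\<in>C. translation_compatible X c d)" for C
    unfolding translation_atlas_def by (simp add: case_prod_unfold)
  have AB: "A \<subseteq> B"
    using A unfolding atl B_def ok_def(2) by blast
  have cmp: "translation_compatible X c d" if c: "ok c" and d: "ok d" for c d
  proof -
    obtain U \<phi> where cU: "c = (U, \<phi>)" by (cases c)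
    obtain V \<psi> where dV: "d = (V, \<psi>)" by (cases d)
    show ?thesis
      unfolding cU dV translation_compatible_def prod.case
    proof
      fix x assume x: "x \<in> U \<inter> V"
      have "x \<in> topspace X" using x c openin_subset unfolding ok_def cU by fastforce
      then obtain e where e: "e \<in> A" "x \<in> fst e" using A unfolding atl by blast
      obtain Q \<theta> where eQ: "e = (Q, \<theta>)" by (cases e)
      have "translation_compatible X (U, \<phi>) (Q, \<theta>)" "translation_compatible X (V, \<psi>) (Q, \<theta>)"
        using c d e unfolding ok_def cU dV eQ by blast+
      then have "\<exists>W v. openin X W \<and> x \<in> W \<and> W \<subseteq> U \<inter> Q \<and> (\<forall>y\<in>W. \<phi> y - \<theta> y = v)"
        "\<exists>W v. openin X W \<and> x \<in> W \<and> W \<subseteq> V \<inter> Q \<and> (\<forall>y\<in>W. \<psi> y - \<theta> y = v)"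
        using x e(2) unfolding translation_compatible_def eQ prod.case fst_conv by blast+
      then obtain W1 v1 W2 v2 where
        W1: "openin X W1" "x \<in> W1" "W1 \<subseteq> U \<inter> Q" "\<And>y. y\<in>W1 \<Longrightarrow> \<phi> y - \<theta> y = v1" and
        W2: "openin X W2" "x \<in> W2" "W2 \<subseteq> V \<inter> Q" "\<And>y. y\<in>W2 \<Longrightarrow> \<psi> y - \<theta> y = v2"
        by metis
      have "\<phi> y - \<psi> y = v1 - v2" if "y \<in> W1 \<inter> W2" for y
      proof -
        have "\<phi> y - \<psi> y = (\<phi> y - \<theta> y) - (\<psi> y - \<theta> y)" by simp
        also have "\<dots> = v1 - v2" using W1(4)[of y] W2(4)[of y] that by simp
        finally show ?thesis .
      qed
      moreover have "openin X (W1 \<inter> W2)" "x \<in> W1 \<inter> W2" "W1 \<inter> W2 \<subseteq> U \<inter> V" using W1 W2 by auto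
      ultimately show "\<exists>W v. openin X W \<and> x \<in> W \<and> W \<subseteq> U \<inter> V \<and> (\<forall>y\<in>W. \<phi> y - \<psi> y = v)"
        by meson
    qed
  qed
  have cov: "(\<Union>c\<in>B. fst c) = topspace X"
  proof
    show "(\<Union>c\<in>B. fst c) \<subseteq> topspace X" unfolding B_def compatible_charts_def using openin_subset by fastforce
    have "(\<Union>c\<in>A. fst c) = topspace X" using A unfolding atl by blast
    then show "topspace X \<subseteq> (\<Union>c\<in>B. fst c)" using AB by blast
  qed
  have 1: "translation_atlas X B"
    unfolding atl
  proof (intro conjI ballI cov)
    fix c assume "c \<in> B"
    then show "openin X (fst c)" "snd c \<in> extensional (fst c)" "local_homeomorphism_on X (fst c) (snd c)"
      by (simp_all add: B_def compatible_charts_def)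
  next
    fix c d assume "c \<in> B" "d \<in> B"
    then show "translation_compatible X c d" using cmp by (simp add: B)
  qed
  have 2: "C = B" if C: "translation_atlas X C" "B \<subseteq> C" for C
  proof -
    have "ok c" if "c \<in> C" for c
      using C(1) that AB C(2) unfolding atl ok_def by (meson subsetD)
    then show ?thesis using C(2) B by blast
  qed
  show "A \<subseteq> compatible_charts X A" using AB by (simp add: B_def)
  show "maximal_translation_atlas X (compatible_charts X A)"
    using 1 2 unfolding maximal_translation_atlas_def B_def by blast
qed

text \<open>
  \<open>\<kappa> a\<close> is the point of the limit represented by the section \<open>a\<close>.
\<close>

locale ultralimit = surface_family T F \<rho>
  for T :: "'i \<Rightarrow> 'b pointed" and F :: "'i filter" and \<rho> :: real +
  fixes \<kappa> :: "('i \<Rightarrow> 'b) \<Rightarrow> real"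
  assumes label: "\<And>a b. reachable a \<Longrightarrow> reachable b \<Longrightarrow> \<kappa> a = \<kappa> b \<longleftrightarrow> near a b"
begin

abbreviation move :: "('i \<Rightarrow> 'b) \<Rightarrow> plane \<Rightarrow> real" where
  "move a v \<equiv> \<kappa> (mvs a v)"

lemma label_cong: "reachable a \<Longrightarrow> eventually (\<lambda>i. a i = b i) F \<Longrightarrow> \<kappa> a = \<kappa> b"
  using near_cong reachable_near label by blast

lemma move_0: "reachable a \<Longrightarrow> move a 0 = \<kappa> a"
proof -
  assume a: "reachable a"
  obtain r where "immersed a r" using reachable_immersed[OF a] .
  then have "eventually (\<lambda>i. a i = mvs a 0 i) F"
    unfolding immersed_def by eventually_elim (use mv_0[OF ts] in auto)
  then show ?thesis using label_cong[OF a] by simp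
qed

lemma move_add:
  assumes a: "reachable a" "immersed a r" and v: "norm v + norm w < r"
  shows "move (mvs a v) w = move a (v + w)"
proof -
  have v': "norm v < r" using v norm_ge_zero[of w] by linarith
  have "reachable (mvs (mvs a v) w)"
    by (rule reachable_mvs[OF reachable_mvs[OF a v'] immersed_mvs[OF a(2) v']]) (use v in linarith)
  then show ?thesis using mvs_add[OF a(2) v] by (rule label_cong)
qed

text \<open>
  The move of \<open>\<kappa> b\<close> continues the move of \<open>\<kappa> a\<close>, whichever section \<open>b\<close> represents the
  intermediate point.
\<close>

lemma move_shift:
  assumes a: "reachable a" "immersed a r" and v: "norm v < r" and b: "reachable b" "\<kappa> b = move a v" and u: "norm u < r - norm v"
  shows "move b u = move a (v + u)"
proof -
  have t: "reachable (mvs a v)" by (rule reachable_mvs[OF a v])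
  have n: "near (mvs a v) b" using label[OF t b(1)] b(2) by simp
  have w: "immersed (mvs a v) (r - norm v)" by (rule immersed_mvs[OF a(2) v])
  have n2: "near (mvs (mvs a v) u) (mvs b u)" by (rule near_mvs[OF w n u])
  have t2: "reachable (mvs (mvs a v) u)" by (rule reachable_mvs[OF t w u])
  have "move (mvs a v) u = move b u" using label[OF t2 reachable_near[OF t2 n2]] n2 by simp
  then show ?thesis using move_add[OF a, of v u] u by simp
qed

lemma move_inj: "reachable a \<Longrightarrow> embedded a r \<Longrightarrow> inj_on (move a) (ball 0 r)"
proof (rule inj_onI)
  fix v w :: plane assume a: "reachable a" "embedded a r" and v: "v \<in> ball 0 r" "w \<in> ball 0 r" "move a v = move a w"
  then have n: "norm v < r" "norm w < r" by auto
  have "near (mvs a v) (mvs a w)"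
    using label[OF reachable_mvs[OF a(1) embedded_immersed[OF a(2)] n(1)] reachable_mvs[OF a(1) embedded_immersed[OF a(2)] n(2)]] v(3) by blast
  then show "v = w" by (rule near_mvs_inj[OF a(2) n])
qed

text \<open>
  The final topology for the maps \<open>v \<mapsto> move a v\<close> on small disks.
\<close>

definition open_lim :: "real set \<Rightarrow> bool" where
  "open_lim O' \<longleftrightarrow> O' \<subseteq> \<kappa> ` Collect reachable \<and>
     (\<forall>a. reachable a \<and> \<kappa> a \<in> O' \<longrightarrow> (\<exists>r>0. \<forall>v. norm v < r \<longrightarrow> move a v \<in> O'))"

definition lim_space :: "real topology" where
  "lim_space = topology open_lim"

lemma openin_lim: "openin lim_space = open_lim"
proof -
  have "istopology open_lim"
    unfolding istopology_def
  proof (intro conjI allI impI)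
    fix S S' assume S: "open_lim S" "open_lim S'"
    have "\<exists>r>0. \<forall>v. norm v < r \<longrightarrow> move a v \<in> S \<inter> S'" if a: "reachable a" "\<kappa> a \<in> S \<inter> S'" for a
    proof -
      have "\<exists>r>0. \<forall>v. norm v < r \<longrightarrow> move a v \<in> S" "\<exists>r>0. \<forall>v. norm v < r \<longrightarrow> move a v \<in> S'"
        using S a unfolding open_lim_def by blast+
      then obtain r r' where r: "r > 0" "\<forall>v. norm v < r \<longrightarrow> move a v \<in> S" "r' > 0" "\<forall>v. norm v < r' \<longrightarrow> move a v \<in> S'"
        by (elim exE conjE)
      then show ?thesis by (intro exI[of _ "min r r'"]) simp
    qed
    then show "open_lim (S \<inter> S')" using S unfolding open_lim_def by blast
  next
    fix \<U> assume U: "\<forall>S\<in>\<U>. open_lim S"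
    have "\<exists>r>0. \<forall>v. norm v < r \<longrightarrow> move a v \<in> \<Union>\<U>" if a: "reachable a" "\<kappa> a \<in> \<Union>\<U>" for a
    proof -
      obtain S where S: "S \<in> \<U>" "\<kappa> a \<in> S" using a by blast
      then obtain r where "r > 0" "\<And>v. norm v < r \<Longrightarrow> move a v \<in> S" using U a unfolding open_lim_def by metis
      then show ?thesis using S by (intro exI[of _ r]) auto
    qed
    then show "open_lim (\<Union>\<U>)" using U unfolding open_lim_def by blast
  qed
  then show ?thesis unfolding lim_space_def by (simp add: topology_inverse')
qed

lemma topspace_lim: "topspace lim_space = \<kappa> ` Collect reachable"
proof -
  have "open_lim (\<kappa> ` Collect reachable)"
    unfolding open_lim_def
  proof (intro conjI allI impI)
    fix a assume a: "reachable a \<and> \<kappa> a \<in> \<kappa> ` Collect reachable"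
    obtain r where "r > 0" "immersed a r" using reachable_immersed a by blast
    then show "\<exists>r>0. \<forall>v. norm v < r \<longrightarrow> move a v \<in> \<kappa> ` Collect reachable"
      using a reachable_mvs by blast
  qed simp
  then show ?thesis
    unfolding topspace_def openin_lim by (auto simp: open_lim_def)
qed

lemma topspace_limE:
  assumes "x \<in> topspace lim_space"
  obtains a where "reachable a" "x = \<kappa> a"
  using assms unfolding topspace_lim by blast

lemma reachable_topspace: "reachable a \<Longrightarrow> \<kappa> a \<in> topspace lim_space"
  by (auto simp: topspace_lim)

lemma move_image_open:
  assumes a: "reachable a" "immersed a r" and V: "open V" "V \<subseteq> ball 0 r"
  shows "open_lim (move a ` V)"
  unfolding open_lim_def
proof (intro conjI allI impI)
  show "move a ` V \<subseteq> \<kappa> ` Collect reachable" using reachable_mvs[OF a] V(2) by auto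
  fix b assume b: "reachable b \<and> \<kappa> b \<in> move a ` V"
  then obtain v where v: "v \<in> V" "\<kappa> b = move a v" by auto
  obtain e where e: "e > 0" "ball v e \<subseteq> V" using V(1) v(1) openE by blast
  have vr: "norm v < r" using v V by auto
  have "move b u \<in> move a ` V" if u: "norm u < min e (r - norm v)" for u
  proof -
    have "v + u \<in> ball v e" using u by (simp add: dist_norm)
    then have "v + u \<in> V" using e by blast
    then show ?thesis using move_shift[OF a vr _ v(2)] b u by auto
  qed
  then show "\<exists>r>0. \<forall>u. norm u < r \<longrightarrow> move b u \<in> move a ` V"
    using e vr by (intro exI[of _ "min e (r - norm v)"]) auto
qed

lemma move_preimage_open:
  assumes a: "reachable a" "immersed a r" and O': "open_lim O'"
  shows "open {v \<in> ball 0 r. move a v \<in> O'}"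
  unfolding open_contains_ball
proof
  fix v assume v: "v \<in> {v \<in> ball 0 r. move a v \<in> O'}"
  then have vr: "norm v < r" by simp
  have t: "reachable (mvs a v)" by (rule reachable_mvs[OF a vr])
  then obtain q where q: "q > 0" "\<And>u. norm u < q \<Longrightarrow> move (mvs a v) u \<in> O'"
    using O' v unfolding open_lim_def by blast
  have "w \<in> {v \<in> ball 0 r. move a v \<in> O'}" if "w \<in> ball v (min q (r - norm v))" for w
  proof -
    have n: "norm (w - v) < q" "norm v + norm (w - v) < r" using that by (auto simp: dist_norm norm_minus_commute)
    have "move (mvs a v) (w - v) = move a (v + (w - v))"
      by (rule move_add[OF a n(2)])
    then have "move a w \<in> O'" using q(2)[OF n(1)] by simp
    moreover have "norm w < r" using n norm_triangle_ineq[of v "w - v"] by simp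
    ultimately show ?thesis by simp
  qed
  then show "\<exists>e>0. ball v e \<subseteq> {v \<in> ball 0 r. move a v \<in> O'}"
    using q vr by (intro exI[of _ "min q (r - norm v)"]) (auto simp del: mem_ball)
qed

lemma move_continuous:
  assumes a: "reachable a" "immersed a r"
  shows "continuous_map (top_of_set (ball 0 r)) lim_space (move a)"
  unfolding continuous_map_def
proof (intro conjI allI impI)
  show "move a \<in> topspace (top_of_set (ball 0 r)) \<rightarrow> topspace lim_space"
    using reachable_mvs[OF a] reachable_topspace by auto
  fix O' assume "openin lim_space O'"
  then have "open {v \<in> ball 0 r. move a v \<in> O'}" using move_preimage_open[OF a] openin_lim by simp
  then show "openin (top_of_set (ball 0 r)) {x \<in> topspace (top_of_set (ball 0 r)). move a x \<in> O'}"
    by (auto intro!: open_subset)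
qed

definition patch :: "('i \<Rightarrow> 'b) \<Rightarrow> real \<Rightarrow> real set" where
  "patch a r = move a ` ball 0 r"

definition pchart :: "('i \<Rightarrow> 'b) \<Rightarrow> real \<Rightarrow> real \<Rightarrow> plane" where
  "pchart a r = restrict (inv_into (ball 0 r) (move a)) (patch a r)"

lemma patch_open: "reachable a \<Longrightarrow> immersed a r \<Longrightarrow> openin lim_space (patch a r)"
  unfolding patch_def openin_lim by (rule move_image_open) auto

lemma label_in_patch: "reachable a \<Longrightarrow> r > 0 \<Longrightarrow> \<kappa> a \<in> patch a r"
  unfolding patch_def by (rule image_eqI[of _ _ 0]) (simp_all add: move_0)

lemma pchart_move: "reachable a \<Longrightarrow> embedded a r \<Longrightarrow> norm v < r \<Longrightarrow> pchart a r (move a v) = v"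
  unfolding pchart_def patch_def by (simp add: inv_into_f_f[OF move_inj])

lemma pchart_homeomorphic:
  assumes a: "reachable a" "embedded a r"
  shows "pchart a r ` patch a r = ball 0 r"
    "homeomorphic_map (subtopology lim_space (patch a r)) (top_of_set (ball 0 r)) (pchart a r)"
proof -
  have top: "topspace (subtopology lim_space (patch a r)) = patch a r"
    using openin_subset[OF patch_open[OF a(1) embedded_immersed[OF a(2)]]] by auto
  show im: "pchart a r ` patch a r = ball 0 r"
    unfolding patch_def image_image using pchart_move[OF a] by auto
  show "homeomorphic_map (subtopology lim_space (patch a r)) (top_of_set (ball 0 r)) (pchart a r)"
  proof (rule bijective_open_imp_homeomorphic_map)
    show "continuous_map (subtopology lim_space (patch a r)) (top_of_set (ball 0 r)) (pchart a r)"
      unfolding continuous_map_def top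
    proof (intro conjI allI impI)
      show "pchart a r \<in> patch a r \<rightarrow> topspace (top_of_set (ball 0 r))" using im by auto
      fix V :: "plane set" assume "openin (top_of_set (ball 0 r)) V"
      then have V: "open V" "V \<subseteq> ball 0 r" using openin_open_eq[OF open_ball] by blast+
      have "{x \<in> patch a r. pchart a r x \<in> V} = move a ` V"
        unfolding patch_def using pchart_move[OF a] V(2) by auto
      moreover have "openin lim_space (move a ` V)"
        unfolding openin_lim by (rule move_image_open[OF a(1) embedded_immersed[OF a(2)] V])
      moreover have "move a ` V \<subseteq> patch a r" using V by (auto simp: patch_def)
      ultimately show "openin (subtopology lim_space (patch a r)) {x \<in> patch a r. pchart a r x \<in> V}"
        using openin_subtopology_Int[of lim_space "move a ` V" "patch a r"] by (simp only: inf.absorb1)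
    qed
    show "open_map (subtopology lim_space (patch a r)) (top_of_set (ball 0 r)) (pchart a r)"
      unfolding open_map_def
    proof (intro allI impI)
      fix O' assume "openin (subtopology lim_space (patch a r)) O'"
      then obtain Q where Q: "openin lim_space Q" "O' = Q \<inter> patch a r" by (auto simp: openin_subtopology)
      have "pchart a r ` O' = {v \<in> ball 0 r. move a v \<in> Q}"
        unfolding Q(2) patch_def using pchart_move[OF a] by (auto intro!: image_eqI)
      moreover have "open {v \<in> ball 0 r. move a v \<in> Q}"
        by (rule move_preimage_open[OF a(1) embedded_immersed[OF a(2)]]) (use Q openin_lim in simp)
      ultimately show "openin (top_of_set (ball 0 r)) (pchart a r ` O')" by (auto intro!: open_subset)
    qed
    show "pchart a r ` topspace (subtopology lim_space (patch a r)) = topspace (top_of_set (ball 0 r))"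
      unfolding top using im by simp
    show "inj_on (pchart a r) (topspace (subtopology lim_space (patch a r)))"
      unfolding top by (rule inj_onI) (auto simp: patch_def pchart_move[OF a])
  qed
qed

definition lim_atlas :: "(real set \<times> (real \<Rightarrow> plane)) set" where
  "lim_atlas = {(patch a r, pchart a r) | a r. reachable a \<and> embedded a r}"

text \<open>
  If \<open>move a v = move b w\<close>, then \<open>move a (v + u) = move b (w + u)\<close> for short \<open>u\<close>, so the charts
  about \<open>a\<close> and \<open>b\<close> differ by the constant \<open>v - w\<close>.
\<close>

lemma lim_atlas: "translation_atlas lim_space lim_atlas"
  unfolding translation_atlas_def
proof (intro conjI ballI)
  fix c assume "c \<in> lim_atlas"
  then obtain a r where c: "c = (patch a r, pchart a r)" "reachable a" "embedded a r" by (auto simp: lim_atlas_def)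
  note o = patch_open[OF c(2) embedded_immersed[OF c(3)]]
  have "local_homeomorphism_on lim_space (patch a r) (pchart a r)"
    unfolding local_homeomorphism_on_def
    using o pchart_homeomorphic[OF c(2,3)] by (intro ballI exI[of _ "patch a r"]) auto
  then show "case c of (U, \<phi>) \<Rightarrow> openin lim_space U \<and> \<phi> \<in> extensional U \<and> local_homeomorphism_on lim_space U \<phi>"
    using o unfolding c(1) by (simp add: pchart_def)
next
  show "(\<Union>(U, \<phi>)\<in>lim_atlas. U) = topspace lim_space"
  proof
    show "(\<Union>(U, \<phi>)\<in>lim_atlas. U) \<subseteq> topspace lim_space"
      using openin_subset[OF patch_open] embedded_immersed by (fastforce simp: lim_atlas_def)
    show "topspace lim_space \<subseteq> (\<Union>(U, \<phi>)\<in>lim_atlas. U)"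
    proof
      fix x assume "x \<in> topspace lim_space"
      then obtain a where a: "reachable a" "x = \<kappa> a" by (auto simp: topspace_lim)
      obtain r where r: "r > 0" "embedded a r" using reachable_embedded[OF a(1)] .
      then have "(patch a r, pchart a r) \<in> lim_atlas" using a by (auto simp: lim_atlas_def)
      then show "x \<in> (\<Union>(U, \<phi>)\<in>lim_atlas. U)" using label_in_patch[OF a(1) r(1)] a(2) by blast
    qed
  qed
next
  fix c d assume "c \<in> lim_atlas" "d \<in> lim_atlas"
  then obtain a r b q where c: "c = (patch a r, pchart a r)" "reachable a" "embedded a r"
    and d: "d = (patch b q, pchart b q)" "reachable b" "embedded b q" by (auto simp: lim_atlas_def)
  show "translation_compatible lim_space c d"
    unfolding c(1) d(1) translation_compatible_def prod.case
  proof
    fix x assume "x \<in> patch a r \<inter> patch b q"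
    then obtain v w where v: "norm v < r" "x = move a v" and w: "norm w < q" "x = move b w"
      by (auto simp: patch_def)
    define e where "e = min (r - norm v) (q - norm w)"
    have e: "e > 0" using v w by (simp add: e_def)
    have t: "reachable (mvs a v)" by (rule reachable_mvs[OF c(2) embedded_immersed[OF c(3)] v(1)])
    have eq: "move a (v + u) = move b (w + u)" "norm (v + u) < r" "norm (w + u) < q" if u: "norm u < e" for u
    proof -
      have "move (mvs a v) u = move b (w + u)"
        by (rule move_shift[OF d(2) embedded_immersed[OF d(3)] w(1) t]) (use v w u in \<open>auto simp: e_def\<close>)
      moreover have "move (mvs a v) u = move a (v + u)"
        by (rule move_add[OF c(2) embedded_immersed[OF c(3)]]) (use u in \<open>auto simp: e_def\<close>)
      ultimately show "move a (v + u) = move b (w + u)" by simp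
      show "norm (v + u) < r" "norm (w + u) < q"
        using u norm_triangle_ineq[of v u] norm_triangle_ineq[of w u] by (auto simp: e_def)
    qed
    have bs: "y \<in> ball v e \<longleftrightarrow> norm (y - v) < e" for y by (simp add: dist_norm norm_minus_commute)
    have sub: "ball v e \<subseteq> ball 0 r"
    proof
      fix y assume "y \<in> ball v e"
      then have "norm (v + (y - v)) < r" using eq(2) bs by blast
      then show "y \<in> ball 0 r" by simp
    qed
    have diff: "pchart a r y - pchart b q y = v - w \<and> y \<in> patch b q" if y: "y \<in> move a ` ball v e" for y
    proof -
      obtain z where z: "norm (z - v) < e" "y = move a z" using y bs by blast
      define u where "u = z - v"
      have u: "norm u < e" "y = move a (v + u)" using z by (auto simp: u_def)
      have "pchart a r y = v + u" unfolding u(2) by (rule pchart_move[OF c(2,3) eq(2)[OF u(1)]])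
      moreover have "pchart b q y = w + u" unfolding u(2) eq(1)[OF u(1)] by (rule pchart_move[OF d(2,3) eq(3)[OF u(1)]])
      moreover have "y \<in> patch b q" unfolding u(2) eq(1)[OF u(1)] patch_def using eq(3)[OF u(1)] by simp
      ultimately show ?thesis by simp
    qed
    show "\<exists>W v. openin lim_space W \<and> x \<in> W \<and> W \<subseteq> patch a r \<inter> patch b q \<and>
         (\<forall>y\<in>W. pchart a r y - pchart b q y = v)"
    proof (intro exI conjI ballI)
      show "openin lim_space (move a ` ball v e)"
        unfolding openin_lim by (rule move_image_open[OF c(2) embedded_immersed[OF c(3)] open_ball sub])
      show "x \<in> move a ` ball v e" using v e by simp
      show "move a ` ball v e \<subseteq> patch a r \<inter> patch b q" using diff sub by (auto simp: patch_def)
      show "pchart a r y - pchart b q y = v - w" if "y \<in> move a ` ball v e" for y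
        using diff[OF that] by simp
    qed
  qed
qed

text \<open>
  Sections that are not identified have almost everywhere distance at least some \<open>\<delta>\<close>;
  disks of radius at most \<open>\<delta> / 3\<close> about them are disjoint.
\<close>

lemma lim_Hausdorff: "Hausdorff_space lim_space"
  unfolding Hausdorff_space_def
proof (intro allI impI, elim conjE)
  fix x y assume xy: "x \<in> topspace lim_space" "y \<in> topspace lim_space" "x \<noteq> y"
  then obtain a b where a: "reachable a" "x = \<kappa> a" and b: "reachable b" "y = \<kappa> b" by (auto simp: topspace_lim)
  have "\<not> near a b" using label a b xy by blast
  then obtain \<delta> where \<delta>: "\<delta> > 0" "\<not> close \<delta> a b"
    unfolding near_def by blast
  obtain r where r: "r > 0" "immersed a r" using reachable_immersed[OF a(1)] .
  obtain q where q: "q > 0" "immersed b q" using reachable_immersed[OF b(1)] .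
  define e where "e = min \<delta> (min r q) / 3"
  have e: "e > 0" "3 * e \<le> \<delta>" "3 * e \<le> r" "3 * e \<le> q" using \<delta> r q by (auto simp: e_def)
  have wa: "immersed a e" by (rule immersed_mono[OF r(2)]) (use e in auto)
  have wb: "immersed b e" by (rule immersed_mono[OF q(2)]) (use e in auto)
  have "False" if z: "z \<in> patch a e" "z \<in> patch b e" for z
  proof -
    obtain v w where v: "norm v < e" "z = move a v" and w: "norm w < e" "z = move b w"
      using z by (auto simp: patch_def)
    have "near (mvs a v) (mvs b w)"
      using label[OF reachable_mvs[OF a(1) wa v(1)] reachable_mvs[OF b(1) wb w(1)]] v w by simp
    then have "close e (mvs a v) (mvs b w)"
      using e unfolding near_def by blast
    then have "close \<delta> a b"
      using r(2) q(2) unfolding immersed_def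
    proof eventually_elim
      case (elim i)
      then obtain u where u: "norm u < e" "mv (T i) (b i) w = mv (T i) (mv (T i) (a i) v) u" by blast
      have n: "norm (v + u + - w) < 3 * e"
        using v w u norm_triangle_ineq[of "v + u" "- w"] norm_triangle_ineq[of v u] by simp
      have "b i = mv (T i) (mv (T i) (b i) w) (- w)"
        using mv_back[OF ts elim(3), of w] w e norm_ge_zero[of w] by simp
      also have "\<dots> = mv (T i) (mv (T i) (a i) (v + u)) (- w)"
        unfolding u(2) using mv_add[OF ts elim(2), of v u] v u e by simp
      also have "\<dots> = mv (T i) (a i) (v + u + - w)"
        using mv_add[OF ts elim(2), of "v + u" "- w"] v w u e norm_triangle_ineq[of v u] by simp
      finally show ?case using n e by (intro exI[of _ "v + u + - w"]) auto
    qed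
    then show False using \<delta> by blast
  qed
  then have "disjnt (patch a e) (patch b e)" by (auto simp: disjnt_iff)
  then show "\<exists>U V. openin lim_space U \<and> openin lim_space V \<and> x \<in> U \<and> y \<in> V \<and> disjnt U V"
    using patch_open[OF a(1) wa] patch_open[OF b(1) wb] label_in_patch[OF a(1) e(1)] label_in_patch[OF b(1) e(1)] a b
    by blast
qed

text \<open>
  A step leads from a section to a point of one disk about it, so induction on the steps
  connects every point to the basepoint.
\<close>

lemma lim_connected: "connected_space lim_space"
proof -
  have pc: "connectedin lim_space (patch a r)" if "reachable a" "immersed a r" for a r
    unfolding patch_def
    by (rule connectedin_continuous_map_image[OF move_continuous[OF that]]) (simp add: connectedin_subtopology)
  have *: "\<exists>S. connectedin lim_space S \<and> \<kappa> base \<in> S \<and> \<kappa> a \<in> S" if "reachable a" for a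
    using that
  proof induction
    case base
    show ?case by (rule exI[of _ "{\<kappa> base}"]) (auto simp: connectedin_sing reachable_topspace reachable.base)
  next
    case (step a r s b)
    then obtain S where S: "connectedin lim_space S" "\<kappa> base \<in> S" "\<kappa> a \<in> S" by blast
    obtain v where v: "norm v \<le> s" and n: "near (mvs a v) b" by (rule step_limit[OF step(2-4)])
    have vr: "norm v < r" using v step by simp
    have t: "reachable (mvs a v)" by (rule reachable_mvs[OF step(1,2) vr])
    have "\<kappa> b = move a v" using label[OF t reachable_near[OF t n]] n by simp
    then have "\<kappa> b \<in> patch a r" using vr by (simp add: patch_def)
    moreover have "\<kappa> a \<in> patch a r" by (rule label_in_patch[OF step(1) immersed_pos[OF step(2)]])
    ultimately show ?case
      using S pc[OF step(1,2)] by (intro exI[of _ "S \<union> patch a r"] conjI connectedin_Un) auto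
  qed
  show ?thesis
    unfolding connected_space_subconnected
  proof (intro ballI)
    fix x y assume "x \<in> topspace lim_space" "y \<in> topspace lim_space"
    then obtain a b where a: "reachable a" "x = \<kappa> a" and b: "reachable b" "y = \<kappa> b" by (auto simp: topspace_lim)
    obtain S where S: "connectedin lim_space S" "\<kappa> base \<in> S" "\<kappa> a \<in> S" using *[OF a(1)] by blast
    obtain S' where S': "connectedin lim_space S'" "\<kappa> base \<in> S'" "\<kappa> b \<in> S'" using *[OF b(1)] by blast
    show "\<exists>S. connectedin lim_space S \<and> x \<in> S \<and> y \<in> S"
      using S S' a b by (intro exI[of _ "S \<union> S'"] conjI connectedin_Un) auto
  qed
qed

text \<open>
  A base is given by the disks of radius \<open>1 / n\<close> about the sections obtained by moves in a countable dense set.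
\<close>

lemma lim_second_countable: "second_countable lim_space"
proof -
  obtain D :: "plane set" where D: "countable D" "\<And>X. open X \<Longrightarrow> X \<noteq> {} \<Longrightarrow> \<exists>d\<in>D. d \<in> X"
    using countable_dense_setE by blast
  define \<B> where "\<B> = (\<lambda>(p, n). patch (chain p) (1 / real (Suc n))) `
     {(p, n). p \<in> lists D \<and> reachable (chain p) \<and> immersed (chain p) (1 / real (Suc n))}"
  have "countable (lists D \<times> (UNIV :: nat set))" using D(1) by simp
  then have "countable {(p, n::nat). p \<in> lists D \<and> reachable (chain p) \<and> immersed (chain p) (1 / real (Suc n))}"
    by (rule countable_subset[rotated]) auto
  then have 1: "countable \<B>" unfolding \<B>_def by (rule countable_image)
  have 2: "openin lim_space V" if "V \<in> \<B>" for V
    using that patch_open by (auto simp: \<B>_def)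
  have 3: "\<exists>V\<in>\<B>. x \<in> V \<and> V \<subseteq> U" if U: "openin lim_space U" "x \<in> U" for U x
  proof -
    obtain a where a: "reachable a" "x = \<kappa> a"
      using topspace_limE openin_subset[OF U(1)] U(2) by blast
    obtain q where q: "q > 0" "\<And>v. norm v < q \<Longrightarrow> move a v \<in> U"
      using U a unfolding openin_lim open_lim_def by blast
    obtain r where r: "r > 0" "immersed a r" using reachable_immersed[OF a(1)] .
    define e where "e = min q r / 3"
    have e: "e > 0" "3 * e \<le> q" "3 * e \<le> r" using q r by (auto simp: e_def)
    obtain n where n: "1 / real (Suc n) < e" using e(1) nat_approx_posE by blast
    define \<eta> where "\<eta> = 1 / real (Suc n)"
    have \<eta>: "\<eta> > 0" "\<eta> < e" using n by (auto simp: \<eta>_def)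
    obtain p w where p: "p \<in> lists D" "norm w < \<eta>" "near (mvs a w) (chain p)"
      using chain_dense[OF D(2) a(1) \<eta>(1)] by blast
    have wr: "norm w < r" using p \<eta> e by simp
    have t: "reachable (mvs a w)" by (rule reachable_mvs[OF a(1) r(2) wr])
    have tp: "reachable (chain p)" by (rule reachable_near[OF t p(3)])
    have wp: "immersed (chain p) \<eta>" by (rule near_immersed[OF immersed_mvs[OF r(2) wr] p(3)]) (use p \<eta> e in auto)
    have eq: "move (chain p) u = move a (w + u)" if "norm u < \<eta> + \<eta>" for u
      by (rule move_shift[OF a(1) r(2) wr tp]) (use label[OF t tp] p that \<eta> e in auto)
    have "move (chain p) (- w) = \<kappa> a" using eq[of "- w"] p move_0[OF a(1)] \<eta> by simp
    then have "x \<in> patch (chain p) \<eta>" unfolding patch_def a(2) using p by (intro image_eqI[of _ _ "- w"]) auto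
    moreover have "patch (chain p) \<eta> \<subseteq> U"
    proof
      fix y assume "y \<in> patch (chain p) \<eta>"
      then obtain u where u: "norm u < \<eta>" "y = move (chain p) u" by (auto simp: patch_def)
      have "norm (w + u) < q" using norm_triangle_ineq[of w u] u p \<eta> e by simp
      then show "y \<in> U" using q(2)[of "w + u"] eq[of u] u \<eta> by simp
    qed
    moreover have "patch (chain p) \<eta> \<in> \<B>"
      unfolding \<B>_def using p tp wp by (intro image_eqI[of _ _ "(p, n)"]) (auto simp: \<eta>_def)
    ultimately show ?thesis by blast
  qed
  show ?thesis unfolding second_countable_def using 1 2 3 by (intro exI[of _ \<B>]) blast
qed

definition lim :: "real pointed" where
  "lim = \<lparr>space_of = lim_space, basept = \<kappa> base,
     charts = compatible_charts lim_space lim_atlas\<rparr>"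

lemma lim_simps [simp]: "space_of lim = lim_space" "basept lim = \<kappa> base"
  by (simp_all add: lim_def)

lemma lim_charts: "lim_atlas \<subseteq> charts lim" "maximal_translation_atlas lim_space (charts lim)"
  using compatible_charts_maximal[OF lim_atlas] by (simp_all add: lim_def)

lemma lim_structure: "pointed_translation_structure lim"
proof -
  have "\<exists>W. openin lim_space W \<and> x \<in> W \<and> (\<exists>V::plane set. open V \<and> subtopology lim_space W homeomorphic_space top_of_set V)"
    if x: "x \<in> topspace lim_space" for x
  proof -
    obtain a where a: "reachable a" "x = \<kappa> a" by (rule topspace_limE[OF x])
    obtain r where r: "r > 0" "embedded a r" using reachable_embedded[OF a(1)] .
    have "subtopology lim_space (patch a r) homeomorphic_space top_of_set (ball 0 r :: plane set)"
      using pchart_homeomorphic(2)[OF a(1) r(2)] homeomorphic_map_imp_homeomorphic_space by blast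
    then show ?thesis
      using patch_open[OF a(1) embedded_immersed[OF r(2)]] label_in_patch[OF a(1) r(1)] a(2) by blast
  qed
  then show ?thesis
    unfolding pointed_translation_structure_def surface_def
    using lim_connected lim_Hausdorff lim_second_countable lim_charts(2) reachable_topspace[OF reachable.base] by simp
qed

text \<open>
  Immersed disks in almost all \<open>T i\<close> yield an immersed disk of the same radius in the limit, in which moves are moves of sections.
\<close>

lemma lim_tball:
  assumes a: "reachable a" "immersed a r"
  shows "tball lim (\<kappa> a) r (move a)"
  unfolding tball_def translation_on_def
proof (intro conjI ballI)
  show "r > 0" by (rule immersed_pos[OF a(2)])
  show "move a 0 = \<kappa> a" by (rule move_0[OF a(1)])
  fix v :: plane assume "v \<in> ball 0 r"
  then have v: "norm v < r" by simp
  have t: "reachable (mvs a v)" by (rule reachable_mvs[OF a v])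
  obtain q where q: "q > 0" "embedded (mvs a v) q" using reachable_embedded[OF t] .
  have ch: "(patch (mvs a v) q, pchart (mvs a v) q) \<in> charts lim"
    using lim_charts(1) t q by (auto simp: lim_atlas_def)
  show "translation_at plane_surface (ball 0 r) lim (move a) v"
  proof (rule translation_atI[OF _ ch, where U = UNIV and \<phi> = "\<lambda>x. x"])
    show "move a v \<in> patch (mvs a v) q" by (rule label_in_patch[OF t q(1)])
    show "openin (space_of lim) (patch (mvs a v) q)" using patch_open[OF t embedded_immersed[OF q(2)]] by simp
    fix O' assume O': "openin (space_of lim) O'" "move a v \<in> O'"
    then have o: "open {v \<in> ball 0 r. move a v \<in> O'}" using move_preimage_open[OF a] openin_lim by simp
    define W where "W = {v \<in> ball 0 r. move a v \<in> O'} \<inter> ball v (min q (r - norm v))"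
    have "pchart (mvs a v) q (move a s') - s' = pchart (mvs a v) q (move a v) - v" if "s' \<in> W" for s'
    proof -
      have n: "norm (s' - v) < q" "norm v + norm (s' - v) < r" using that by (auto simp: W_def dist_norm norm_minus_commute)
      have "move (mvs a v) (s' - v) = move a (v + (s' - v))" by (rule move_add[OF a n(2)])
      then have "pchart (mvs a v) q (move a s') = s' - v" using pchart_move[OF t q(2) n(1)] by simp
      moreover have "pchart (mvs a v) q (move a v) = 0"
        using pchart_move[OF t q(2), of 0] q(1) move_0[OF t] by simp
      ultimately show ?thesis by simp
    qed
    note charts = this
    have W: "open W" "v \<in> W" using o v O'(2) q(1) by (auto simp: W_def)
    have "move a ` (W \<inter> ball 0 r) \<subseteq> O'" by (auto simp: W_def)
    then show "\<exists>W. openin (space_of plane_surface) W \<and> v \<in> W \<and> move a ` (W \<inter> ball 0 r) \<subseteq> O' \<and>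
        (\<forall>s'\<in>W \<inter> ball 0 r. pchart (mvs a v) q (move a s') - s' = pchart (mvs a v) q (move a v) - v)"
    proof (intro exI[of _ W] conjI ballI)
      show "openin (space_of plane_surface) W" using W(1) by simp
      show "pchart (mvs a v) q (move a s') - s' = pchart (mvs a v) q (move a v) - v" if "s' \<in> W \<inter> ball 0 r" for s'
        by (rule charts) (use that in blast)
    qed (use W(2) in blast)
  qed auto
qed

lemma lim_tsurf: "tsurf lim"
  by (rule pts_tsurf[OF lim_structure])

lemma lim_mv:
  assumes a: "reachable a" "immersed a r"
  shows "has_ball lim (\<kappa> a) r" "norm v < r \<Longrightarrow> mv lim (\<kappa> a) v = move a v"
  using lim_tball[OF a] mv_eq[OF lim_tsurf] by (auto simp: has_ball_def)

end

lemma small_nbhd: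
  assumes R: "tsurf R" and A: "openin (space_of R) A" "x \<in> A"
  obtains r N where "has_ball R x r" "mv R x ` ball 0 r \<subseteq> A" "openin (space_of R) N" "x \<in> N" "N \<subseteq> A"
    "\<And>y. y \<in> N \<Longrightarrow> \<exists>v. 2 * norm v < r \<and> y = mv R x v" "inj_on (mv R x) (ball 0 r)"
proof -
  have "x \<in> whole R" using A openin_subset by blast
  then obtain U \<phi> where U: "(U,\<phi>) \<in> charts R" "x \<in> U" using chart_cover[OF R] by metis
  obtain r N where r: "has_ball R x r" "inj_on (mv R x) (ball 0 r)" "N = mv R x ` ball 0 r"
    "openin (space_of R) N" "x \<in> N" "N \<subseteq> U \<inter> A"
    "\<And>y. y \<in> N \<Longrightarrow> norm (\<phi> y - \<phi> x) < r \<and> y = mv R x (\<phi> y - \<phi> x)"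
    by (rule small_ball_exists[OF R U A]) (rule that)
  have "r / 2 > 0" using has_ball_pos[OF r(1)] by simp
  then obtain W where W: "openin (space_of R) W" "x \<in> W" "W \<subseteq> U" "\<And>y. y \<in> W \<Longrightarrow> norm (\<phi> y - \<phi> x) < r / 2"
    using chart_cont[OF R U] by metis
  show ?thesis
  proof (rule that[of r "N \<inter> W"])
    show "\<exists>v. 2 * norm v < r \<and> y = mv R x v" if y: "y \<in> N \<inter> W" for y
    proof (intro exI conjI)
      show "2 * norm (\<phi> y - \<phi> x) < r" using W(4)[of y] y by simp
      show "y = mv R x (\<phi> y - \<phi> x)" using r(7)[of y] y by blast
    qed
  qed (use r W in auto)
qed

context ultralimit
begin

subsection \<open>Limits of local translations\<close>

context
  fixes R :: "'c pointed" and A :: "'c set" and f :: "'i \<Rightarrow> 'c \<Rightarrow> 'b"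
  assumes R: "tsurf R" and A: "openin (space_of R) A" "connectedin (space_of R) A" "basept R \<in> A"
    and f: "eventually (\<lambda>i. translation_on R A (T i) (f i) \<and> f i (basept R) = basept (T i)) F"
begin

lemma limit_mv:
  assumes r: "has_ball R x r" "mv R x ` ball 0 r \<subseteq> A"
  shows "immersed (\<lambda>i. f i x) r"
    "norm v < r \<Longrightarrow> eventually (\<lambda>i. mvs (\<lambda>i. f i x) v i = f i (mv R x v)) F"
proof -
  show "immersed (\<lambda>i. f i x) r"
    unfolding immersed_def using f by eventually_elim (use translation_on_mv(1)[OF R ts _ r] in blast)
  show "eventually (\<lambda>i. mvs (\<lambda>i. f i x) v i = f i (mv R x v)) F" if "norm v < r"
    using f by eventually_elim (use translation_on_mv(2)[OF R ts _ r that] in metis)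
qed

text \<open>
  The points of \<open>A\<close> whose images form a reachable section are a clopen subset of \<open>A\<close>, because a disk in
  \<open>A\<close> about \<open>x\<close> is mapped to immersed disks of the same radius in almost all \<open>T i\<close>.
\<close>

lemma limit_reachable:
  assumes "x \<in> A" shows "reachable (\<lambda>i. f i x)"
proof -
  let ?t = "\<lambda>x. reachable (\<lambda>i. f i x)"
  have key: "\<exists>N. openin (space_of R) N \<and> x \<in> N \<and> N \<subseteq> A \<and> (\<forall>y\<in>N. ?t y \<longleftrightarrow> ?t x)" if x: "x \<in> A" for x
  proof -
    obtain r N where N: "has_ball R x r" "mv R x ` ball 0 r \<subseteq> A" "openin (space_of R) N" "x \<in> N" "N \<subseteq> A"
      "\<And>y. y \<in> N \<Longrightarrow> \<exists>v. 2 * norm v < r \<and> y = mv R x v"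
      using small_nbhd[OF R A(1) x] by metis
    note w = limit_mv(1)[OF N(1,2)]
    have "?t y \<longleftrightarrow> ?t x" if y: "y \<in> N" for y
    proof -
      obtain v where v: "2 * norm v < r" "y = mv R x v" using N(6)[OF y] by blast
      have vr: "norm v < r" using v norm_ge_zero[of v] by linarith
      have e: "eventually (\<lambda>i. mvs (\<lambda>i. f i x) v i = f i y) F" unfolding v(2) by (rule limit_mv(2)[OF N(1,2) vr])
      show ?thesis
      proof
        assume t: "?t x"
        show "?t y" by (rule reachable_near[OF reachable_mvs[OF t w vr] near_cong[OF reachable_mvs[OF t w vr] e]])
      next
        assume t: "?t y"
        have e': "eventually (\<lambda>i. mvs (\<lambda>i. f i y) (- v) i = f i x) F"
          using e w unfolding immersed_def
        proof eventually_elim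
          case (elim i)
          show ?case using mv_back[OF ts elim(2) v(1)] unfolding elim(1) .
        qed
        have "immersed (mvs (\<lambda>i. f i x) v) (r - norm v)" by (rule immersed_mvs[OF w vr])
        then have wy: "immersed (\<lambda>i. f i y) (r - norm v)"
          using e unfolding immersed_def by eventually_elim simp
        have t': "reachable (mvs (\<lambda>i. f i y) (- v))"
          by (rule reachable_mvs[OF t wy]) (use v in simp)
        show "?t x" by (rule reachable_near[OF t' near_cong[OF t' e']])
      qed
    qed
    then show ?thesis using N by blast
  qed
  have t0: "?t (basept R)"
  proof -
    have "eventually (\<lambda>i. base i = f i (basept R)) F"
      using f by eventually_elim (simp add: base_def)
    then show ?thesis by (rule reachable_near[OF reachable.base near_cong[OF reachable.base]])
  qed
  let ?E1 = "{x \<in> A. ?t x}" and ?E2 = "{x \<in> A. \<not> ?t x}"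
  have o: "openin (space_of R) {x \<in> A. ?t x = b}" for b
  proof (subst openin_subopen, intro ballI)
    fix x assume x: "x \<in> {x \<in> A. ?t x = b}"
    then obtain N where N: "openin (space_of R) N" "x \<in> N" "N \<subseteq> A" "\<forall>y\<in>N. ?t y \<longleftrightarrow> ?t x" using key by blast
    have "?t x = b" using x by simp
    then have "N \<subseteq> {x \<in> A. ?t x = b}" using N(3,4) by (intro subsetI CollectI conjI) (blast | simp)+
    then show "\<exists>Ta. openin (space_of R) Ta \<and> x \<in> Ta \<and> Ta \<subseteq> {x \<in> A. ?t x = b}" using N(1,2) by (intro exI conjI)
  qed
  have o1: "openin (space_of R) ?E1" and o2: "openin (space_of R) ?E2" using o[of True] o[of False] by simp_all
  show ?thesis
  proof (rule ccontr)
    assume "\<not> ?thesis"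
    then have "?E2 \<inter> A \<noteq> {}" using assms by blast
    moreover have "A \<subseteq> ?E1 \<union> ?E2" "?E1 \<inter> ?E2 \<inter> A = {}" "?E1 \<inter> A \<noteq> {}" using t0 A(3) by auto
    ultimately show False using connectedinD[OF A(2) o1 o2] by blast
  qed
qed

lemma limit_translation_on: "translation_on R A lim (\<lambda>x. \<kappa> (\<lambda>i. f i x))"
proof (rule translation_on_openI[OF R lim_tsurf A(1)])
  fix x assume x: "x \<in> A"
  obtain r N where N: "has_ball R x r" "mv R x ` ball 0 r \<subseteq> A"
    using small_nbhd[OF R A(1) x] by metis
  note w = limit_mv(1)[OF N] and t = limit_reachable[OF x]
  have "\<kappa> (\<lambda>i. f i (mv R x v)) = mv lim (\<kappa> (\<lambda>i. f i x)) v" if v: "norm v < r" for v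
    unfolding lim_mv(2)[OF t w v]
    by (rule label_cong[OF reachable_mvs[OF t w v] limit_mv(2)[OF N v], symmetric])
  then show "\<exists>r. has_ball R x r \<and> has_ball lim (\<kappa> (\<lambda>i. f i x)) r \<and>
       (\<forall>v. norm v < r \<longrightarrow> mv R x v \<in> A \<longrightarrow> \<kappa> (\<lambda>i. f i (mv R x v)) = mv lim (\<kappa> (\<lambda>i. f i x)) v)"
    using N lim_mv(1)[OF t w] by blast
qed

lemma limit_basept: "\<kappa> (\<lambda>i. f i (basept R)) = \<kappa> base"
  by (rule label_cong[OF limit_reachable[OF A(3)]]) (use f in \<open>eventually_elim, simp add: base_def\<close>)

text \<open>
  If \<open>x\<close> and \<open>y\<close> have the same limit, then \<open>f i y\<close> is a short move of \<open>f i x\<close>, hence the image of a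
  short move of \<open>x\<close>. By injectivity \<open>y\<close> is this short move, so it lies in a given neighbourhood of \<open>x\<close>.
\<close>

lemma limit_inj:
  assumes inj: "eventually (\<lambda>i. inj_on (f i) A) F"
  shows "inj_on (\<lambda>x. \<kappa> (\<lambda>i. f i x)) A"
proof (rule inj_onI, rule ccontr)
  fix x y assume xy: "x \<in> A" "y \<in> A" "\<kappa> (\<lambda>i. f i x) = \<kappa> (\<lambda>i. f i y)" "x \<noteq> y"
  have "x \<in> whole R" "y \<in> whole R" using xy A(1) openin_subset by blast+
  then obtain Ux Uy where U: "openin (space_of R) Ux" "openin (space_of R) Uy" "x \<in> Ux" "y \<in> Uy" "disjnt Ux Uy"
    using R xy(4) unfolding tsurf_def Hausdorff_space_def by metis
  have "openin (space_of R) (A \<inter> Ux)" "x \<in> A \<inter> Ux" using A U xy by auto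
  then obtain r where N: "has_ball R x r" "mv R x ` ball 0 r \<subseteq> A \<inter> Ux"
    using small_nbhd[OF R, of "A \<inter> Ux" x] by metis
  have N2: "mv R x ` ball 0 r \<subseteq> A" using N by blast
  have "near (\<lambda>i. f i x) (\<lambda>i. f i y)" using label limit_reachable xy by blast
  then have "eventually (\<lambda>i. \<exists>v. norm v < r \<and> f i y = mv (T i) (f i x) v) F"
    using has_ball_pos[OF N(1)] unfolding near_def by blast
  then have "eventually (\<lambda>i. False) F"
    using f inj
  proof eventually_elim
    case (elim i)
    then obtain v where v: "norm v < r" "f i y = mv (T i) (f i x) v" by blast
    have "f i (mv R x v) = mv (T i) (f i x) v"
      by (rule translation_on_mv(2)[OF R ts _ N(1) N2 v(1)]) (use elim in blast)
    then have "f i (mv R x v) = f i y" using v by simp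
    moreover have m: "mv R x v \<in> A \<inter> Ux" using N(2) v(1) by auto
    ultimately have "mv R x v = y" using elim(3) xy(2) by (auto dest: inj_onD)
    then show False using m U by (auto simp: disjnt_iff)
  qed
  then show False using ultrafilter_not_False[OF ultra] by blast
qed

end

subsection \<open>Lifting local translations from the limit\<close>

context
  fixes R :: "'c pointed" and D :: "'c set" and f :: "'c \<Rightarrow> real"
  assumes R: "tsurf R" and f: "translation_on R D lim f"
begin

text \<open>
  The value of the lift at one point \<open>x\<close> is prescribed exactly and not only up to identification; this
  lets a lift over one piece be continued over the next. Convergence along arguments \<open>u i\<close> that
  vary with \<open>i\<close> expresses that the lifts converge uniformly.
\<close>

definition lifts :: "'c set \<Rightarrow> bool" where
  "lifts Q \<longleftrightarrow> (\<forall>x\<in>Q. \<forall>a. reachable a \<and> \<kappa> a = f x \<longrightarrow>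
     (\<exists>g. eventually (\<lambda>i. translation_on R Q (T i) (g i) \<and> g i x = a i) F \<and>
        (\<forall>u y. y \<in> Q \<and> limitin (space_of R) u y F \<and> eventually (\<lambda>i. u i \<in> Q) F \<longrightarrow>
           reachable (\<lambda>i. g i (u i)) \<and> \<kappa> (\<lambda>i. g i (u i)) = f y)))"

lemma lifts_local:
  assumes x0: "x0 \<in> D"
  obtains W where "openin (space_of R) W" "x0 \<in> W" "\<And>Q. Q \<subseteq> W \<inter> D \<Longrightarrow> lifts Q"
proof -
  have fx0: "translation_at R D lim f x0" using f x0 translation_on_def by metis
  obtain b where b: "reachable b" "f x0 = \<kappa> b"
    using translation_at_topspace(2)[OF R lim_tsurf fx0] unfolding lim_simps by (rule topspace_limE)
  obtain U \<phi> where U: "(U,\<phi>) \<in> charts R" "x0 \<in> U"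
    using chart_cover[OF R] translation_at_topspace(1)[OF R lim_tsurf fx0] by metis
  obtain r where r: "r > 0" "immersed b r" using reachable_immersed[OF b(1)] .
  have hb: "has_ball lim (f x0) (r/4)"
    unfolding b(2) by (rule has_ball_mono[OF lim_mv(1)[OF b(1) r(2)]]) (use r in auto)
  obtain W where W: "openin (space_of R) W" "x0 \<in> W" "W \<subseteq> U"
    "\<And>s'. s' \<in> W \<inter> D \<Longrightarrow> norm (\<phi> s' - \<phi> x0) < r/4 \<and> f s' = mv lim (f x0) (\<phi> s' - \<phi> x0)"
    by (rule translation_atD_mv[OF R lim_tsurf fx0 U hb]) (rule that)
  have WD: "norm (\<phi> s' - \<phi> x0) < r/4" "f s' = move b (\<phi> s' - \<phi> x0)" if "s' \<in> W \<inter> D" for s'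
  proof -
    show 1: "norm (\<phi> s' - \<phi> x0) < r/4" using W(4)[OF that] by blast
    show "f s' = move b (\<phi> s' - \<phi> x0)"
      using W(4)[OF that] lim_mv(2)[OF b(1) r(2), of "\<phi> s' - \<phi> x0"] 1 r(1) b(2) by simp
  qed
  have "lifts Q" if Q: "Q \<subseteq> W \<inter> D" for Q
    unfolding lifts_def
  proof (intro ballI allI impI, elim conjE)
    fix x a assume x: "x \<in> Q" and a: "reachable a" "\<kappa> a = f x"
    define d where "d = \<phi> x - \<phi> x0"
    have xWD: "x \<in> W \<inter> D" using x Q by blast
    have d: "norm d < r/4" "\<kappa> a = move b d" using WD[OF xWD] a(2) by (auto simp: d_def)
    have dr: "norm d < r" using d r by simp
    have td: "reachable (mvs b d)" by (rule reachable_mvs[OF b(1) r(2) dr])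
    have n: "near (mvs b d) a" using label[OF td a(1)] d(2) by simp
    have wa: "immersed a (r/2)"
      by (rule near_immersed[OF immersed_mvs[OF r(2) dr] n]) (use r d in auto)
    define g where "g = (\<lambda>i y. mv (T i) (a i) (\<phi> y - \<phi> x))"
    have dy: "norm (\<phi> y - \<phi> x) < r/2" if y: "y \<in> Q" for y
    proof -
      have "norm (\<phi> y - \<phi> x0) < r/4" "norm d < r/4" using WD(1)[of y] y Q d by auto
      then have "norm ((\<phi> y - \<phi> x0) - d) < r/2" using norm_triangle_ineq4[of "\<phi> y - \<phi> x0" d] by simp
      then show ?thesis by (simp add: d_def)
    qed
    have QU: "Q \<subseteq> U" using Q W(3) by blast
    have 1: "eventually (\<lambda>i. translation_on R Q (T i) (g i) \<and> g i x = a i) F"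
      using wa unfolding immersed_def
    proof eventually_elim
      case (elim i)
      have im: "(\<lambda>y. \<phi> y - \<phi> x) ` Q \<subseteq> ball 0 (r/2)" using dy by auto
      have "translation_on R Q (T i) (g i)"
        unfolding g_def
        by (rule translation_on_comp[OF R tsurf_plane ts translation_on_mono[OF translation_on_chart[OF R U(1)] QU] mv_translation[OF ts elim] im])
      moreover have "g i x = a i" using mv_0[OF ts elim] by (simp add: g_def)
      ultimately show ?case by blast
    qed
    have 2: "reachable (\<lambda>i. g i (u i)) \<and> \<kappa> (\<lambda>i. g i (u i)) = f y"
      if y: "y \<in> Q" and u: "limitin (space_of R) u y F" for u y
    proof -
      have yU: "y \<in> U" using y QU by blast
      have "((\<lambda>i. \<phi> (u i)) \<longlongrightarrow> \<phi> y) F"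
      proof (rule tendstoI)
        fix e :: real assume "e > 0"
        then obtain V where V: "openin (space_of R) V" "y \<in> V" "\<And>z. z \<in> V \<Longrightarrow> norm (\<phi> z - \<phi> y) < e"
          using chart_cont[OF R U(1) yU] by metis
        have "eventually (\<lambda>i. u i \<in> V) F" using limitinD[OF u V(1,2)] .
        then show "eventually (\<lambda>i. dist (\<phi> (u i)) (\<phi> y) < e) F"
          by eventually_elim (use V(3) in \<open>simp add: dist_norm\<close>)
      qed
      then have lim: "((\<lambda>i. \<phi> (u i) - \<phi> x) \<longlongrightarrow> \<phi> y - \<phi> x) F" by (intro tendsto_intros)
      have n: "near (mvs a (\<phi> y - \<phi> x)) (\<lambda>i. g i (u i))"
        by (rule near_tendsto[OF wa dy[OF y] lim]) (simp add: g_def)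
      have t: "reachable (mvs a (\<phi> y - \<phi> x))" by (rule reachable_mvs[OF a(1) wa dy[OF y]])
      have t': "reachable (\<lambda>i. g i (u i))" by (rule reachable_near[OF t n])
      have "\<kappa> (\<lambda>i. g i (u i)) = move a (\<phi> y - \<phi> x)" using label[OF t t'] n by simp
      also have "\<dots> = move b (d + (\<phi> y - \<phi> x))"
        by (rule move_shift[OF b(1) r(2) dr a(1) d(2)]) (use dy[OF y] d(1) r(1) in linarith)
      also have "d + (\<phi> y - \<phi> x) = \<phi> y - \<phi> x0" by (simp add: d_def)
      also have "move b (\<phi> y - \<phi> x0) = f y"
      proof -
        have "y \<in> W \<inter> D" using y Q by blast
        from WD(2)[OF this] show ?thesis by (rule sym)
      qed
      finally show ?thesis using t' by simp
    qed
    show "\<exists>g. eventually (\<lambda>i. translation_on R Q (T i) (g i) \<and> g i x = a i) F \<and>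
        (\<forall>u y. y \<in> Q \<and> limitin (space_of R) u y F \<and> eventually (\<lambda>i. u i \<in> Q) F \<longrightarrow>
           reachable (\<lambda>i. g i (u i)) \<and> \<kappa> (\<lambda>i. g i (u i)) = f y)"
      using 1 2 by (intro exI[of _ g] conjI allI impI) blast+
  qed
  then show ?thesis using that W by blast
qed

text \<open>
  Choose the lift over \<open>Q2\<close> so that at one point of the intersection it has the value of the lift over
  \<open>Q1\<close>. By unique continuation the two agree on the whole intersection.
\<close>

lemma lifts_Un:
  assumes l: "lifts Q1" "lifts Q2" and cl: "closedin (space_of R) Q1" "closedin (space_of R) Q2"
    and conn: "connectedin (space_of R) (Q1 \<inter> Q2)" and ne: "Q1 \<inter> Q2 \<noteq> {}"
  shows "lifts (Q1 \<union> Q2)"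
proof -
  have key: "\<exists>g. eventually (\<lambda>i. translation_on R (Q1 \<union> Q2) (T i) (g i) \<and> g i x = a i) F \<and>
        (\<forall>u y. y \<in> Q1 \<union> Q2 \<and> limitin (space_of R) u y F \<and> eventually (\<lambda>i. u i \<in> Q1 \<union> Q2) F \<longrightarrow>
           reachable (\<lambda>i. g i (u i)) \<and> \<kappa> (\<lambda>i. g i (u i)) = f y)"
    if x: "x \<in> Q1" and a: "reachable a" "\<kappa> a = f x"
    and l: "lifts Q1" "lifts Q2" and cl: "closedin (space_of R) Q1" "closedin (space_of R) Q2"
    and conn: "connectedin (space_of R) (Q1 \<inter> Q2)" and ne: "Q1 \<inter> Q2 \<noteq> {}" for Q1 Q2 x a
  proof -
    obtain g1 where g1: "eventually (\<lambda>i. translation_on R Q1 (T i) (g1 i) \<and> g1 i x = a i) F"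
      "\<And>u y. y \<in> Q1 \<Longrightarrow> limitin (space_of R) u y F \<Longrightarrow> eventually (\<lambda>i. u i \<in> Q1) F \<Longrightarrow>
           reachable (\<lambda>i. g1 i (u i)) \<and> \<kappa> (\<lambda>i. g1 i (u i)) = f y"
      using l(1)[unfolded lifts_def, rule_format, OF x conjI[OF a]] by blast
    obtain z where z: "z \<in> Q1" "z \<in> Q2" using ne by blast
    have zR: "z \<in> whole R" using z cl closedin_subset by blast
    have z1: "reachable (\<lambda>i. g1 i z)" "\<kappa> (\<lambda>i. g1 i z) = f z"
      using g1(2)[OF z(1), of "\<lambda>i. z"] z zR by auto
    obtain g2 where g2: "eventually (\<lambda>i. translation_on R Q2 (T i) (g2 i) \<and> g2 i z = g1 i z) F"
      "\<And>u y. y \<in> Q2 \<Longrightarrow> limitin (space_of R) u y F \<Longrightarrow> eventually (\<lambda>i. u i \<in> Q2) F \<Longrightarrow>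
           reachable (\<lambda>i. g2 i (u i)) \<and> \<kappa> (\<lambda>i. g2 i (u i)) = f y"
      using l(2)[unfolded lifts_def, rule_format, OF z(2) conjI[OF z1]] by blast
    define g where "g = (\<lambda>i y. if y \<in> Q1 then g1 i y else g2 i y)"
    have agree: "eventually (\<lambda>i. \<forall>y \<in> Q1 \<inter> Q2. g1 i y = g2 i y) F"
      using g1(1) g2(1)
    proof eventually_elim
      case (elim i)
      show ?case
      proof
        fix y assume y: "y \<in> Q1 \<inter> Q2"
        show "g1 i y = g2 i y"
          by (rule translation_on_unique[OF R ts, of "Q1 \<inter> Q2" i "g1 i" "g2 i" z])
            (use elim conn z y in \<open>auto elim: translation_on_mono\<close>)
      qed
    qed
    have 1: "eventually (\<lambda>i. translation_on R (Q1 \<union> Q2) (T i) (g i) \<and> g i x = a i) F"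
      using g1(1) g2(1) agree
    proof eventually_elim
      case (elim i)
      have "translation_on R (Q1 \<union> Q2) (T i) (g i)"
        unfolding g_def by (rule translation_on_glue[OF R ts _ _ cl]) (use elim in auto)
      then show ?case using elim x by (simp add: g_def)
    qed
    have 2: "reachable (\<lambda>i. g i (u i)) \<and> \<kappa> (\<lambda>i. g i (u i)) = f y"
      if u: "limitin (space_of R) u y F" "eventually (\<lambda>i. u i \<in> Q1 \<union> Q2) F" for u y
    proof -
      have nb: "F \<noteq> bot" using ultra by (simp add: ultrafilter_def)
      have fin: ?thesis if "reachable (\<lambda>i. h i (u i)) \<and> \<kappa> (\<lambda>i. h i (u i)) = f y" "eventually (\<lambda>i. h i (u i) = g i (u i)) F" for h
        using that reachable_near[OF _ near_cong] label_cong by metis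
      show ?thesis
      proof (cases "eventually (\<lambda>i. u i \<in> Q1) F")
        case True
        have "y \<in> Q1" by (rule limitin_closedin[OF u(1) cl(1) True nb])
        from g1(2)[OF this u(1) True] show ?thesis
          by (rule fin) (use True in \<open>eventually_elim, simp add: g_def\<close>)
      next
        case False
        then have "eventually (\<lambda>i. u i \<notin> Q1) F" by (rule ultrafilter_not_eventually[OF ultra])
        with u(2) have T2: "eventually (\<lambda>i. u i \<in> Q2) F" by eventually_elim blast
        have "y \<in> Q2" by (rule limitin_closedin[OF u(1) cl(2) T2 nb])
        from g2(2)[OF this u(1) T2] show ?thesis
          by (rule fin) (use T2 agree in \<open>eventually_elim, auto simp: g_def\<close>)
      qed
    qed
    show ?thesis using 1 2 by (intro exI[of _ g]) blast
  qed
  show ?thesis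
    unfolding lifts_def
  proof (intro ballI allI impI, elim conjE)
    fix x a assume x: "x \<in> Q1 \<union> Q2" and a: "reachable a" "\<kappa> a = f x"
    show "\<exists>g. eventually (\<lambda>i. translation_on R (Q1 \<union> Q2) (T i) (g i) \<and> g i x = a i) F \<and>
        (\<forall>u y. y \<in> Q1 \<union> Q2 \<and> limitin (space_of R) u y F \<and> eventually (\<lambda>i. u i \<in> Q1 \<union> Q2) F \<longrightarrow>
           reachable (\<lambda>i. g i (u i)) \<and> \<kappa> (\<lambda>i. g i (u i)) = f y)"
    proof (cases "x \<in> Q1")
      case True
      show ?thesis by (rule key[OF True a l cl conn ne])
    next
      case False
      then have "x \<in> Q2" using x by blast
      from key[OF this a l(2,1) cl(2,1)] conn ne show ?thesis
        by (simp only: Un_commute[of Q2 Q1] Int_commute[of Q2 Q1] simp_thms)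
    qed
  qed
qed

text \<open>
  Rectangles in one direction are joined to thin strips, and strips to the square. Thinness of a strip
  may depend on its position, which is what the local case of \<open>Bolzano\<close> allows.
\<close>

lemma lifts_square:
  assumes H: "homeomorphic_map (top_of_set ({0..1} \<times> {0..1} :: (real \<times> real) set)) (subtopology (space_of R) D) H"
    and DR: "D \<subseteq> whole R"
  shows "lifts D"
proof -
  define Q where "Q = (\<lambda>s1 s2 t1 t2. H ` ({s1..s2::real} \<times> {t1..t2::real}))"
  have cont: "continuous_map (top_of_set ({0..1} \<times> {0..1})) (space_of R) H"
    using homeomorphic_imp_continuous_map[OF H] continuous_map_in_subtopology by blast
  have inj: "inj_on H ({0..1} \<times> {0..1})" using homeomorphic_imp_injective_map[OF H] by simp
  have surj: "H ` ({0..1} \<times> {0..1}) = D" using homeomorphic_imp_surjective_map[OF H] DR by auto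
  have sub: "{s1..s2} \<times> {t1..t2} \<subseteq> {0..1} \<times> {0..1}" if "0 \<le> s1" "s2 \<le> 1" "0 \<le> t1" "t2 \<le> 1" for s1 s2 t1 t2 :: real
    using that by auto
  have cl: "closedin (space_of R) (H ` S)" if S: "compact S" "S \<subseteq> {0..1} \<times> {0..1}" for S
  proof (rule compactin_imp_closedin)
    show "Hausdorff_space (space_of R)" using R by (simp add: tsurf_def)
    show "compactin (space_of R) (H ` S)"
      by (rule image_compactin[OF _ cont]) (use S in \<open>simp add: compactin_subtopology\<close>)
  qed
  have cn: "connectedin (space_of R) (H ` S)" if S: "connected S" "S \<subseteq> {0..1} \<times> {0..1}" for S
    by (rule connectedin_continuous_map_image[OF cont]) (use S in \<open>simp add: connectedin_subtopology\<close>)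
  have step: "lifts (H ` (S1 \<union> S2))" if S: "lifts (H ` S1)" "lifts (H ` S2)" "compact S1" "compact S2"
    "S1 \<subseteq> {0..1} \<times> {0..1}" "S2 \<subseteq> {0..1} \<times> {0..1}" "convex (S1 \<inter> S2)" "S1 \<inter> S2 \<noteq> {}" for S1 S2
  proof -
    have i: "H ` S1 \<inter> H ` S2 = H ` (S1 \<inter> S2)" using inj_on_image_Int[OF inj S(5,6)] by simp
    have "connectedin (space_of R) (H ` (S1 \<inter> S2))"
      by (rule cn[OF convex_connected[OF S(7)]]) (use S in blast)
    then show ?thesis
      unfolding image_Un by (intro lifts_Un[OF S(1,2) cl[OF S(3,5)] cl[OF S(4,6)]]) (use i S(8) in auto)
  qed
  have strip: "\<exists>d>0. \<forall>s1 s2. 0 \<le> s1 \<and> s1 \<le> s \<and> s \<le> s2 \<and> s2 \<le> 1 \<and> s2 - s1 < d \<longrightarrow> lifts (Q s1 s2 0 1)"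
    if s: "0 \<le> s" "s \<le> 1" for s
  proof -
    define P where "P = (\<lambda>t1 t2. 0 \<le> t1 \<and> t2 \<le> 1 \<longrightarrow> (\<exists>d>0. \<forall>s1 s2. 0 \<le> s1 \<and> s1 \<le> s \<and> s \<le> s2 \<and> s2 \<le> 1 \<and> s2 - s1 < d \<longrightarrow> lifts (Q s1 s2 t1 t2)))"
    have "(0::real) \<le> 1" by simp
    then have "P 0 1"
    proof (induction rule: Bolzano)
      case (trans a b c)
      show ?case
        unfolding P_def
      proof (intro impI, elim conjE)
        assume ac: "0 \<le> a" "c \<le> 1"
        have "0 \<le> b" "b \<le> 1" using ac trans(3,4) by linarith+
        obtain d1 where d1: "d1 > 0" "\<forall>s1 s2. 0 \<le> s1 \<and> s1 \<le> s \<and> s \<le> s2 \<and> s2 \<le> 1 \<and> s2 - s1 < d1 \<longrightarrow> lifts (Q s1 s2 a b)"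
          using trans(1) ac(1) \<open>b \<le> 1\<close> unfolding P_def by (elim impE exE) auto
        obtain d2 where d2: "d2 > 0" "\<forall>s1 s2. 0 \<le> s1 \<and> s1 \<le> s \<and> s \<le> s2 \<and> s2 \<le> 1 \<and> s2 - s1 < d2 \<longrightarrow> lifts (Q s1 s2 b c)"
          using trans(2) ac(2) \<open>0 \<le> b\<close> unfolding P_def by (elim impE exE) auto
        have "lifts (Q s1 s2 a c)" if "0 \<le> s1 \<and> s1 \<le> s \<and> s \<le> s2 \<and> s2 \<le> 1 \<and> s2 - s1 < min d1 d2" for s1 s2
        proof -
          have u: "{s1..s2} \<times> {a..c} = {s1..s2} \<times> {a..b} \<union> {s1..s2} \<times> {b..c}" using trans(3,4) by auto
          have i: "{s1..s2} \<times> {a..b} \<inter> {s1..s2} \<times> {b..c} = {s1..s2} \<times> {b}" using trans(3,4) by auto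
          have "lifts (H ` ({s1..s2} \<times> {a..b} \<union> {s1..s2} \<times> {b..c}))"
          proof (rule step)
            show "lifts (H ` ({s1..s2} \<times> {a..b}))" using d1(2)[rule_format, of s1 s2] that by (simp add: Q_def)
            show "lifts (H ` ({s1..s2} \<times> {b..c}))" using d2(2)[rule_format, of s1 s2] that by (simp add: Q_def)
          qed (use that ac trans(3,4) i in \<open>auto intro!: compact_Times convex_Times\<close>)
          then show ?thesis unfolding Q_def u .
        qed
        then show "\<exists>d>0. \<forall>s1 s2. 0 \<le> s1 \<and> s1 \<le> s \<and> s \<le> s2 \<and> s2 \<le> 1 \<and> s2 - s1 < d \<longrightarrow> lifts (Q s1 s2 a c)"
          using d1(1) d2(1) by (intro exI[of _ "min d1 d2"]) simp
      qed
    next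
      case (local t)
      then have st: "(s, t) \<in> {0..1} \<times> {0..1}" using s by auto
      then have "H (s, t) \<in> D" using surj by blast
      then obtain W where W: "openin (space_of R) W" "H (s, t) \<in> W" "\<And>Q. Q \<subseteq> W \<inter> D \<Longrightarrow> lifts Q"
        using lifts_local by blast
      have "openin (top_of_set ({0..1} \<times> {0..1})) {p \<in> {0..1} \<times> {0..1}. H p \<in> W}"
        using cont W(1) unfolding continuous_map_def by auto
      then obtain V where V: "open V" "{p \<in> {0..1} \<times> {0..1}. H p \<in> W} = ({0..1} \<times> {0..1}) \<inter> V"
        by (auto simp: openin_open)
      then have "(s, t) \<in> V" using st W(2) by blast
      then obtain e where e: "e > 0" "ball (s, t) e \<subseteq> V" using V(1) openE by blast
      have "lifts (Q s1 s2 t1 t2)" if st1: "0 \<le> s1 \<and> s1 \<le> s \<and> s \<le> s2 \<and> s2 \<le> 1 \<and> s2 - s1 < e/2"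
        "0 \<le> t1 \<and> t1 \<le> t \<and> t \<le> t2 \<and> t2 \<le> 1 \<and> t2 - t1 < e/2" for s1 s2 t1 t2
      proof (rule W(3))
        have "H p \<in> W \<inter> D" if p: "p \<in> {s1..s2} \<times> {t1..t2}" for p
        proof -
          obtain p1 p2 where pp: "p = (p1, p2)" by (cases p)
          have 1: "dist s p1 < e/2" "dist t p2 < e/2" using p st1 by (auto simp: pp dist_real_def abs_if)
          have "dist (s, t) p \<le> dist s p1 + dist t p2"
            unfolding pp dist_Pair_Pair by (rule sqrt_sum_squares_le_sum) auto
          then have "p \<in> ball (s, t) e" using 1 by simp
          then have "p \<in> V" using e by blast
          moreover have p01: "p \<in> {0..1} \<times> {0..1}" using p st1 by auto
          ultimately have "H p \<in> W" using V(2) by blast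
          then show ?thesis using surj p01 by blast
        qed
        then show "Q s1 s2 t1 t2 \<subseteq> W \<inter> D" unfolding Q_def by (rule image_subsetI)
      qed
      then show ?case unfolding P_def using e(1)
        by (intro exI[of _ "e/2"] conjI allI impI) auto
    qed
    then show ?thesis unfolding P_def by simp
  qed
  define P where "P = (\<lambda>s1 s2. 0 \<le> s1 \<and> s2 \<le> 1 \<longrightarrow> lifts (Q s1 s2 0 1))"
  have "(0::real) \<le> 1" by simp
  then have "P 0 1"
  proof (induction rule: Bolzano)
    case (trans a b c)
    show ?case
      unfolding P_def
    proof (intro impI, elim conjE)
      assume ac: "0 \<le> a" "c \<le> 1"
      have b: "0 \<le> b" "b \<le> 1" using ac trans(3,4) by linarith+
      have u: "{a..c} \<times> {0..1} = {a..b} \<times> {0..1} \<union> {b..c} \<times> {0..1::real}" using trans(3,4) by auto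
      have i: "{a..b} \<times> {0..1} \<inter> {b..c} \<times> {0..1} = {b} \<times> {0..1::real}" using trans(3,4) by auto
      have "lifts (H ` ({a..b} \<times> {0..1} \<union> {b..c} \<times> {0..1}))"
      proof (rule step)
        show "lifts (H ` ({a..b} \<times> {0..1}))" "lifts (H ` ({b..c} \<times> {0..1}))"
          using trans(1,2) ac b by (simp_all add: P_def Q_def)
        show "{a..b} \<times> {0..1} \<subseteq> {0..1} \<times> {0..1::real}" "{b..c} \<times> {0..1} \<subseteq> {0..1} \<times> {0..1::real}"
          by (rule sub; use ac b in simp)+
      qed (simp_all add: i compact_Times convex_Times)
      then show "lifts (Q a c 0 1)" unfolding Q_def u .
    qed
  next
    case (local s)
    from strip[OF this] show ?case unfolding P_def by meson
  qed
  then show ?thesis unfolding P_def Q_def surj by simp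
qed

end

end

lemma closed_disk_square:
  assumes "closed_disk R D"
  obtains H where "homeomorphic_map (top_of_set ({0..1} \<times> {0..1} :: (real \<times> real) set)) (subtopology (space_of R) D) H"
proof -
  have "({0..1} \<times> {0..1} :: (real \<times> real) set) = cbox (0,0) (1,1)" by (simp add: cbox_Pair_eq)
  moreover have "aff_dim (cbox (0,0) (1,1) :: (real \<times> real) set) = 2"
  proof -
    have "box (0,0) (1,1) \<noteq> ({} :: (real \<times> real) set)" by (simp add: box_ne_empty Basis_prod_def)
    then have "interior (cbox (0,0) (1,1)) \<noteq> ({} :: (real \<times> real) set)" by (simp add: interior_cbox)
    from aff_dim_nonempty_interior[OF this] show ?thesis by simp
  qed
  moreover have "aff_dim (cball (0::plane) 1) = 2"
    using aff_dim_cball[of 1 "0::plane"] by simp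
  ultimately have "({0..1} \<times> {0..1} :: (real \<times> real) set) homeomorphic cball (0::plane) 1"
    by (simp only:) (rule homeomorphic_convex_compact_sets; simp)
  then obtain h k where "homeomorphism ({0..1} \<times> {0..1} :: (real \<times> real) set) (cball (0::plane) 1) h k"
    unfolding homeomorphic_def by blast
  then have "homeomorphic_maps (top_of_set ({0..1} \<times> {0..1})) (top_of_set (cball 0 1)) h k"
    unfolding homeomorphism_def homeomorphic_maps_def
    by (simp add: continuous_map_in_subtopology image_subset_iff_funcset[symmetric])
  then have "top_of_set ({0..1} \<times> {0..1} :: (real \<times> real) set) homeomorphic_space top_of_set (cball (0::plane) 1)"
    unfolding homeomorphic_space_def by blast
  moreover have "top_of_set (cball (0::plane) 1) homeomorphic_space subtopology (space_of R) D"
    using assms homeomorphic_space_sym unfolding closed_disk_def by blast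
  ultimately have "top_of_set ({0..1} \<times> {0..1} :: (real \<times> real) set) homeomorphic_space subtopology (space_of R) D"
    by (rule homeomorphic_space_trans)
  then show ?thesis using that homeomorphic_space by metis
qed

section \<open>Immersions\<close>

text \<open>
  A restricted chart can be added to the atlas, which is maximal. Immersions need such restrictions, as
  the image of the domain of the chart has to fit into one chart of the target.
\<close>

lemma chart_restrict:
  assumes S: "pointed_translation_structure S" and U: "(U,\<phi>) \<in> charts S" and W: "openin (space_of S) W" "W \<subseteq> U"
  shows "(W, restrict \<phi> W) \<in> charts S"
proof -
  have max: "maximal_translation_atlas (space_of S) (charts S)"
    using S unfolding pointed_translation_structure_def by blast
  then have atl: "translation_atlas (space_of S) (charts S)" unfolding maximal_translation_atlas_def by blast
  have tS: "tsurf S" by (rule pts_tsurf[OF S])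
  let ?c = "(W, restrict \<phi> W)"
  have lh: "local_homeomorphism_on (space_of S) W (restrict \<phi> W)"
    unfolding local_homeomorphism_on_def
  proof
    fix x assume x: "x \<in> W"
    obtain W0 where W0: "openin (space_of S) W0" "x \<in> W0" "W0 \<subseteq> U" "open (\<phi> ` W0)"
      and h: "homeomorphic_map (subtopology (space_of S) W0) (top_of_set (\<phi> ` W0)) \<phi>"
      by (rule chart_homeo[OF tS U, of x]) (use x W(2) that in \<open>blast+\<close>)
    have W0S: "W0 \<subseteq> whole S" using W0(1) openin_subset by blast
    let ?V = "W0 \<inter> W"
    have im: "restrict \<phi> W ` ?V = \<phi> ` ?V" by auto
    have "openin (subtopology (space_of S) W0) ?V"
      using W(1) by (metis inf_commute openin_subtopology_Int)
    then have "openin (top_of_set (\<phi> ` W0)) (\<phi> ` ?V)"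
      using h homeomorphic_imp_open_map open_map_def by blast
    then have o: "open (\<phi> ` ?V)" using W0(4) openin_open_trans by blast
    have "homeomorphic_map (subtopology (subtopology (space_of S) W0) ?V) (subtopology (top_of_set (\<phi> ` W0)) (\<phi> ` ?V)) \<phi>"
      by (rule homeomorphic_map_subtopologies[OF h]) (use W0S in auto)
    moreover have "subtopology (subtopology (space_of S) W0) ?V = subtopology (space_of S) ?V"
      by (simp add: subtopology_subtopology)
    moreover have "subtopology (top_of_set (\<phi> ` W0)) (\<phi> ` ?V) = top_of_set (\<phi> ` ?V)"
      by (simp add: subtopology_subtopology Int_absorb1 image_mono)
    ultimately have "homeomorphic_map (subtopology (space_of S) ?V) (top_of_set (\<phi> ` ?V)) \<phi>" by simp
    then have "homeomorphic_map (subtopology (space_of S) ?V) (top_of_set (\<phi> ` ?V)) (restrict \<phi> W)"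
      by (rule homeomorphic_map_eq) auto
    then show "\<exists>Wa. openin (space_of S) Wa \<and> x \<in> Wa \<and> Wa \<subseteq> W \<and> open (restrict \<phi> W ` Wa) \<and>
       homeomorphic_map (subtopology (space_of S) Wa) (top_of_set (restrict \<phi> W ` Wa)) (restrict \<phi> W)"
      using W0 W x o unfolding im[symmetric] by (intro exI[of _ ?V]) auto
  qed
  have comp: "\<exists>W' v. openin (space_of S) W' \<and> x \<in> W' \<and> W' \<subseteq> W \<inter> V \<and> (\<forall>y\<in>W'. \<phi> y - \<psi> y = v)"
    if V: "(V, \<psi>) \<in> charts S" "x \<in> W" "x \<in> V" for V \<psi> x
  proof -
    obtain W' where W': "openin (space_of S) W'" "x \<in> W'" "W' \<subseteq> U \<inter> V" "\<And>y. y \<in> W' \<Longrightarrow> \<phi> y - \<psi> y = \<phi> x - \<psi> x"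
      using chart_compat[OF tS U V(1) _ V(3)] V(2) W(2) by blast
    show ?thesis
    proof (intro exI conjI ballI)
      show "openin (space_of S) (W' \<inter> W)" using W'(1) W(1) by blast
      show "x \<in> W' \<inter> W" "W' \<inter> W \<subseteq> W \<inter> V" using W'(2,3) V(2) by blast+
      show "\<phi> y - \<psi> y = \<phi> x - \<psi> x" if "y \<in> W' \<inter> W" for y
        by (rule W'(4)) (use that in blast)
    qed
  qed
  have c1: "translation_compatible (space_of S) ?c d" if d0: "d \<in> charts S" for d
  proof -
    obtain V \<psi> where d: "d = (V, \<psi>)" by (cases d)
    show ?thesis
      unfolding d translation_compatible_def prod.case
    proof
      fix x assume "x \<in> W \<inter> V"
      then obtain W' v where W': "openin (space_of S) W'" "x \<in> W'" "W' \<subseteq> W \<inter> V" "\<forall>y\<in>W'. \<phi> y - \<psi> y = v"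
        using comp[of V \<psi> x] d0 unfolding d by blast
      show "\<exists>Wa v. openin (space_of S) Wa \<and> x \<in> Wa \<and> Wa \<subseteq> W \<inter> V \<and> (\<forall>y\<in>Wa. restrict \<phi> W y - \<psi> y = v)"
      proof (intro exI conjI ballI)
        show "restrict \<phi> W y - \<psi> y = v" if "y \<in> W'" for y
        proof -
          have "y \<in> W" using that W'(3) by blast
          then show ?thesis using W'(4) that by simp
        qed
      qed (rule W')+
    qed
  qed
  have c: "?c \<in> compatible_charts (space_of S) (charts S)"
    unfolding compatible_charts_def using W(1) lh c1 by simp
  have "compatible_charts (space_of S) (charts S) = charts S"
    using max compatible_charts_maximal[OF atl] unfolding maximal_translation_atlas_def by blast
  with c show ?thesis by simp
qed

lemma immersion_iff:
  assumes S: "pointed_translation_structure S" and T: "pointed_translation_structure T"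
  shows "immersion S A T B \<iota> \<longleftrightarrow>
    A \<in> PC S \<and> B \<subseteq> whole T \<and> \<iota> ` A \<subseteq> B \<and> \<iota> (basept S) = basept T \<and> translation_on S A T \<iota>"
    (is "?L \<longleftrightarrow> ?R")
proof
  note tS = pts_tsurf[OF S] and tT = pts_tsurf[OF T]
  assume L: ?L
  have A: "A \<in> PC S" and B: "B \<subseteq> whole T" and
    cont: "continuous_map (subtopology (space_of S) A) (subtopology (space_of T) B) \<iota>" and
    bas: "\<iota> (basept S) = basept T" and
    ch: "\<And>s. s \<in> A \<Longrightarrow> \<exists>(U,\<phi>)\<in>charts S. \<exists>(V,\<psi>)\<in>charts T. \<exists>v.
        s \<in> U \<and> \<iota> ` (U \<inter> A) \<subseteq> V \<and> (\<forall>s'\<in>U \<inter> A. \<psi> (\<iota> s') = v + \<phi> s')"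
    using L unfolding immersion_def by blast+
  have AS: "A \<subseteq> whole S" using A unfolding PC_def path_connectedin_def by blast
  have im: "\<iota> ` A \<subseteq> B" using cont AS unfolding continuous_map_in_subtopology by auto
  have cont': "continuous_map (subtopology (space_of S) A) (space_of T) \<iota>"
    using cont continuous_map_in_subtopology by blast
  have "translation_at S A T \<iota> s" if s: "s \<in> A" for s
  proof -
    obtain U \<phi> V \<psi> v where *: "(U,\<phi>) \<in> charts S" "(V,\<psi>) \<in> charts T" "s \<in> U" "\<iota> ` (U \<inter> A) \<subseteq> V"
      "\<And>s'. s' \<in> U \<inter> A \<Longrightarrow> \<psi> (\<iota> s') = v + \<phi> s'"
      using ch[OF s] by (fastforce simp: case_prod_unfold)
    show ?thesis
    proof (rule translation_atI[OF *(1,2,3)])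
      show "\<iota> s \<in> V" using * s by blast
      show "openin (space_of T) V" by (rule chart_open[OF tT *(2)])
      fix O' assume O': "openin (space_of T) O'" "\<iota> s \<in> O'"
      have "openin (subtopology (space_of S) A) {x \<in> topspace (subtopology (space_of S) A). \<iota> x \<in> O'}"
        using cont' O'(1) unfolding continuous_map_def by blast
      then obtain Q where Q: "openin (space_of S) Q" "{x \<in> topspace (subtopology (space_of S) A). \<iota> x \<in> O'} = Q \<inter> A"
        unfolding openin_subtopology by blast
      have "x \<in> Q \<inter> A \<longleftrightarrow> \<iota> x \<in> O'" if "x \<in> A" for x using Q(2) that AS by auto
      then have "s \<in> Q" "\<iota> ` (Q \<inter> U \<inter> A) \<subseteq> O'" using s O'(2) by auto
      moreover have "\<psi> (\<iota> s') - \<phi> s' = \<psi> (\<iota> s) - \<phi> s" if "s' \<in> Q \<inter> U \<inter> A" for s'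
        using *(5)[of s'] *(5)[of s] that s *(3) by simp
      ultimately show "\<exists>W. openin (space_of S) W \<and> s \<in> W \<and> \<iota> ` (W \<inter> A) \<subseteq> O' \<and> (\<forall>s'\<in>W \<inter> A. \<psi> (\<iota> s') - \<phi> s' = \<psi> (\<iota> s) - \<phi> s)"
        using Q(1) chart_open[OF tS *(1)] *(3) by (intro exI[of _ "Q \<inter> U"] conjI ballI) auto
    qed
  qed
  then show ?R using A B bas im unfolding translation_on_def by blast
next
  note tS = pts_tsurf[OF S] and tT = pts_tsurf[OF T]
  assume R: ?R
  then have A: "A \<in> PC S" "B \<subseteq> whole T" "\<iota> ` A \<subseteq> B" "\<iota> (basept S) = basept T" and t: "translation_on S A T \<iota>" by blast+
  have "continuous_map (subtopology (space_of S) A) (subtopology (space_of T) B) \<iota>"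
    using translation_on_continuous[OF tS tT t] A(3) by (auto simp: continuous_map_in_subtopology)
  moreover have "\<exists>(U,\<phi>)\<in>charts S. \<exists>(V,\<psi>)\<in>charts T. \<exists>v.
        s \<in> U \<and> \<iota> ` (U \<inter> A) \<subseteq> V \<and> (\<forall>s'\<in>U \<inter> A. \<psi> (\<iota> s') = v + \<phi> s')" if s: "s \<in> A" for s
  proof -
    have ts: "translation_at S A T \<iota> s" using t s translation_on_def by metis
    obtain U \<phi> where U: "(U,\<phi>) \<in> charts S" "s \<in> U"
      using chart_cover[OF tS] translation_at_topspace[OF tS tT ts] by metis
    obtain V \<psi> where V: "(V,\<psi>) \<in> charts T" "\<iota> s \<in> V"
      using chart_cover[OF tT] translation_at_topspace[OF tS tT ts] by metis
    obtain W where W: "openin (space_of S) W" "s \<in> W" "W \<subseteq> U" "\<iota> ` (W \<inter> A) \<subseteq> V \<inter> V"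
      "\<And>s'. s' \<in> W \<inter> A \<Longrightarrow> \<psi> (\<iota> s') - \<phi> s' = \<psi> (\<iota> s) - \<phi> s"
      by (rule translation_at_any_chart[OF tS tT ts U V chart_open[OF tT V(1)] V(2)]) (rule that)
    have c: "(W, restrict \<phi> W) \<in> charts S" by (rule chart_restrict[OF S U(1) W(1,3)])
    have "\<psi> (\<iota> s') = (\<psi> (\<iota> s) - \<phi> s) + restrict \<phi> W s'" if "s' \<in> W \<inter> A" for s'
    proof -
      have "\<psi> (\<iota> s') = (\<psi> (\<iota> s') - \<phi> s') + \<phi> s'" by simp
      also have "\<dots> = (\<psi> (\<iota> s) - \<phi> s) + restrict \<phi> W s'" unfolding W(5)[OF that] using that by simp
      finally show ?thesis .
    qed
    then have "\<exists>v. s \<in> W \<and> \<iota> ` (W \<inter> A) \<subseteq> V \<and> (\<forall>s'\<in>W \<inter> A. \<psi> (\<iota> s') = v + restrict \<phi> W s')"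
      using W(2,4) by blast
    then show ?thesis using c V(1) by blast
  qed
  ultimately show ?L using A unfolding immersion_def by blast
qed

lemma immersion_comp:
  assumes S: "pointed_translation_structure S" "pointed_translation_structure T" "pointed_translation_structure Z"
    and f: "immersion S A T (whole T) f"
    and g: "translation_on T (whole T) Z g" "g (basept T) = basept Z"
  shows "immersion S A Z (whole Z) (\<lambda>x. g (f x))"
proof -
  have f': "A \<in> PC S" "f ` A \<subseteq> whole T" "f (basept S) = basept T" "translation_on S A T f"
    using f unfolding immersion_iff[OF S(1,2)] by blast+
  have t: "translation_on S A Z (\<lambda>x. g (f x))"
    by (rule translation_on_comp[OF pts_tsurf[OF S(1)] pts_tsurf[OF S(2)] pts_tsurf[OF S(3)] f'(4) g(1) f'(2)])
  then have "(\<lambda>x. g (f x)) ` A \<subseteq> whole Z"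
    using translation_at_topspace(2)[OF pts_tsurf[OF S(1)] pts_tsurf[OF S(3)]] unfolding translation_on_def by blast
  then show ?thesis unfolding immersion_iff[OF S(1,3)] using f' g t by simp
qed

text \<open>
  The atlases correspond under \<open>h\<close>, and in corresponding charts \<open>h\<close> and its inverse are the identity.
\<close>

lemma isomorphism_translation:
  assumes S: "pointed_translation_structure S" and S': "pointed_translation_structure S'" and h: "isomorphism h S S'"
  defines "k \<equiv> inv_into (whole S) h"
  shows "translation_on S (whole S) S' h" "translation_on S' (whole S') S k"
    "h (basept S) = basept S'" "k (basept S') = basept S" "inj_on k (whole S')"
proof -
  note tS = pts_tsurf[OF S] and tS' = pts_tsurf[OF S']
  have hm: "homeomorphic_map (space_of S) (space_of S') h" and
    hc: "charts S' = (\<lambda>(U,\<phi>). (h ` U, restrict (\<phi> \<circ> k) (h ` U))) ` charts S"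
    using h unfolding isomorphism_def k_def by blast+
  show hb: "h (basept S) = basept S'" using h unfolding isomorphism_def by blast
  have inj: "inj_on h (whole S)" and surj: "h ` whole S = whole S'"
    using hm homeomorphic_imp_injective_map homeomorphic_imp_surjective_map by blast+
  have kh: "k (h x) = x" if "x \<in> whole S" for x unfolding k_def using inj that by simp
  have hk: "h (k y) = y" "k y \<in> whole S" if "y \<in> whole S'" for y
    unfolding k_def using that surj by (auto intro: f_inv_into_f inv_into_into)
  have bS: "basept S \<in> whole S" using S unfolding pointed_translation_structure_def by blast
  show "k (basept S') = basept S" using kh[OF bS] hb by simp
  show "inj_on k (whole S')" using hk(1) by (metis inj_onI)
  have ch: "(h ` U, restrict (\<phi> \<circ> k) (h ` U)) \<in> charts S'" if "(U,\<phi>) \<in> charts S" for U \<phi>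
    unfolding hc using that by force
  have comp: "restrict (\<phi> \<circ> k) (h ` U) (h y) = \<phi> y" if "(U,\<phi>) \<in> charts S" "y \<in> U" for U \<phi> y
    using that kh openin_subset[OF chart_open[OF tS that(1)]] by auto
  show "translation_on S (whole S) S' h"
    unfolding translation_on_def
  proof
    fix s assume s: "s \<in> whole S"
    obtain U \<phi> where U: "(U,\<phi>) \<in> charts S" "s \<in> U" using chart_cover[OF tS s] .
    show "translation_at S (whole S) S' h s"
    proof (rule translation_atI[OF U(1) ch[OF U(1)] U(2)])
      show "h s \<in> h ` U" using U by blast
      show "openin (space_of S') (h ` U)" by (rule chart_open[OF tS' ch[OF U(1)]])
      fix O' assume O': "openin (space_of S') O'" "h s \<in> O'"
      have o: "openin (space_of S) {x \<in> whole S. h x \<in> O'}"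
        using homeomorphic_imp_continuous_map[OF hm] O'(1) unfolding continuous_map_def by blast
      have "restrict (\<phi> \<circ> k) (h ` U) (h s') - \<phi> s' = restrict (\<phi> \<circ> k) (h ` U) (h s) - \<phi> s" if "s' \<in> U" for s'
        using comp[OF U(1) that] comp[OF U(1,2)] by (simp only: diff_self)
      then show "\<exists>W. openin (space_of S) W \<and> s \<in> W \<and> h ` (W \<inter> whole S) \<subseteq> O' \<and>
        (\<forall>s'\<in>W \<inter> whole S. restrict (\<phi> \<circ> k) (h ` U) (h s') - \<phi> s' = restrict (\<phi> \<circ> k) (h ` U) (h s) - \<phi> s)"
        using o chart_open[OF tS U(1)] U(2) s O'
        by (intro exI[of _ "{x \<in> whole S. h x \<in> O'} \<inter> U"] conjI ballI openin_Int) blast+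
    qed
  qed
  show "translation_on S' (whole S') S k"
    unfolding translation_on_def
  proof
    fix s' assume s': "s' \<in> whole S'"
    define s where "s = k s'"
    have s: "s \<in> whole S" "s' = h s" using hk[OF s'] by (auto simp: s_def)
    obtain U \<phi> where U: "(U,\<phi>) \<in> charts S" "s \<in> U" using chart_cover[OF tS s(1)] .
    show "translation_at S' (whole S') S k s'"
    proof (rule translation_atI[OF ch[OF U(1)] U(1)])
      show "s' \<in> h ` U" using U s by blast
      show "k s' \<in> U" using U by (simp add: s_def)
      show "openin (space_of S) U" by (rule chart_open[OF tS U(1)])
      fix O' assume O': "openin (space_of S) O'" "k s' \<in> O'"
      let ?W = "h ` (O' \<inter> U)"
      have o: "openin (space_of S') ?W"
        using homeomorphic_imp_open_map[OF hm] O'(1) chart_open[OF tS U(1)] unfolding open_map_def by blast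
      have OU: "O' \<inter> U \<subseteq> whole S" using openin_subset[OF O'(1)] by blast
      have im: "k ` (?W \<inter> whole S') \<subseteq> O'" using OU kh by auto
      have zero: "\<phi> (k y) - restrict (\<phi> \<circ> k) (h ` U) y = 0" if "y \<in> h ` U" for y
        using that by simp
      show "\<exists>W. openin (space_of S') W \<and> s' \<in> W \<and> k ` (W \<inter> whole S') \<subseteq> O' \<and>
        (\<forall>y\<in>W \<inter> whole S'. \<phi> (k y) - restrict (\<phi> \<circ> k) (h ` U) y = \<phi> (k s') - restrict (\<phi> \<circ> k) (h ` U) s')"
      proof (intro exI[of _ ?W] conjI ballI)
        have "s \<in> O'" using O'(2) s_def by metis
        then show "s' \<in> ?W" using U(2) s(2) by blast
        show "\<phi> (k y) - restrict (\<phi> \<circ> k) (h ` U) y = \<phi> (k s') - restrict (\<phi> \<circ> k) (h ` U) s'"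
          if y: "y \<in> ?W \<inter> whole S'" for y
        proof -
          have "y \<in> h ` U" "s' \<in> h ` U" using y U s by blast+
          then show ?thesis using zero by simp
        qed
      qed (use o im in blast)+
    qed
  qed
qed

text \<open>
  Invariance of domain: in a chart, a piece of \<open>U\<close> becomes the injective continuous image of
  an open subset of the plane.
\<close>

lemma open_disk_openin:
  assumes R: "pointed_translation_structure R" and U: "open_disk R U"
  shows "openin (space_of R) U"
proof (subst openin_subopen, intro ballI)
  note tR = pts_tsurf[OF R]
  have US: "U \<subseteq> whole R" using U unfolding open_disk_def PC_def path_connectedin_def by blast
  obtain h k where hk: "homeomorphic_maps (subtopology (space_of R) U) (top_of_set (ball (0::plane) 1)) h k"
    using U unfolding open_disk_def homeomorphic_space_def by blast
  have topU: "topspace (subtopology (space_of R) U) = U" using US by auto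
  have h1: "homeomorphic_map (subtopology (space_of R) U) (top_of_set (ball (0::plane) 1)) h"
    using hk homeomorphic_maps_map by blast
  have kc: "continuous_map (top_of_set (ball (0::plane) 1)) (subtopology (space_of R) U) k"
    and kh: "\<And>x. x \<in> U \<Longrightarrow> k (h x) = x" and hk': "\<And>y. y \<in> ball 0 1 \<Longrightarrow> h (k y) = y"
    using hk topU unfolding homeomorphic_maps_def by auto
  fix x assume x: "x \<in> U"
  then obtain V \<phi> where V: "(V,\<phi>) \<in> charts R" "x \<in> V" using chart_cover[OF tR] US by blast
  obtain W where W: "openin (space_of R) W" "x \<in> W" "W \<subseteq> V" "open (\<phi> ` W)"
    and inj: "inj_on \<phi> W" and cont: "continuous_map (subtopology (space_of R) W) euclidean \<phi>"
    by (rule chart_homeo[OF tR V]) (rule that)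
  have WR: "W \<subseteq> whole R" using W(1) openin_subset by blast
  define Q where "Q = h ` (U \<inter> W)"
  have Qb: "Q \<subseteq> ball 0 1" using homeomorphic_imp_surjective_map[OF h1] topU by (auto simp: Q_def)
  have "openin (subtopology (space_of R) U) (U \<inter> W)" using W(1) by (metis inf_commute openin_subtopology_Int)
  then have "openin (top_of_set (ball (0::plane) 1)) Q"
    unfolding Q_def using homeomorphic_imp_open_map[OF h1] open_map_def by blast
  then have Qo: "open Q" using openin_open_trans[OF _ open_ball] by blast
  have kQ: "k ` Q = U \<inter> W" unfolding Q_def image_image using kh by auto
  have "continuous_map (top_of_set Q) (space_of R) k"
    using kc Qb continuous_map_from_subtopology_mono continuous_map_in_subtopology by blast
  then have "continuous_map (top_of_set Q) (subtopology (space_of R) W) k"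
    using kQ by (auto simp: continuous_map_in_subtopology)
  from continuous_map_compose[OF this cont] have "continuous_on Q (\<phi> \<circ> k)"
    by simp
  moreover have "inj_on (\<phi> \<circ> k) Q"
  proof (rule comp_inj_on)
    show "inj_on k Q" using hk' Qb by (metis inj_onI subsetD)
    show "inj_on \<phi> (k ` Q)" unfolding kQ using inj by (rule inj_on_subset) blast
  qed
  ultimately have "open ((\<phi> \<circ> k) ` Q)" using Qo invariance_of_domain by blast
  then have o: "open (\<phi> ` (U \<inter> W))" by (simp only: image_comp[symmetric] kQ)
  have "openin (subtopology (space_of R) W) {y \<in> topspace (subtopology (space_of R) W). \<phi> y \<in> \<phi> ` (U \<inter> W)}"
    using cont o unfolding continuous_map_def by auto
  moreover have "{y \<in> topspace (subtopology (space_of R) W). \<phi> y \<in> \<phi> ` (U \<inter> W)} = U \<inter> W"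
    using WR inj by (auto dest: inj_onD)
  ultimately have "openin (space_of R) (U \<inter> W)"
    using W(1) by (simp add: openin_open_subtopology)
  then show "\<exists>Ta. openin (space_of R) Ta \<and> x \<in> Ta \<and> Ta \<subseteq> U"
    using x W(2) by (intro exI[of _ "U \<inter> W"]) auto
qed

section \<open>Immersions into the ultralimit\<close>

context ultralimit
begin

lemma limit_immersion:
  assumes R: "pointed_translation_structure R" and T: "\<And>i. pointed_translation_structure (T i)"
    and U: "open_disk R U"
    and f: "eventually (\<lambda>i. immersion R U (T i) (whole (T i)) (f i)) F"
  shows "immersion R U lim (whole lim) (\<lambda>x. \<kappa> (\<lambda>i. f i x))"
    and "eventually (\<lambda>i. inj_on (f i) U) F \<Longrightarrow> inj_on (\<lambda>x. \<kappa> (\<lambda>i. f i x)) U"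
proof -
  note tR = pts_tsurf[OF R]
  have UPC: "U \<in> PC R" using U by (simp add: open_disk_def)
  have o: "openin (space_of R) U" by (rule open_disk_openin[OF R U])
  have c: "connectedin (space_of R) U" using UPC path_connectedin_imp_connectedin unfolding PC_def by blast
  have b: "basept R \<in> U" using UPC by (simp add: PC_def)
  have ev: "eventually (\<lambda>i. translation_on R U (T i) (f i) \<and> f i (basept R) = basept (T i)) F"
    using f by eventually_elim (use immersion_iff[OF R T] in blast)
  have "translation_on R U lim (\<lambda>x. \<kappa> (\<lambda>i. f i x))" by (rule limit_translation_on[OF tR o c b ev])
  moreover have "\<kappa> (\<lambda>i. f i (basept R)) = basept lim" using limit_basept[OF tR o c b ev] by simp
  moreover have "(\<lambda>x. \<kappa> (\<lambda>i. f i x)) ` U \<subseteq> whole lim"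
    using limit_reachable[OF tR o c b ev] reachable_topspace by auto
  ultimately show "immersion R U lim (whole lim) (\<lambda>x. \<kappa> (\<lambda>i. f i x))"
    unfolding immersion_iff[OF R lim_structure] using UPC by blast
  show "eventually (\<lambda>i. inj_on (f i) U) F \<Longrightarrow> inj_on (\<lambda>x. \<kappa> (\<lambda>i. f i x)) U"
    by (rule limit_inj[OF tR o c b ev])
qed

lemma immersion_lift:
  assumes R: "pointed_translation_structure R" and T: "\<And>i. pointed_translation_structure (T i)"
    and D: "closed_disk R D" and f: "immersion R D lim (whole lim) f"
  obtains g where "eventually (\<lambda>i. immersion R D (T i) (whole (T i)) (g i)) F"
    "\<And>u y. y \<in> D \<Longrightarrow> limitin (space_of R) u y F \<Longrightarrow> eventually (\<lambda>i. u i \<in> D) F \<Longrightarrow>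
       reachable (\<lambda>i. g i (u i)) \<and> \<kappa> (\<lambda>i. g i (u i)) = f y"
proof -
  note tR = pts_tsurf[OF R]
  have f': "D \<in> PC R" "f (basept R) = \<kappa> base" "translation_on R D lim f"
    using f unfolding immersion_iff[OF R lim_structure] by auto
  have bD: "basept R \<in> D" using f'(1) by (simp add: PC_def)
  obtain H where H: "homeomorphic_map (top_of_set ({0..1} \<times> {0..1} :: (real \<times> real) set)) (subtopology (space_of R) D) H"
    using closed_disk_square[OF D] .
  have "D \<subseteq> whole R" using D by (simp add: closed_disk_def)
  have l: "lifts R f D"
    by (rule lifts_square[OF tR f'(3) H \<open>D \<subseteq> whole R\<close>])
  obtain g where g: "eventually (\<lambda>i. translation_on R D (T i) (g i) \<and> g i (basept R) = base i) F"
    "\<And>u y. y \<in> D \<Longrightarrow> limitin (space_of R) u y F \<Longrightarrow> eventually (\<lambda>i. u i \<in> D) F \<Longrightarrow>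
       reachable (\<lambda>i. g i (u i)) \<and> \<kappa> (\<lambda>i. g i (u i)) = f y"
    using l[unfolded lifts_def[OF tR f'(3)], rule_format, OF bD, of base] reachable.base f'(2) by auto
  have "eventually (\<lambda>i. immersion R D (T i) (whole (T i)) (g i)) F"
    using g(1)
  proof eventually_elim
    case (elim i)
    have "g i ` D \<subseteq> whole (T i)"
      using elim translation_at_topspace(2)[OF tR ts] unfolding translation_on_def by blast
    then show ?case unfolding immersion_iff[OF R T] using elim f'(1) by (simp add: base_def)
  qed
  then show ?thesis using that g(2) by blast
qed

text \<open>
  The limit sends \<open>x\<close> to the basepoint, so the lifts send \<open>x\<close> to points that differ from the basepoints by
  short moves. Correcting \<open>x\<close> by the same moves stays in the open set \<open>V\<close>.
\<close>

lemma lift_plus: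
  assumes R: "pointed_translation_structure R" and T: "\<And>i. pointed_translation_structure (T i)"
    and D: "closed_disk R D" and V: "openin (space_of R) V" "V \<subseteq> D"
    and f: "immersion R D lim (whole lim) f" and o: "basept lim \<in> f ` V"
  shows "eventually (\<lambda>i. \<exists>\<iota>. immersion R D (T i) (whole (T i)) \<iota> \<and> basept (T i) \<in> \<iota> ` V) F"
proof -
  note tR = pts_tsurf[OF R]
  obtain g where g: "eventually (\<lambda>i. immersion R D (T i) (whole (T i)) (g i)) F"
    "\<And>u y. y \<in> D \<Longrightarrow> limitin (space_of R) u y F \<Longrightarrow> eventually (\<lambda>i. u i \<in> D) F \<Longrightarrow>
       reachable (\<lambda>i. g i (u i)) \<and> \<kappa> (\<lambda>i. g i (u i)) = f y"
    by (rule immersion_lift[OF R T D f]) (rule that)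
  obtain x where x: "x \<in> V" "f x = \<kappa> base" using o by auto
  have xR: "x \<in> whole R" using x V openin_subset by blast
  have t: "reachable (\<lambda>i. g i x)" "\<kappa> (\<lambda>i. g i x) = \<kappa> base"
    using g(2)[of x "\<lambda>i. x"] x V xR by auto
  obtain r where r: "has_ball R x r" "mv R x ` ball 0 r \<subseteq> V"
    using small_nbhd[OF tR V(1) x(1)] by metis
  have rD: "mv R x ` ball 0 r \<subseteq> D" using r V by blast
  have "near (\<lambda>i. g i x) base" using label[OF t(1) reachable.base] t(2) by blast
  then have "eventually (\<lambda>i. \<exists>v. norm v < r \<and> base i = mv (T i) (g i x) v) F"
    using has_ball_pos[OF r(1)] unfolding near_def by blast
  then show ?thesis
    using g(1)
  proof eventually_elim
    case (elim i)
    then obtain v where v: "norm v < r" "base i = mv (T i) (g i x) v" by blast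
    have "translation_on R D (T i) (g i)" using elim immersion_iff[OF R T] by blast
    from translation_on_mv(2)[OF tR ts this r(1) rD v(1)] have "g i (mv R x v) = basept (T i)"
      using v(2) by (simp add: base_def)
    moreover have "mv R x v \<in> V" using r(2) v(1) by auto
    ultimately have "basept (T i) \<in> g i ` V" by force
    then show ?case using elim by blast
  qed
qed

text \<open>
  If the lifts reached the basepoints at \<open>u i \<in> K\<close>, then the limit would reach its basepoint at the limit of the \<open>u i\<close>
  along \<open>F\<close>, which exists and lies in \<open>K\<close> because \<open>K\<close> is compact.
\<close>

lemma lift_minus:
  assumes R: "pointed_translation_structure R" and T: "\<And>i. pointed_translation_structure (T i)"
    and D: "closed_disk R D" and K: "closedin (space_of R) K" "K \<subseteq> D"
    and f: "immersion R D lim (whole lim) f" and o: "basept lim \<notin> f ` K"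
  shows "eventually (\<lambda>i. \<exists>\<iota>. immersion R D (T i) (whole (T i)) \<iota> \<and> basept (T i) \<notin> \<iota> ` K) F"
proof -
  note tR = pts_tsurf[OF R]
  obtain g where g: "eventually (\<lambda>i. immersion R D (T i) (whole (T i)) (g i)) F"
    "\<And>u y. y \<in> D \<Longrightarrow> limitin (space_of R) u y F \<Longrightarrow> eventually (\<lambda>i. u i \<in> D) F \<Longrightarrow>
       reachable (\<lambda>i. g i (u i)) \<and> \<kappa> (\<lambda>i. g i (u i)) = f y"
    by (rule immersion_lift[OF R T D f]) (rule that)
  have "eventually (\<lambda>i. basept (T i) \<notin> g i ` K) F"
  proof (rule ccontr)
    assume "\<not> ?thesis"
    then have "eventually (\<lambda>i. basept (T i) \<in> g i ` K) F" using ultrafilter_not_eventually[OF ultra] by fastforce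
    then have ev: "eventually (\<lambda>i. (SOME u. u \<in> K \<and> basept (T i) = g i u) \<in> K \<and>
       basept (T i) = g i (SOME u. u \<in> K \<and> basept (T i) = g i u)) F"
    proof eventually_elim
      case (elim i)
      then show ?case by (intro someI_ex[of "\<lambda>u. u \<in> K \<and> basept (T i) = g i u"]) blast
    qed
    define u where "u = (\<lambda>i. SOME u. u \<in> K \<and> basept (T i) = g i u)"
    have u: "eventually (\<lambda>i. u i \<in> K) F" "eventually (\<lambda>i. base i = g i (u i)) F"
      using ev unfolding u_def base_def by (auto elim: eventually_mono)
    have "compactin (space_of R) D"
    proof -
      have "compact_space (subtopology (space_of R) D)"
        using D homeomorphic_compact_space[of "subtopology (space_of R) D" "top_of_set (cball (0::plane) 1)"]
        unfolding closed_disk_def by (simp add: compact_space_subtopology compactin_euclidean_iff)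
      then show ?thesis using D unfolding closed_disk_def compactin_subspace by blast
    qed
    then have "compactin (space_of R) K" using K closed_compactin by blast
    then obtain y where y: "y \<in> K" "limitin (space_of R) u y F"
      using ultrafilter_limit_compactin[OF ultra _ u(1)] by blast
    have "eventually (\<lambda>i. u i \<in> D) F" using u(1) by eventually_elim (use K in blast)
    then have t: "reachable (\<lambda>i. g i (u i))" "\<kappa> (\<lambda>i. g i (u i)) = f y" using g(2)[OF _ y(2)] y(1) K by blast+
    have "\<kappa> base = \<kappa> (\<lambda>i. g i (u i))" by (rule label_cong[OF reachable.base u(2)])
    then show False using o y(1) t(2) by simp
  qed
  with g(1) show ?thesis by eventually_elim blast
qed

end

section \<open>Compactness\<close>

text \<open>
  A disk inside \<open>U\<close> about the basepoint is embedded in every \<open>T i\<close> with the same radius.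
\<close>

lemma surface_family_embeds:
  assumes R: "pointed_translation_structure R" and U: "open_disk R U"
    and F: "ultrafilter F" and T: "\<And>i. pointed_translation_structure (T i)"
    and e: "\<And>i. embeds R U (T i) (whole (T i))"
  obtains \<rho> where "surface_family T F \<rho>"
proof -
  note tR = pts_tsurf[OF R]
  have "basept R \<in> U" using U by (simp add: open_disk_def PC_def)
  then obtain r where r: "has_ball R (basept R) r" "mv R (basept R) ` ball 0 r \<subseteq> U" "inj_on (mv R (basept R)) (ball 0 r)"
    using small_nbhd[OF tR open_disk_openin[OF R U]] by metis
  have "has_ball (T i) (basept (T i)) r \<and> inj_on (mv (T i) (basept (T i))) (ball 0 r)" for i
  proof -
    note tT = pts_tsurf[OF T[of i]]
    obtain f where f: "immersion R U (T i) (whole (T i)) f" "inj_on f U" using e[of i] unfolding embeds_def by blast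
    have f': "translation_on R U (T i) f" "f (basept R) = basept (T i)"
      using f(1) unfolding immersion_iff[OF R T] by blast+
    have b: "has_ball (T i) (basept (T i)) r" and eq: "\<And>v. norm v < r \<Longrightarrow> f (mv R (basept R) v) = mv (T i) (basept (T i)) v"
      using translation_on_mv[OF tR tT f'(1) r(1,2)] unfolding f'(2) by blast+
    have "inj_on (f \<circ> mv R (basept R)) (ball 0 r)"
      using r(2,3) f(2) by (intro comp_inj_on) (auto elim: inj_on_subset)
    then have "inj_on (mv (T i) (basept (T i))) (ball 0 r)"
      by (rule inj_on_cong[THEN iffD1, rotated]) (simp add: eq)
    then show ?thesis using b by blast
  qed
  then have "surface_family T F r"
    by unfold_locales (use F pts_tsurf[OF T] in auto)
  then show ?thesis by (rule that)
qed

lemma iso_rel_refl: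
  assumes "pointed_translation_structure S"
  shows "(S, S) \<in> iso_rel"
proof -
  have inv: "inv_into (whole S) id y = y" if "y \<in> whole S" for y
    using that by (metis id_apply inj_on_id inv_into_f_f)
  have "(\<lambda>(U,\<phi>). (id ` U, restrict (\<phi> \<circ> inv_into (whole S) id) (id ` U))) c = c" if c: "c \<in> charts S" for c
  proof -
    obtain U \<phi> where cU: "c = (U, \<phi>)" by (cases c)
    have "openin (space_of S) U \<and> \<phi> \<in> extensional U"
      using pts_tsurf[OF assms] c unfolding cU tsurf_def translation_atlas_def by blast
    then have "U \<subseteq> whole S" "\<phi> \<in> extensional U" using openin_subset by blast+
    then have "restrict (\<phi> \<circ> inv_into (whole S) id) U = \<phi>"
      using inv by (intro ext) (auto simp: restrict_def extensional_def subset_iff)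
    then show ?thesis by (simp add: cU)
  qed
  then have "(\<lambda>(U,\<phi>). (id ` U, restrict (\<phi> \<circ> inv_into (whole S) id) (id ` U))) ` charts S = charts S"
    by force
  then have "isomorphism id S S"
    unfolding isomorphism_def using homeomorphic_map_id by auto
  then show ?thesis using assms unfolding iso_rel_def by blast
qed

lemma generated_filter_converges:
  assumes "generate_topology_on \<S> O'" "x \<in> O'"
    and "\<And>S. S \<in> \<S> \<Longrightarrow> x \<in> S \<Longrightarrow> eventually (\<lambda>y. y \<in> S) F"
  shows "eventually (\<lambda>y. y \<in> O') F"
  using assms(1,2)
proof induction
  case (Int a b)
  then show ?case by (auto intro: eventually_conj)
next
  case (UN K)
  then obtain k where k: "k \<in> K" "x \<in> k" by blast
  have "eventually (\<lambda>y. y \<in> k) F" by (rule UN.IH[OF k])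
  then show ?case by (rule eventually_mono) (use k in blast)
qed (use assms(3) in auto)

lemma compactinI_ultrafilter:
  assumes K: "K \<subseteq> topspace X"
    and lim: "\<And>F. ultrafilter F \<Longrightarrow> eventually (\<lambda>x. x \<in> K) F \<Longrightarrow>
       \<exists>x\<in>K. \<forall>O'. openin X O' \<and> x \<in> O' \<longrightarrow> eventually (\<lambda>y. y \<in> O') F"
  shows "compactin X K"
  unfolding compactin_def
proof (intro conjI allI impI)
  show "K \<subseteq> topspace X" by (rule K)
  fix \<U> assume \<U>: "(\<forall>U\<in>\<U>. openin X U) \<and> K \<subseteq> \<Union>\<U>"
  show "\<exists>\<F>. finite \<F> \<and> \<F> \<subseteq> \<U> \<and> K \<subseteq> \<Union>\<F>"
  proof (rule ccontr)
    assume "\<not> ?thesis"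
    then have no: "\<not> K \<subseteq> \<Union>\<F>" if "finite \<F>" "\<F> \<subseteq> \<U>" for \<F> using that by blast
    define F0 where "F0 = (INF V\<in>\<U>. principal (K - V))"
    have "F0 \<noteq> bot"
      unfolding F0_def
    proof (rule INF_filter_not_bot)
      fix \<F> assume \<F>: "\<F> \<subseteq> \<U>" "finite \<F>"
      have eq: "(INF V\<in>\<F>. principal (K - V)) = principal (\<Inter>V\<in>\<F>. K - V)"
        by (rule INF_principal_finite[OF \<F>(2)])
      obtain x where "x \<in> K" "x \<notin> \<Union>\<F>" using no[OF \<F>(2,1)] by blast
      then have "x \<in> (\<Inter>V\<in>\<F>. K - V)" by blast
      then show "(INF V\<in>\<F>. principal (K - V)) \<noteq> bot"
        unfolding eq principal_eq_bot_iff by blast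
    qed
    then obtain F where F: "F \<le> F0" "ultrafilter F" by (rule ultrafilter_exists_below)
    have out: "eventually (\<lambda>x. x \<in> K - V) F" if "V \<in> \<U>" for V
    proof -
      have "F \<le> principal (K - V)" using F(1) that unfolding F0_def by (meson INF_lower order_trans)
      then show ?thesis by (simp add: le_principal)
    qed
    obtain x0 where "x0 \<in> K" using no[of "{}"] by auto
    then obtain V0 where "V0 \<in> \<U>" using \<U> by blast
    from out[OF this] have "eventually (\<lambda>x. x \<in> K) F" by (rule eventually_mono) blast
    then obtain x where x: "x \<in> K" "\<And>O'. openin X O' \<Longrightarrow> x \<in> O' \<Longrightarrow> eventually (\<lambda>y. y \<in> O') F"
      using lim[OF F(2)] by blast
    then obtain V where V: "V \<in> \<U>" "x \<in> V" using \<U> by blast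
    have "eventually (\<lambda>y. y \<in> V) F" using x(2) V \<U> by blast
    with out[OF V(1)] have "eventually (\<lambda>_. False) F" by eventually_elim blast
    then show False using ultrafilter_not_False[OF F(2)] by blast
  qed
qed

lemma classes_ofE:
  assumes "c \<in> classes_of P"
  obtains S where "S \<in> c" "P S" "pointed_translation_structure S"
proof -
  obtain S where S: "c \<in> moduli" "S \<in> c" "P S" using assms unfolding classes_of_def by blast
  then obtain S0 where "c = iso_rel `` {S0}" unfolding moduli_def quotient_def by blast
  then have "pointed_translation_structure S" using S(2) unfolding iso_rel_def by blast
  then show ?thesis using that S by blast
qed

theorem theorem14:
  fixes R :: "'a pointed" and U :: "'a set"
  assumes "pointed_translation_structure R"
    and "open_disk R U"
  shows "compactin immersive_topology (classes_of (\<lambda>S. embeds R U S (whole S)))"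
proof (rule compactinI_ultrafilter)
  let ?K = "classes_of (\<lambda>S. embeds R U S (whole S))"
  show "?K \<subseteq> topspace immersive_topology"
    unfolding immersive_topology_def topology_generated_by_topspace classes_of_def by blast
  fix F :: "real pointed set filter" assume F: "ultrafilter F" and FK: "eventually (\<lambda>c. c \<in> ?K) F"
  \<comment> \<open>\<open>S0\<close> is a value for \<open>T\<close> at classes outside \<open>?K\<close>, which \<open>F\<close> does not see\<close>
  obtain c0 where c0: "c0 \<in> ?K" using ultrafilter_eventually_ex[OF F FK] by blast
  obtain S0 :: "real pointed" where S0: "embeds R U S0 (whole S0)" "pointed_translation_structure S0"
    by (rule classes_ofE[OF c0])
  define T where "T = (\<lambda>c. if c \<in> ?K then SOME S. S \<in> c \<and> embeds R U S (whole S) \<and> pointed_translation_structure S else S0)"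
  have T: "T c \<in> c \<and> embeds R U (T c) (whole (T c)) \<and> pointed_translation_structure (T c)" if "c \<in> ?K" for c
  proof -
    have "\<exists>S. S \<in> c \<and> embeds R U S (whole S) \<and> pointed_translation_structure S"
      using that by (rule classes_ofE) blast
    from someI_ex[OF this] show ?thesis using that by (simp add: T_def)
  qed
  have Tp: "pointed_translation_structure (T c)" and Te: "embeds R U (T c) (whole (T c))" for c
    using T[of c] S0 by (cases "c \<in> ?K"; simp add: T_def)+
  obtain \<rho> where fam: "surface_family T F \<rho>"
    by (rule surface_family_embeds[OF assms F Tp Te])
  obtain \<kappa> where "\<forall>a b. surface_family.reachable T F a \<longrightarrow> surface_family.reachable T F b \<longrightarrow>
     (\<kappa> a = \<kappa> b \<longleftrightarrow> surface_family.near T F a b)" and "\<kappa> = (\<kappa> :: _ \<Rightarrow> real)"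
    using surface_family.label_exists[OF fam] by blast
  then interpret ultralimit T F \<rho> \<kappa>
    using fam by (intro ultralimit.intro ultralimit_axioms.intro) auto
  define x where "x = iso_rel `` {lim}"
  have limx: "lim \<in> x" using iso_rel_refl[OF lim_structure] by (simp add: x_def)
  have xm: "x \<in> moduli" unfolding moduli_def x_def by (rule quotientI) (use lim_structure in simp)
  have "\<forall>c. \<exists>f. immersion R U (T c) (whole (T c)) f \<and> inj_on f U" using Te unfolding embeds_def by blast
  then obtain e where e: "\<And>c. immersion R U (T c) (whole (T c)) (e c)" "\<And>c. inj_on (e c) U" by metis
  have "embeds R U lim (whole lim)"
    unfolding embeds_def using limit_immersion[OF assms(1) Tp assms(2), of e] e by (intro exI conjI) auto
  then have xK: "x \<in> ?K" unfolding classes_of_def using xm limx by blast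
  have evK: "eventually (\<lambda>c. c \<in> classes_of P) F" if "eventually (\<lambda>c. P (T c)) F" for P
    using that FK by eventually_elim (use T in \<open>auto simp: classes_of_def\<close>)
  \<comment> \<open>membership of \<open>x\<close> in a subbasic set is witnessed by an isomorphic copy \<open>S\<close> of the limit, not by the limit itself\<close>
  have iso: "\<exists>h k. translation_on lim (whole lim) S h \<and> translation_on S (whole S) lim k \<and> h (basept lim) = basept S \<and>
      k (basept S) = basept lim \<and> inj_on k (whole S) \<and> pointed_translation_structure S" if "S \<in> x" for S
  proof -
    obtain h where "isomorphism h lim S" "pointed_translation_structure S" using \<open>S \<in> x\<close> unfolding x_def iso_rel_def by blast
    then show ?thesis using isomorphism_translation[OF lim_structure, of S h] by blast
  qed
  have sub: "eventually (\<lambda>c. c \<in> Q) F" if Q: "Q \<in> insert moduli immersive_subbasis" "x \<in> Q" for Q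
  proof -
    consider "Q = moduli"
      | R' D where "Q = classes_of (\<lambda>S. immerses R' D S (whole S))" "pointed_translation_structure (R' :: real pointed)" "closed_disk R' D"
      | R' V where "Q = classes_of (\<lambda>S. \<not> immerses R' V S (whole S))" "pointed_translation_structure (R' :: real pointed)" "open_disk R' V"
      | R' D V where "Q = moduli_plus R' D V" "pointed_translation_structure R'" "closed_disk R' D"
         "openin (space_of R') V" "V \<subseteq> space_of R' interior_of D"
      | R' D K where "Q = moduli_minus R' D K" "pointed_translation_structure R'" "closed_disk R' D"
         "closedin (space_of R') K" "K \<subseteq> D"
      using Q(1) unfolding immersive_subbasis_def by blast
    then show ?thesis
    proof cases
      case 1
      show ?thesis unfolding 1 using FK by eventually_elim (simp add: classes_of_def)
    next
      case 2
      obtain S where S: "S \<in> x" "immerses R' D S (whole S)" using Q(2) unfolding 2(1) classes_of_def by blast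
      obtain k where k: "translation_on S (whole S) lim k" "k (basept S) = basept lim" "pointed_translation_structure S"
        using iso[OF S(1)] by blast
      obtain \<iota> where "immersion R' D S (whole S) \<iota>" using S(2) unfolding immerses_def by blast
      from immersion_comp[OF 2(2) k(3) lim_structure this k(1,2)]
      obtain g where "eventually (\<lambda>c. immersion R' D (T c) (whole (T c)) (g c)) F"
        using immersion_lift[OF 2(2) Tp 2(3)] by blast
      then have "eventually (\<lambda>c. immerses R' D (T c) (whole (T c))) F"
        by eventually_elim (auto simp: immerses_def)
      then show ?thesis unfolding 2(1) by (rule evK)
    next
      case 3
      obtain S where S: "S \<in> x" "\<not> immerses R' V S (whole S)" using Q(2) unfolding 3(1) classes_of_def by blast
      obtain h where h: "translation_on lim (whole lim) S h" "h (basept lim) = basept S" "pointed_translation_structure S"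
        using iso[OF S(1)] by blast
      have "eventually (\<lambda>c. \<not> immerses R' V (T c) (whole (T c))) F"
      proof (rule ccontr)
        assume "\<not> ?thesis"
        then have "eventually (\<lambda>c. immerses R' V (T c) (whole (T c))) F"
          using ultrafilter_not_eventually[OF F] by fastforce
        then have "eventually (\<lambda>c. immersion R' V (T c) (whole (T c)) (SOME f. immersion R' V (T c) (whole (T c)) f)) F"
          unfolding immerses_def
        proof eventually_elim
          case (elim c)
          show ?case by (rule someI_ex[OF elim])
        qed
        from immersion_comp[OF 3(2) lim_structure h(3) limit_immersion(1)[OF 3(2) Tp 3(3) this] h(1,2)]
        show False using S(2) unfolding immerses_def by blast
      qed
      then show ?thesis unfolding 3(1) by (rule evK)
    next
      case 4
      obtain S \<iota> where S: "S \<in> x" "immersion R' D S (whole S) \<iota>" "basept S \<in> \<iota> ` V"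
      proof -
        have "x \<in> classes_of (\<lambda>S. \<exists>\<iota>. immersion R' D S (whole S) \<iota> \<and> basept S \<in> \<iota> ` V)"
          using Q(2) unfolding 4(1) moduli_plus_def .
        then have "\<exists>S\<in>x. \<exists>\<iota>. immersion R' D S (whole S) \<iota> \<and> basept S \<in> \<iota> ` V"
          unfolding classes_of_def mem_Collect_eq by (rule conjunct2)
        then show ?thesis using that by (elim bexE exE conjE)
      qed
      obtain k where k: "translation_on S (whole S) lim k" "k (basept S) = basept lim" "pointed_translation_structure S"
        using iso[OF S(1)] by blast
      have VD: "V \<subseteq> D" by (rule order_trans[OF 4(5) interior_of_subset])
      have b: "basept lim \<in> (\<lambda>y. k (\<iota> y)) ` V" using S(3) k(2) by (metis imageE imageI)
      show ?thesis unfolding 4(1) moduli_plus_def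
        by (rule evK[OF lift_plus[OF 4(2) Tp 4(3,4) VD immersion_comp[OF 4(2) k(3) lim_structure S(2) k(1,2)] b]])
    next
      case 5
      obtain S \<iota> where S: "S \<in> x" "immersion R' D S (whole S) \<iota>" "basept S \<notin> \<iota> ` K"
      proof -
        have "x \<in> classes_of (\<lambda>S. \<exists>\<iota>. immersion R' D S (whole S) \<iota> \<and> basept S \<notin> \<iota> ` K)"
          using Q(2) unfolding 5(1) moduli_minus_def .
        then have "\<exists>S\<in>x. \<exists>\<iota>. immersion R' D S (whole S) \<iota> \<and> basept S \<notin> \<iota> ` K"
          unfolding classes_of_def mem_Collect_eq by (rule conjunct2)
        then show ?thesis using that by (elim bexE exE conjE)
      qed
      obtain k where k: "translation_on S (whole S) lim k" "k (basept S) = basept lim" "pointed_translation_structure S"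
          "inj_on k (whole S)"
        using iso[OF S(1)] by blast
      have im: "\<iota> ` D \<subseteq> whole S" using S(2) unfolding immersion_iff[OF 5(2) k(3)] by blast
      have bS: "basept S \<in> whole S" using k(3) unfolding pointed_translation_structure_def by blast
      have b: "basept lim \<notin> (\<lambda>y. k (\<iota> y)) ` K"
      proof
        assume "basept lim \<in> (\<lambda>y. k (\<iota> y)) ` K"
        then obtain y where y: "y \<in> K" "k (\<iota> y) = k (basept S)" using k(2) by auto
        have "\<iota> y \<in> whole S" using y im 5(5) by blast
        then have "\<iota> y = basept S" using inj_onD[OF k(4) y(2)] bS by blast
        with y(1) have "basept S \<in> \<iota> ` K" by (intro image_eqI[of _ \<iota> y]) simp_all
        then show False using S(3) by simp
      qed
      show ?thesis unfolding 5(1) moduli_minus_def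
        by (rule evK[OF lift_minus[OF 5(2) Tp 5(3,4,5) immersion_comp[OF 5(2) k(3) lim_structure S(2) k(1,2)] b]])
    qed
  qed
  show "\<exists>x\<in>?K. \<forall>O'. openin immersive_topology O' \<and> x \<in> O' \<longrightarrow> eventually (\<lambda>y. y \<in> O') F"
    using xK generated_filter_converges[OF _ _ sub]
    unfolding immersive_topology_def openin_topology_generated_by_iff by blast
qed

end
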